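(* Let $c_0>0$, $\beta_2\ge0$, $K_0<0$, $K_2<0$. In the system (S$_\varepsilon$) (the reduced equations for $\theta=\tfrac{\pi}{6}$), for all sufficiently small $\varepsilon\geq 0$, the following heteroclinic orbits exist. (i) If $K_2<K_0$, then for every $\mu_0>0$ there is a heteroclinic orbit converging to the down-hexagon equilibrium $\mathbf{A}_{H_-}$ as $\Xi\to-\infty$ and to the trivial equilibrium $\mathbf{A}_T$ as $\Xi\to+\infty$. (ii) If $K_2\in(K_0,0)$, set $$\mu_1=-\frac{\beta_2^2K_0}{2\sqrt2\sqrt{K_0(K_0+K_2)^3}-2K_0(K_0+3K_2)}.$$ For every $\mu_0\in(0,\mu_1)$ there is a heteroclinic orbit from $\mathbf{A}_{H_-}$ to $\mathbf{A}_T$ as in (i), and for every $\mu_0>\mu_1$ there is a heteroclinic orbit converging to the roll-wave equilibrium $\mathbf{A}_R$ as $\Xi\to-\infty$ and to $\mathbf{A}_T$ as $\Xi\to+\infty$.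
   Context: System (S$_\varepsilon$), for real-valued unknowns $(A_1,B_1,A_2,A_3,B_3)\in\mathbb{R}^5$, with $\mathbf{d}=(\cos\tfrac\pi6,\sin\tfrac\pi6)$, so that $4(\mathbf{d}\cdot\mathbf{k}_1)^2=4(\mathbf{d}\cdot\mathbf{k}_3)^2=3$ and $\mathbf{d}\cdot\mathbf{k}_2=0$ for $\mathbf{k}_1=(1,0)$, $\mathbf{k}_2=\tfrac12(-1,\sqrt3)$, $\mathbf{k}_3=-\tfrac12(1,\sqrt3)$: $$\begin{aligned}\partial_\Xi A_1&=B_1,\\ 3\,\partial_\Xi B_1&=-\mu_0A_1-c_0B_1-\beta_2A_2A_3-(K_0A_1^2+K_2(A_2^2+A_3^2))A_1+\mathcal{O}(\varepsilon),\\ c_0\,\partial_\Xi A_2&=-\mu_0A_2-\beta_2A_1A_3-(K_0A_2^2+K_2(A_1^2+A_3^2))A_2+\mathcal{O}(\varepsilon),\\ \partial_\Xi A_3&=B_3,\\ 3\,\partial_\Xi B_3&=-\mu_0A_3-c_0B_3-\beta_2A_1A_2-(K_0A_3^2+K_2(A_1^2+A_2^2))A_3+\mathcal{O}(\varepsilon).\end{aligned}$$ The $\mathcal{O}(\varepsilon)$ terms are higher-order terms of a centre manifold reduction: differentiable real-valued functions vanishing at the origin which are, together with their first derivatives, $\mathcal{O}(\varepsilon)$ uniformly on bounded sets (and absent for $\varepsilon=0$). Equilibria at leading order (with $B_1=B_3=0$): $\mathbf{A}_T=(0,0,0)$; $\mathbf{A}_R=(\pm\sqrt{-\mu_0/K_0},0,0)$,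 understood up to the symmetry permuting the indices; $\mathbf{A}_{H_-}=(a,a,a)$, $a=\frac{-\beta_2+\sqrt{\beta_2^2-4\mu_0(K_0+2K_2)}}{2(K_0+2K_2)}$. For $\varepsilon>0$ the same names denote the equilibria of (S$_\varepsilon$) which agree with these to leading order, i.e. up to $\mathcal{O}(\varepsilon)$.
   Formalization: The smallness threshold for ε may depend on μ0 (μ0 is fixed before ε); a threshold uniform in μ0 is impossible: for β2=0 and higher-order terms εA_j, no nontrivial equilibrium exists when 0<μ0≤ε. *)

theory Defs
  imports "HOL-Analysis.Analysis"
begin

text \<open>Points of phase space are \<open>(A1, B1, A2, A3, B3)\<close>.\<close>

type_synonym state = "real \<times> real \<times> real \<times> real \<times> real"

text \<open>
  The system solved for the derivatives. The factor 3 on the left of the \<open>B1\<close> and \<open>B3\<close> equations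
  is \<open>4 (d \<cdot> k\<^sub>j)\<^sup>2\<close> for \<open>j = 1, 3\<close>. The functions \<open>r1\<close>, \<open>r2\<close>, \<open>r3\<close> are the \<open>O(\<epsilon>)\<close> terms of the
  \<open>B1\<close>, \<open>A2\<close> and \<open>B3\<close> equations at a fixed \<open>\<epsilon>\<close>.
\<close>

definition reduced_field ::
  "real \<Rightarrow> real \<Rightarrow> real \<Rightarrow> real \<Rightarrow> real \<Rightarrow> (state \<Rightarrow> real) \<Rightarrow> (state \<Rightarrow> real) \<Rightarrow> (state \<Rightarrow> real)
    \<Rightarrow> state \<Rightarrow> state" where
  "reduced_field c0 \<beta>2 K0 K2 \<mu>0 r1 r2 r3 = (\<lambda>(A1, B1, A2, A3, B3).
     (B1,
      (- \<mu>0 * A1 - c0 * B1 - \<beta>2 * A2 * A3 - (K0 * A1^2 + K2 * (A2^2 + A3^2)) * A1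
         + r1 (A1, B1, A2, A3, B3)) / 3,
      (- \<mu>0 * A2 - \<beta>2 * A1 * A3 - (K0 * A2^2 + K2 * (A1^2 + A3^2)) * A2
         + r2 (A1, B1, A2, A3, B3)) / c0,
      B3,
      (- \<mu>0 * A3 - c0 * B3 - \<beta>2 * A1 * A2 - (K0 * A3^2 + K2 * (A1^2 + A2^2)) * A3
         + r3 (A1, B1, A2, A3, B3)) / 3))"

text \<open>
  A family \<open>\<epsilon> \<mapsto> r \<epsilon>\<close> of higher-order terms. The bound on the family and its first derivative
  is required on each ball for \<open>\<epsilon>\<close> below a threshold that may depend on the ball.
\<close>

definition higher_order_term :: "(real \<Rightarrow> state \<Rightarrow> real) \<Rightarrow> bool" where
  "higher_order_term r \<longleftrightarrow>
     (\<forall>x. r 0 x = 0) \<and>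
     (\<forall>\<epsilon>\<ge>0. r \<epsilon> 0 = 0 \<and> (\<forall>x. r \<epsilon> differentiable (at x))) \<and>
     (\<forall>\<rho>. \<exists>C. \<exists>\<epsilon>1>0. \<forall>\<epsilon>\<in>{0..<\<epsilon>1}. \<forall>x. norm x \<le> \<rho> \<longrightarrow>
        \<bar>r \<epsilon> x\<bar> \<le> C * \<epsilon> \<and> onorm (frechet_derivative (r \<epsilon>) (at x)) \<le> C * \<epsilon>)"

definition heteroclinic_orbit ::
  "(state \<Rightarrow> state) \<Rightarrow> state \<Rightarrow> state \<Rightarrow> (real \<Rightarrow> state) \<Rightarrow> bool" where
  "heteroclinic_orbit F P Q X \<longleftrightarrow>
     F P = 0 \<and> F Q = 0 \<and> P \<noteq> Q \<and>
     (\<forall>\<xi>. (X has_vector_derivative F (X \<xi>)) (at \<xi>)) \<and>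
     (X \<longlongrightarrow> P) at_bot \<and> (X \<longlongrightarrow> Q) at_top"

definition equilibrium_state :: "real \<times> real \<times> real \<Rightarrow> state" where
  "equilibrium_state = (\<lambda>(A1, A2, A3). (A1, 0, A2, A3, 0))"

definition A_T :: state where
  "A_T = equilibrium_state (0, 0, 0)"

definition A_H_minus :: "real \<Rightarrow> real \<Rightarrow> real \<Rightarrow> real \<Rightarrow> state" where
  "A_H_minus \<beta>2 K0 K2 \<mu>0 =
     (let a = (- \<beta>2 + sqrt (\<beta>2^2 - 4 * \<mu>0 * (K0 + 2 * K2))) / (2 * (K0 + 2 * K2))
      in equilibrium_state (a, a, a))"

text \<open>All roll waves: both signs, and all permutations of the indices.\<close>

definition A_R :: "real \<Rightarrow> real \<Rightarrow> state set" where
  "A_R K0 \<mu>0 =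
     (\<Union>s\<in>{sqrt (- \<mu>0 / K0), - sqrt (- \<mu>0 / K0)}.
        equilibrium_state ` {(s, 0, 0), (0, s, 0), (0, 0, s)})"

definition mu1 :: "real \<Rightarrow> real \<Rightarrow> real \<Rightarrow> real" where
  "mu1 \<beta>2 K0 K2 =
     - (\<beta>2^2 * K0 / (2 * sqrt 2 * sqrt (K0 * (K0 + K2)^3) - 2 * K0 * (K0 + 3 * K2)))"

text \<open>
  For all sufficiently small \<open>\<epsilon> \<ge> 0\<close> the field \<open>F \<epsilon>\<close> has a heteroclinic orbit to the trivial
  equilibrium from an equilibrium that agrees with \<open>P0\<close> up to \<open>O(\<epsilon>)\<close>. The trivial equilibrium
  itself does not move with \<open>\<epsilon>\<close>, because the higher-order terms vanish at the origin.
\<close>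

definition heteroclinic_to_trivial :: "(real \<Rightarrow> state \<Rightarrow> state) \<Rightarrow> state \<Rightarrow> bool" where
  "heteroclinic_to_trivial F P0 \<longleftrightarrow>
     (\<exists>C. \<exists>\<epsilon>0>0. \<forall>\<epsilon>\<in>{0..<\<epsilon>0}. \<exists>P X.
        dist P P0 \<le> C * \<epsilon> \<and> heteroclinic_orbit (F \<epsilon>) P A_T X)"

end

theory Submission
  imports Defs
begin

text \<open>
  The system at \<open>\<epsilon> = 0\<close> is gradient-like: its forces are the negative partial derivatives of a quartic potential
  \<open>U (A1, A2, A3)\<close>. The components \<open>A1\<close> and \<open>A3\<close> move like damped particles in this potential and \<open>A2\<close>
  follows its negative gradient. Adding to the energy \<open>3/2 (B1\<^sup>2 + B3\<^sup>2) + U\<close> a small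
  multiple of \<open>(B1 + \<partial>\<^sub>1U)\<^sup>2 + (B3 + \<partial>\<^sub>3U)\<^sup>2\<close> gives a function \<open>V \<ge> U\<close> that
  decreases on a given ball at a rate comparable to the squared length of the vector field, whereas the
  dissipation of the energy itself vanishes wherever \<open>B1 = B3 = \<partial>\<^sub>2U = 0\<close>.

  Since \<open>U\<close> is a positive quadratic part plus a cubic part plus a negative quartic part, it first
  increases and then decreases along every ray from the origin. The points where it still increases,
  \<open>A \<bullet> \<nabla>U \<ge> 0\<close>, form a star-shaped well around the trivial state. Let \<open>P\<close> be a nondegenerate equilibrium at which
  \<open>U\<close> is minimal on the rim \<open>A \<bullet> \<nabla>U = 0\<close>, \<open>A \<noteq> 0\<close> of the well, a mountain pass, and let \<open>c\<close> be its level.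
  An orbit in the well with \<open>V < c\<close> cannot reach the rim, and the trivial state is the
  only equilibrium there, so the orbit converges to it. One branch of
  the unstable set of \<open>P\<close> descends into this part of the well, and this is the heteroclinic orbit.

  The argument survives small Lipschitz perturbations of the field (\<open>heteroclinic_orbit_persists\<close>): the
  equilibrium \<open>P\<close> moves to some \<open>p\<close> by Brouwer's theorem; the function \<open>y \<mapsto> V (P + y) - c\<close> still decreases strictly
  along the perturbed flow written in the coordinates \<open>y = x - p\<close>, so that a cone around the unstable direction is
  forward invariant, and a subsequence of the orbits started in this cone at points tending to \<open>p\<close> converges to an
  orbit that leaves \<open>p\<close> and reaches a fixed level below \<open>c\<close> (\<open>unstable_orbit\<close>); from
  there on strict decrease of \<open>V\<close> is again robust, because the perturbation is at most a small multiple of the distance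
  to the origin.

  It remains to find the lowest point of the rim. On a sphere the potential depends only on the product of the coordinates and on
  the second symmetric function of their squares, and for each value of the latter the worst direction has two coordinates
  of equal modulus. In the plane of these directions, for \<open>K0 < K2\<close>, the ridge of \<open>U\<close> over the third coordinate is a quartic
  polynomial without a minimum strictly between the hexagon and the roll wave, so one of these two is
  lowest (\<open>hex_or_roll_lowest\<close>). Comparing their levels is a quadratic inequality for the hexagon
  amplitude, and its root corresponds to \<open>\<mu>\<^sub>0 = mu1\<close>. For \<open>K2 < K0\<close> a comparison on a single sphere shows
  that the hexagon is lowest (\<open>hex_lowest_of_K2_le_K0\<close>).
\<close>

section \<open>Differential equations with a Lipschitz right-hand side\<close>

lemma antiderivative_exists:
  fixes h :: "real \<Rightarrow> 'a::banach"
  assumes "continuous_on UNIV h"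
  obtains H where "H 0 = 0" "\<And>t. (H has_vector_derivative h t) (at t)"
proof -
  define H where "H t = (if 0 \<le> t then integral {0..t} h else - integral {t..0} h)" for t
  have int: "h integrable_on {a..b}" for a b
    by (rule integrable_continuous_real) (rule continuous_on_subset[OF assms subset_UNIV])
  have H_eq: "H t = integral {-n..t} h - integral {-n..0} h" if "-n \<le> t" "0 \<le> n" for n t
  proof (cases "0 \<le> t")
    case True
    then have "integral {-n..0} h + integral {0..t} h = integral {-n..t} h"
      using that by (intro Henstock_Kurzweil_Integration.integral_combine int) auto
    then show ?thesis using True by (simp add: H_def algebra_simps)
  next
    case False
    then have "integral {-n..t} h + integral {t..0} h = integral {-n..0} h"
      using that by (intro Henstock_Kurzweil_Integration.integral_combine int) auto
    then show ?thesis using False by (simp add: H_def algebra_simps)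
  qed
  have "(H has_vector_derivative h t) (at t)" for t
  proof -
    define n where "n = \<bar>t\<bar> + 1"
    have t: "-n < t" "t < n" and n: "0 \<le> n" by (auto simp: n_def)
    have "((\<lambda>u. integral {-n..u} h) has_vector_derivative h t) (at t within {-n..n})"
      using t by (intro integral_has_vector_derivative continuous_on_subset[OF assms subset_UNIV]) auto
    then have "((\<lambda>u. integral {-n..u} h - integral {-n..0} h) has_vector_derivative h t)
        (at t within {-n..n})"
      by (auto intro!: derivative_eq_intros)
    then have "((\<lambda>u. integral {-n..u} h - integral {-n..0} h) has_vector_derivative h t)
        (at t within {-n<..<n})"
      by (rule has_vector_derivative_within_subset) auto
    then have "((\<lambda>u. integral {-n..u} h - integral {-n..0} h) has_vector_derivative h t) (at t)"
      using at_within_open[of t "{-n<..<n}"] t by (simp only: open_greaterThanLessThan greaterThanLessThan_iff)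
    then show ?thesis
      by (rule has_vector_derivative_transform_within_open[where S="{-n<..<n}"])
        (use t n in \<open>simp_all add: H_eq[where n = n]\<close>)
  qed
  moreover have "H 0 = 0" by (simp add: H_def)
  ultimately show ?thesis using that by blast
qed

lemma has_vector_derivative_reflect:
  assumes "(X has_vector_derivative d) (at (- t))"
  shows "((\<lambda>t. X (- t)) has_vector_derivative - d) (at t)"
proof -
  have "(uminus has_vector_derivative - 1) (at t)"
    by (auto intro!: derivative_eq_intros)
  from vector_diff_chain_at[OF this, of X d] assms show ?thesis
    by (simp add: o_def)
qed

text \<open>
  The exponential weight is that of the norm in which the Picard operator below contracts on the whole line.
\<close>

lemma norm_antiderivative_le:
  fixes H :: "real \<Rightarrow> 'a::banach"
  assumes H: "H 0 = 0" "\<And>t. (H has_vector_derivative h t) (at t)"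
    and le: "\<And>t. norm (h t) \<le> a * exp (L * \<bar>t\<bar>)" and L: "L > 0"
  shows "norm (H t) \<le> a / L * exp (L * \<bar>t\<bar>)"
proof -
  have a: "a \<ge> 0"
    using order_trans[OF norm_ge_zero le[of 0]] by simp
  have pos: "norm (W t) \<le> a / L * exp (L * t)"
    if W: "W 0 = 0" "\<And>t. (W has_vector_derivative w t) (at t)"
      and w: "\<And>t. norm (w t) \<le> a * exp (L * \<bar>t\<bar>)" and t: "t > 0"
    for W w :: "real \<Rightarrow> 'a" and t
  proof -
    have "norm (W t - W 0) \<le> a / L * exp (L * t) - a / L * exp (L * 0)"
    proof (rule differentiable_bound_general[OF t])
      show "continuous_on {0..t} W"
        using W(2) by (meson continuous_at_imp_continuous_on has_vector_derivative_continuous)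
      show "continuous_on {0..t} (\<lambda>t. a / L * exp (L * t))"
        by (intro continuous_intros)
      show "(W has_vector_derivative w x) (at x)" for x by (rule W)
      show "((\<lambda>t. a / L * exp (L * t)) has_vector_derivative a * exp (L * x)) (at x)" for x
        using L by (auto intro!: derivative_eq_intros simp flip: has_real_derivative_iff_has_vector_derivative)
      show "norm (w x) \<le> a * exp (L * x)" if "0 < x" for x
        using w[of x] that by simp
    qed
    moreover have "a / L \<ge> 0" using a L by simp
    ultimately show ?thesis using W(1) by simp
  qed
  consider "t > 0" | "t = 0" | "t < 0" by linarith
  then show ?thesis
  proof cases
    case 1
    then show ?thesis using pos[OF H le] by simp
  next
    case 2
    then show ?thesis using H(1) a L by simp
  next
    case 3
    have "norm ((\<lambda>t. H (- t)) (- t)) \<le> a / L * exp (L * - t)"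
    proof (rule pos[where w = "\<lambda>t. - h (- t)"])
      show "((\<lambda>t. H (- t)) has_vector_derivative - h (- t)) (at t)" for t
        by (rule has_vector_derivative_reflect) (rule H)
    qed (use H 3 le[of "- x" for x] in auto)
    then show ?thesis using 3 by simp
  qed
qed

text \<open>
  One contraction suffices for all times: the Picard operator acts on \<open>y t = exp (- 2 K \<bar>t\<bar>) (X t - x0)\<close>
  in the space of bounded continuous functions, where its Lipschitz constant is \<open>1/2\<close>.
\<close>

theorem global_solution_exists:
  fixes G :: "'a::banach \<Rightarrow> 'a"
  assumes K: "K > 0" and Lip: "\<And>x y. norm (G x - G y) \<le> K * norm (x - y)"
  obtains X where "X 0 = x0" "\<And>t. (X has_vector_derivative G (X t)) (at t)"
proof -
  define h where "h y s = G (x0 + exp (2 * K * \<bar>s\<bar>) *\<^sub>R apply_bcontfun y s)"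
    for y :: "real \<Rightarrow>\<^sub>C 'a" and s :: real
  have contG: "continuous_on UNIV G"
    using K Lip by (intro lipschitz_on_continuous_on[of K] lipschitz_onI) (auto simp: dist_norm)
  have "continuous_on UNIV (h y)" for y
    unfolding h_def
    by (intro continuous_on_compose2[OF contG] continuous_intros) auto
  then have "\<exists>H. H 0 = 0 \<and> (\<forall>t. (H has_vector_derivative h y t) (at t))" for y
    by (metis antiderivative_exists)
  then obtain H where H0: "\<And>y. H y 0 = 0"
    and H: "\<And>y t. (H y has_vector_derivative h y t) (at t)"
    by metis
  have diff: "norm (H y t - H z t) \<le> dist y z / 2 * exp (2 * K * \<bar>t\<bar>)" for y z t
  proof -
    have "norm (H y t - H z t) \<le> (K * dist y z) / (2 * K) * exp (2 * K * \<bar>t\<bar>)"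
    proof (rule norm_antiderivative_le[where h = "\<lambda>t. h y t - h z t"])
      fix t
      have "norm (h y t - h z t) \<le> K * norm (exp (2 * K * \<bar>t\<bar>) *\<^sub>R (apply_bcontfun y t - apply_bcontfun z t))"
        unfolding h_def by (rule order_trans[OF Lip]) (simp add: algebra_simps)
      also have "\<dots> \<le> K * (exp (2 * K * \<bar>t\<bar>) * dist y z)"
        using K dist_bounded[of y t z] by (auto simp: dist_norm)
      finally show "norm (h y t - h z t) \<le> K * dist y z * exp (2 * K * \<bar>t\<bar>)"
        by (simp add: mult_ac)
    qed (use K H H0 in \<open>auto intro!: derivative_eq_intros\<close>)
    then show ?thesis using K by simp
  qed
  have bound: "norm (H y t) \<le> (norm (G x0) + K * norm y) / (2 * K) * exp (2 * K * \<bar>t\<bar>)" for y t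
  proof (rule norm_antiderivative_le[OF H0 H])
    fix t
    have "norm (h y t) \<le> norm (G x0) + norm (h y t - G x0)"
      using norm_triangle_ineq[of "G x0" "h y t - G x0"] by simp
    also have "norm (h y t - G x0) \<le> K * (exp (2 * K * \<bar>t\<bar>) * norm y)"
      unfolding h_def using K norm_bounded[of y t]
      by (intro order_trans[OF Lip]) (auto simp: algebra_simps)
    also have "norm (G x0) \<le> norm (G x0) * exp (2 * K * \<bar>t\<bar>)"
      using K by (simp add: mult_le_cancel_left1)
    finally show "norm (h y t) \<le> (norm (G x0) + K * norm y) * exp (2 * K * \<bar>t\<bar>)"
      by (simp add: algebra_simps)
  qed (use K in auto)
  define \<Phi> where "\<Phi> y t = exp (- (2 * K * \<bar>t\<bar>)) *\<^sub>R H y t" for y t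
  have \<Phi>: "\<Phi> y \<in> bcontfun" for y
  proof (rule bcontfun_normI)
    have "continuous_on UNIV (H y)"
      using H by (meson continuous_at_imp_continuous_on has_vector_derivative_continuous)
    then show "continuous_on UNIV (\<Phi> y)"
      unfolding \<Phi>_def by (intro continuous_intros)
    fix t
    have "norm (\<Phi> y t) \<le> exp (- (2 * K * \<bar>t\<bar>)) * ((norm (G x0) + K * norm y) / (2 * K) * exp (2 * K * \<bar>t\<bar>))"
      unfolding \<Phi>_def norm_scaleR abs_exp_cancel
      by (intro mult_left_mono bound) auto
    also have "\<dots> = (norm (G x0) + K * norm y) / (2 * K)"
      using K by (simp add: exp_minus divide_simps)
    finally show "norm (\<Phi> y t) \<le> (norm (G x0) + K * norm y) / (2 * K)" .
  qed
  have "dist (Bcontfun (\<Phi> y)) (Bcontfun (\<Phi> z)) \<le> 1 / 2 * dist y z" for y z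
  proof (rule dist_bound)
    fix t
    have "dist (Bcontfun (\<Phi> y) t) (Bcontfun (\<Phi> z) t) = exp (- (2 * K * \<bar>t\<bar>)) * norm (H y t - H z t)"
      by (simp add: Bcontfun_inverse[OF \<Phi>] \<Phi>_def dist_norm flip: scaleR_diff_right)
    also have "\<dots> \<le> exp (- (2 * K * \<bar>t\<bar>)) * (dist y z / 2 * exp (2 * K * \<bar>t\<bar>))"
      using diff by simp
    also have "\<dots> = 1 / 2 * dist y z"
      by (simp add: exp_minus field_simps)
    finally show "dist (Bcontfun (\<Phi> y) t) (Bcontfun (\<Phi> z) t) \<le> 1 / 2 * dist y z" .
  qed
  then have "\<exists>!y. Bcontfun (\<Phi> y) = y"
    by (intro banach_fix_type[of "1/2"]) auto
  then obtain y where "Bcontfun (\<Phi> y) = y" by blast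
  then have y: "apply_bcontfun y t = \<Phi> y t" for t
    by (metis Bcontfun_inverse \<Phi>)
  have "h y t = G (x0 + H y t)" for t
    unfolding h_def y \<Phi>_def by (simp add: exp_minus)
  then have "((\<lambda>t. x0 + H y t) has_vector_derivative G (x0 + H y t)) (at t)" for t
    using H[of y t] by (auto intro!: derivative_eq_intros)
  then show ?thesis
    using that[of "\<lambda>t. x0 + H y t"] H0 by simp
qed

text \<open>
  The derivative of \<open>f t * exp (- c t)\<close> has the sign of \<open>f' - c f\<close>, whatever the signs of \<open>f\<close> and \<open>c\<close>; both
  signs of each occur below.
\<close>

lemma differential_inequality_exp:
  fixes f :: "real \<Rightarrow> real"
  assumes "a \<le> b"
    and der: "\<And>t. a \<le> t \<Longrightarrow> t \<le> b \<Longrightarrow> (f has_real_derivative f' t) (at t)"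
    and le: "\<And>t. a \<le> t \<Longrightarrow> t \<le> b \<Longrightarrow> f' t \<le> c * f t"
  shows "f b \<le> f a * exp (c * (b - a))"
proof -
  have "f b * exp (- c * (b - a)) \<le> f a * exp (- c * (a - a))"
  proof (rule DERIV_nonpos_imp_nonincreasing[OF \<open>a \<le> b\<close>])
    fix t assume t: "a \<le> t" "t \<le> b"
    have "((\<lambda>t. f t * exp (- c * (t - a))) has_real_derivative
        (f' t - c * f t) * exp (- c * (t - a))) (at t)"
      using der[OF t] by (auto intro!: derivative_eq_intros simp: algebra_simps)
    moreover have "(f' t - c * f t) * exp (- c * (t - a)) \<le> 0"
      using le[OF t] by (simp add: mult_nonpos_nonneg)
    ultimately show "\<exists>y. ((\<lambda>t. f t * exp (- c * (t - a))) has_real_derivative y) (at t) \<and> y \<le> 0"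
      by blast
  qed
  then have "f b * exp (- c * (b - a)) * exp (c * (b - a)) \<le> f a * exp (c * (b - a))"
    by (intro mult_right_mono) auto
  then show ?thesis by (simp add: mult.assoc flip: exp_add)
qed

lemma solutions_diverge_exp:
  fixes G :: "'a::real_inner \<Rightarrow> 'a"
  assumes Lip: "\<And>x y. norm (G x - G y) \<le> K * norm (x - y)"
    and X: "\<And>t. (X has_vector_derivative G (X t)) (at t)"
    and Y: "\<And>t. (Y has_vector_derivative G (Y t)) (at t)"
  shows "norm (X t - Y t) \<le> exp (K * \<bar>t\<bar>) * norm (X 0 - Y 0)"
proof -
  have fwd: "norm (X t - Y t) \<le> exp (K * t) * norm (X 0 - Y 0)"
    if X: "\<And>t. (X has_vector_derivative G (X t)) (at t)"
    and Y: "\<And>t. (Y has_vector_derivative G (Y t)) (at t)" and "t \<ge> 0"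
    and Lip: "\<And>x y. norm (G x - G y) \<le> K * norm (x - y)"
    for G :: "'a::real_inner \<Rightarrow> 'a" and X Y t
  proof -
    have "(norm (X t - Y t))^2 \<le> (norm (X 0 - Y 0))^2 * exp ((2 * K) * (t - 0))"
    proof (rule differential_inequality_exp[OF \<open>t \<ge> 0\<close>])
      fix s
      show "((\<lambda>t. (norm (X t - Y t))\<^sup>2) has_real_derivative 2 * ((X s - Y s) \<bullet> (G (X s) - G (Y s)))) (at s)"
        unfolding has_real_derivative_iff_has_vector_derivative power2_norm_eq_inner
        using bounded_bilinear.has_vector_derivative[OF bounded_bilinear_inner
          has_vector_derivative_diff[OF X[of s] Y[of s]] has_vector_derivative_diff[OF X[of s] Y[of s]]]
        by (simp add: inner_commute)
      have "(X s - Y s) \<bullet> (G (X s) - G (Y s)) \<le> norm (X s - Y s) * norm (G (X s) - G (Y s))"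
        by (rule norm_cauchy_schwarz)
      also have "\<dots> \<le> norm (X s - Y s) * (K * norm (X s - Y s))"
        by (intro mult_left_mono Lip) auto
      finally show "2 * ((X s - Y s) \<bullet> (G (X s) - G (Y s))) \<le> 2 * K * (norm (X s - Y s))^2"
        by (simp add: power2_eq_square mult_ac)
    qed
    also have "\<dots> = (exp (K * t) * norm (X 0 - Y 0))^2"
      by (simp add: power_mult_distrib exp_double[symmetric] mult_ac)
    finally show ?thesis
      by (rule power2_le_imp_le) auto
  qed
  show ?thesis
  proof (cases "t \<ge> 0")
    case True
    then show ?thesis using fwd[OF X Y _ Lip] by simp
  next
    case False
    have rev: "((\<lambda>t. Z (- t)) has_vector_derivative - G (Z (- t))) (at t)"
      if "\<And>t. (Z has_vector_derivative G (Z t)) (at t)" for Z t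
      by (rule has_vector_derivative_reflect) (rule that)
    have "norm (X (- (- t)) - Y (- (- t))) \<le> exp (K * - t) * norm (X (- 0) - Y (- 0))"
      using False Lip
      by (intro fwd[of "\<lambda>t. X (- t)" "\<lambda>x. - G x" "\<lambda>t. Y (- t)"] rev X Y)
        (auto simp: norm_minus_commute)
    then show ?thesis using False by simp
  qed
qed

section \<open>The unstable set of a saddle with a strict Lyapunov function\<close>

text \<open>
  The path is connected and \<open>E\<close> is relatively open and closed along it.
\<close>

lemma path_stays_in_region:
  fixes z :: "real \<Rightarrow> 'a::topological_space"
  assumes "a \<le> b" and cont: "continuous_on {a..b} z" and "closed E" and "z a \<in> E"
    and "open": "\<And>t. a \<le> t \<Longrightarrow> t \<le> b \<Longrightarrow> z t \<in> E \<Longrightarrow> z t \<in> interior E"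
    and t: "a \<le> t" "t \<le> b"
  shows "z t \<in> E"
proof (rule ccontr)
  assume "z t \<notin> E"
  have "connected (z ` {a..b})"
    by (intro connected_continuous_image cont connected_Icc)
  then have "interior E \<inter> z ` {a..b} = {} \<or> - E \<inter> z ` {a..b} = {}"
  proof (rule connectedD)
    show "open (interior E)" "open (- E)" using \<open>closed E\<close> by auto
    show "interior E \<inter> - E \<inter> z ` {a..b} = {}" using interior_subset by blast
    show "z ` {a..b} \<subseteq> interior E \<union> - E" using "open" by auto
  qed
  moreover have "z a \<in> interior E" using assms by auto
  ultimately show False using \<open>z t \<notin> E\<close> \<open>a \<le> b\<close> t by (auto simp: disjoint_iff)
qed

lemma first_exit:
  fixes z :: "real \<Rightarrow> 'a::topological_space"
  assumes cont: "continuous_on UNIV z" and "open W" and "\<exists>t\<ge>0. z t \<notin> W"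
  obtains T where "T \<ge> 0" "z T \<notin> W" "\<And>t. 0 \<le> t \<Longrightarrow> t < T \<Longrightarrow> z t \<in> W"
proof -
  define S where "S = {0..} \<inter> z -` (- W)"
  have "closed (z -` (- W))"
    using \<open>open W\<close> cont by (intro closed_vimage) (auto simp: continuous_on_eq_continuous_at)
  then have "closed S" unfolding S_def by (intro closed_Int) auto
  have ne: "S \<noteq> {}" using assms(3) by (auto simp: S_def)
  have bd: "bdd_below S" unfolding S_def by (rule bdd_belowI[of _ 0]) auto
  have "Inf S \<in> S" using closed_contains_Inf[OF ne bd \<open>closed S\<close>] .
  moreover have "z t \<in> W" if "0 \<le> t" "t < Inf S" for t
    using cInf_lower[OF _ bd, of t] that by (force simp: S_def)
  ultimately show ?thesis using that[of "Inf S"] by (auto simp: S_def)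
qed

lemma solution_continuous:
  assumes "\<And>t. (X has_vector_derivative G (X t)) (at t)"
  shows "continuous_on S X"
  using assms by (meson continuous_at_imp_continuous_on has_vector_derivative_continuous)

lemma has_real_derivative_along_solution:
  assumes "(q has_derivative q') (at (X t))" and "(X has_vector_derivative v) (at t)"
  shows "((\<lambda>t. q (X t)) has_real_derivative q' v) (at t)"
proof -
  have "((\<lambda>t. q (X t)) has_derivative (\<lambda>h. q' (h *\<^sub>R v))) (at t)"
    using has_derivative_compose[OF assms(2)[unfolded has_vector_derivative_def] assms(1)] .
  moreover have "(\<lambda>h. q' (h *\<^sub>R v)) = (*) (q' v)"
    using has_derivative_linear[OF assms(1)] by (auto simp: linear_cmul)
  ultimately show ?thesis by (simp add: has_field_derivative_def)
qed

lemma has_vector_derivative_shift: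
  assumes "(X has_vector_derivative d) (at (c + t))"
  shows "((\<lambda>t. X (c + t)) has_vector_derivative d) (at t)"
proof -
  have "((\<lambda>t. c + t) has_vector_derivative 1) (at t)"
    by (auto intro!: derivative_eq_intros)
  from vector_diff_chain_at[OF this, of X d] assms show ?thesis
    by (simp add: o_def)
qed

text \<open>
  An equilibrium \<open>p\<close> of \<open>G\<close> with a function \<open>q\<close> of the displacement \<open>y\<close> from \<open>p\<close> that decreases along the flow and is
  negative in the direction \<open>e\<close>. The set \<open>E\<close> selects one of the two halves of \<open>{q < 0}\<close>. The constants \<open>\<rho>\<close>,
  \<open>\<delta>\<close>, \<open>\<gamma>\<close>, \<open>C\<close>, \<open>s0\<close> are parameters, because uniform bounds for a family of fields \<open>G\<close> are needed later.
\<close>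

locale saddle_flow =
  fixes G :: "'a::euclidean_space \<Rightarrow> 'a" and K :: real
    and p e :: 'a and q :: "'a \<Rightarrow> real" and q' :: "'a \<Rightarrow> 'a \<Rightarrow> real" and E :: "'a set"
    and \<rho> \<delta> \<gamma> C s0 :: real
  assumes Lip: "K > 0" "\<And>x y. norm (G x - G y) \<le> K * norm (x - y)"
    and Gp: "G p = 0"
    and pos: "\<rho> > 0" "\<delta> > 0" "\<gamma> > 0" "C > 0" "s0 > 0" and \<gamma>K: "2 * \<gamma> * K \<le> \<delta>"
    and q': "\<And>y. (q has_derivative q' y) (at y)"
    and decrease: "\<And>y. norm y \<le> \<rho> \<Longrightarrow> q' y (G (p + y)) \<le> - \<delta> * (norm y)^2"
    and lower: "\<And>y. norm y \<le> \<rho> \<Longrightarrow> - C * (norm y)^2 \<le> q y"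
    and E: "closed E" "\<And>y. norm y \<le> \<rho> \<Longrightarrow> y \<in> E \<Longrightarrow> q y < 0 \<Longrightarrow> y \<in> interior E"
    and e: "e \<noteq> 0" "\<And>s. 0 < s \<Longrightarrow> s \<le> s0 \<Longrightarrow> s *\<^sub>R e \<in> E \<and> q (s *\<^sub>R e) \<le> - \<gamma> * (norm (s *\<^sub>R e))^2"
begin

text \<open>
  Because \<open>\<gamma>\<close> is small compared with \<open>\<delta>\<close>, also \<open>q + \<gamma> \<bar>y\<bar>\<^sup>2\<close> decreases, so the cone
  \<open>q \<le> - \<gamma> \<bar>y\<bar>\<^sup>2\<close> is invariant; and \<open>- q \<le> C \<bar>y\<bar>\<^sup>2\<close> turns the decrease of \<open>q\<close> into exponential growth of \<open>- q\<close>.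
\<close>

lemma cone_invariant:
  assumes Y: "\<And>t. (Y has_vector_derivative G (Y t)) (at t)"
    and Y0: "Y 0 = p + s *\<^sub>R e" and s: "0 < s" "s \<le> s0"
    and in_ball: "\<And>t. 0 \<le> t \<Longrightarrow> t \<le> T \<Longrightarrow> norm (Y t - p) \<le> \<rho>"
    and t: "0 \<le> t" "t \<le> T"
  shows "q (Y t - p) \<le> - \<gamma> * (norm (Y t - p))^2"
    and "q (Y T - p) \<le> q (Y t - p) * exp (\<delta> / C * (T - t))"
    and "q (Y t - p) < 0"
    and "Y t - p \<in> E"
proof -
  let ?z = "\<lambda>t. Y t - p"
  have z: "(?z has_vector_derivative G (Y u)) (at u)" for u
    using Y by (auto intro!: derivative_eq_intros)
  have qz: "((\<lambda>u. q (?z u)) has_real_derivative q' (?z u) (G (Y u))) (at u)" for u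
    by (rule has_real_derivative_along_solution[OF q' z])
  have dq: "q' (?z u) (G (Y u)) \<le> - \<delta> * (norm (?z u))^2" if "0 \<le> u" "u \<le> T" for u
    using decrease[OF in_ball[OF that]] by simp
  have grow: "q (?z v) \<le> q (?z u) * exp (\<delta> / C * (v - u))" if "0 \<le> u" "u \<le> v" "v \<le> T" for u v
  proof (rule differential_inequality_exp[OF that(2) qz])
    fix w assume "u \<le> w" "w \<le> v"
    then have w: "0 \<le> w" "w \<le> T" using that by auto
    have "\<delta> / C * (- C * (norm (?z w))^2) \<le> \<delta> / C * q (?z w)"
      using lower[OF in_ball[OF w]] pos by (intro mult_left_mono) auto
    then show "q' (?z w) (G (Y w)) \<le> \<delta> / C * q (?z w)"
      using dq[OF w] pos by simp
  qed
  show "q (Y T - p) \<le> q (Y t - p) * exp (\<delta> / C * (T - t))"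
    using grow[of t T] t by auto
  have q0: "q (?z 0) \<le> - \<gamma> * (norm (?z 0))^2" and E0: "?z 0 \<in> E"
    using e(2)[OF s] Y0 by auto
  have "norm (?z 0) > 0" using e(1) Y0 s by simp
  then have "\<gamma> * (norm (?z 0))^2 > 0"
    using pos by (intro mult_pos_pos zero_less_power) auto
  then have "q (?z 0) < 0" using q0 by linarith
  then have neg: "q (?z u) < 0" if "0 \<le> u" "u \<le> T" for u
    using grow[of 0 u] that by (smt (verit) exp_gt_zero mult_neg_pos)
  then show "q (Y t - p) < 0" using t by auto
  show "Y t - p \<in> E"
    by (rule path_stays_in_region[where z = ?z and a = 0 and b = T])
      (use t E E0 neg in_ball in \<open>auto intro!: continuous_intros solution_continuous[of Y G] Y\<close>)
  have "q (?z t) + \<gamma> * (norm (?z t))^2 \<le> q (?z 0) + \<gamma> * (norm (?z 0))^2"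
  proof (rule DERIV_nonpos_imp_nonincreasing[OF t(1)])
    fix u assume "0 \<le> u" "u \<le> t"
    then have u: "0 \<le> u" "u \<le> T" using t by auto
    have "((\<lambda>u. (norm (?z u))\<^sup>2) has_real_derivative 2 * (?z u \<bullet> G (Y u))) (at u)"
      unfolding has_real_derivative_iff_has_vector_derivative power2_norm_eq_inner
      using bounded_bilinear.has_vector_derivative[OF bounded_bilinear_inner z[of u] z[of u]]
      by (simp add: inner_commute)
    from DERIV_add[OF qz[of u] DERIV_cmult[OF this, of \<gamma>]]
    have "((\<lambda>u. q (?z u) + \<gamma> * (norm (?z u))^2) has_real_derivative
        q' (?z u) (G (Y u)) + \<gamma> * (2 * (?z u \<bullet> G (Y u)))) (at u)" .
    moreover have "q' (?z u) (G (Y u)) + \<gamma> * (2 * (?z u \<bullet> G (Y u))) \<le> 0"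
    proof -
      have "?z u \<bullet> G (Y u) \<le> norm (?z u) * norm (G (Y u) - G p)"
        using norm_cauchy_schwarz[of "?z u" "G (Y u)"] Gp by simp
      also have "\<dots> \<le> norm (?z u) * (K * norm (?z u))"
        by (intro mult_left_mono Lip) auto
      finally have "\<gamma> * (2 * (?z u \<bullet> G (Y u))) \<le> \<gamma> * (2 * (K * (norm (?z u))^2))"
        using pos by (intro mult_left_mono) (auto simp: power2_eq_square mult_ac)
      also have "\<dots> \<le> \<delta> * (norm (?z u))^2"
        using mult_right_mono[OF \<gamma>K, of "(norm (?z u))^2"] by (simp add: mult_ac)
      finally show ?thesis using dq[OF u] by simp
    qed
    ultimately show "\<exists>y. ((\<lambda>u. q (?z u) + \<gamma> * (norm (?z u))^2) has_real_derivative y) (at u) \<and> y \<le> 0"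
      by blast
  qed
  then show "q (Y t - p) \<le> - \<gamma> * (norm (Y t - p))^2"
    using q0 by simp
qed

text \<open>
  The growth of \<open>- q\<close> forces the orbit out of the ball. Read backwards from the exit time \<open>T\<close>, the same growth is a
  decay estimate whose constants do not depend on the starting point.
\<close>

lemma exit_orbit:
  assumes s: "0 < s" "s \<le> s0" "norm (s *\<^sub>R e) < \<rho>"
  obtains Y T where "\<And>t. (Y has_vector_derivative G (Y t)) (at t)" "T \<ge> 0"
    "\<rho> \<le> exp (K * T) * norm (s *\<^sub>R e)"
    "norm (Y T - p) = \<rho>" "Y T - p \<in> E" "q (Y T - p) \<le> - \<gamma> * \<rho>^2"
    "\<And>t. 0 \<le> t \<Longrightarrow> t \<le> T \<Longrightarrow> norm (Y t - p) \<le> \<rho>"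
    "\<And>t. 0 \<le> t \<Longrightarrow> t \<le> T \<Longrightarrow> \<gamma> * (norm (Y t - p))^2 \<le> C * \<rho>^2 * exp (- (\<delta> / C * (T - t)))"
proof -
  obtain Y where Y0: "Y 0 = p + s *\<^sub>R e" and Y: "\<And>t. (Y has_vector_derivative G (Y t)) (at t)"
    using global_solution_exists[OF Lip] by blast
  have contY: "continuous_on S Y" for S by (rule solution_continuous) (rule Y)
  have "\<exists>t\<ge>0. Y t \<notin> ball p \<rho>"
  proof (rule ccontr)
    assume "\<not> ?thesis"
    then have b: "norm (Y t - p) \<le> \<rho>" if "t \<ge> 0" for t
      using that by (force simp: dist_norm norm_minus_commute)
    \<comment> \<open>At this time exponential growth would already exceed the lower bound on \<open>q\<close>.\<close>
    define T where "T = C / \<delta> * (C * \<rho>^2 / (- q (Y 0 - p)))"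
    have q0: "q (Y 0 - p) < 0"
      using cone_invariant(3)[OF Y Y0 s(1,2), of 0 0] b by auto
    then have T: "T > 0" unfolding T_def using pos by (intro mult_pos_pos divide_pos_pos) auto
    have "- C * \<rho>^2 \<le> - C * (norm (Y T - p))^2"
      using b[of T] T pos by (auto intro!: power_mono)
    also have "\<dots> \<le> q (Y T - p)" using lower b T by simp
    also have "\<dots> \<le> q (Y 0 - p) * exp (\<delta> / C * (T - 0))"
      using cone_invariant(2)[OF Y Y0 s(1,2), of T 0] b T by auto
    also have "\<dots> \<le> q (Y 0 - p) * (1 + \<delta> / C * T)"
      using q0 exp_ge_add_one_self[of "\<delta> / C * T"] by (intro mult_left_mono_neg) auto
    also have "\<dots> = q (Y 0 - p) - C * \<rho>^2"
      unfolding T_def using q0 pos by (simp add: field_simps)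
    finally show False using q0 by simp
  qed
  then obtain T where T: "T \<ge> 0" "Y T \<notin> ball p \<rho>" "\<And>t. 0 \<le> t \<Longrightarrow> t < T \<Longrightarrow> Y t \<in> ball p \<rho>"
    using first_exit[OF contY open_ball] by blast
  have "T \<noteq> 0" using T(2) Y0 s by (auto simp: dist_norm)
  then have "T > 0" using T(1) by simp
  have le: "norm (Y t - p) \<le> \<rho>" if t: "0 \<le> t" "t \<le> T" for t
  proof -
    have "Y ` closure {0<..<T} \<subseteq> closure (ball p \<rho>)"
      by (rule order_trans[OF continuous_image_closure_subset[OF contY, of "{0<..<T}" UNIV]])
        (use T(3) in \<open>auto intro!: closure_mono\<close>)
    then have "Y t \<in> cball p \<rho>"
      using t pos \<open>T > 0\<close> by (auto simp: image_subset_iff)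
    then show ?thesis by (simp add: dist_norm norm_minus_commute)
  qed
  have YT: "norm (Y T - p) = \<rho>"
    using T(2) le[of T] T(1) by (simp add: dist_norm norm_minus_commute)
  note cone = cone_invariant[OF Y Y0 s(1,2) le]
  have "\<rho> \<le> exp (K * T) * norm (s *\<^sub>R e)"
    using solutions_diverge_exp[OF Lip(2) Y, of "\<lambda>_. p" T] T(1) Gp YT Y0 by simp
  moreover have "\<gamma> * (norm (Y t - p))^2 \<le> C * \<rho>^2 * exp (- (\<delta> / C * (T - t)))"
    if t: "0 \<le> t" "t \<le> T" for t
  proof -
    have "\<gamma> * (norm (Y t - p))^2 * exp (\<delta> / C * (T - t)) \<le> - q (Y t - p) * exp (\<delta> / C * (T - t))"
      using cone(1)[OF _ _ t] by (intro mult_right_mono) auto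
    also have "\<dots> \<le> - q (Y T - p)" using cone(2)[OF _ _ t] by simp
    also have "\<dots> \<le> C * \<rho>^2" using lower[of "Y T - p"] YT by simp
    finally show ?thesis by (simp add: exp_minus field_simps)
  qed
  moreover have "Y T - p \<in> E" "q (Y T - p) \<le> - \<gamma> * \<rho>^2"
    using cone(1,4)[of T T] T(1) YT by auto
  ultimately show ?thesis
    using that Y T(1) YT le by blast
qed

text \<open>
  The exit points of orbits started at \<open>p + s e\<close> accumulate on the sphere as \<open>s\<close> tends to \<open>0\<close>, while the exit times
  tend to infinity. The solution through an accumulation point inherits the decay estimate for all negative times.
\<close>

theorem unstable_orbit:
  obtains X where "\<And>t. (X has_vector_derivative G (X t)) (at t)"
    "(X \<longlongrightarrow> p) at_bot" "\<And>t. t \<le> 0 \<Longrightarrow> norm (X t - p) \<le> \<rho>"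
    "X 0 - p \<in> E" "q (X 0 - p) \<le> - \<gamma> * \<rho>^2"
proof -
  define a where "a = min s0 (\<rho> / (2 * norm e))"
  define s where "s n = a / (real n + 1)" for n
  have a: "a > 0" "a \<le> s0" "a * norm e < \<rho>"
    using pos e(1) by (auto simp: a_def min_def field_simps)
  have s: "0 < s n" "s n \<le> s0" "norm (s n *\<^sub>R e) < \<rho>" for n
  proof -
    have "s n \<le> a" using a by (simp add: s_def field_simps)
    moreover show "0 < s n" using a by (simp add: s_def)
    ultimately show "s n \<le> s0" "norm (s n *\<^sub>R e) < \<rho>"
      using a mult_right_mono[of "s n" a "norm e"] by auto
  qed
  have "\<exists>Y T. (\<forall>t. (Y has_vector_derivative G (Y t)) (at t)) \<and> T \<ge> 0 \<and>
     \<rho> \<le> exp (K * T) * norm (s n *\<^sub>R e) \<and>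
     norm (Y T - p) = \<rho> \<and> Y T - p \<in> E \<and> q (Y T - p) \<le> - \<gamma> * \<rho>^2 \<and>
     (\<forall>t. 0 \<le> t \<longrightarrow> t \<le> T \<longrightarrow> norm (Y t - p) \<le> \<rho>) \<and>
     (\<forall>t. 0 \<le> t \<longrightarrow> t \<le> T \<longrightarrow> \<gamma> * (norm (Y t - p))^2 \<le> C * \<rho>^2 * exp (- (\<delta> / C * (T - t))))" for n
    using exit_orbit[OF s(1,2,3)[of n]] by (smt (verit, ccfv_threshold))
  then obtain Y T where Y: "\<And>n t. (Y n has_vector_derivative G (Y n t)) (at t)" and "\<And>n. T n \<ge> 0"
    and T: "\<And>n. \<rho> \<le> exp (K * T n) * norm (s n *\<^sub>R e)"
    and YT: "\<And>n. norm (Y n (T n) - p) = \<rho>" "\<And>n. Y n (T n) - p \<in> E"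
      "\<And>n. q (Y n (T n) - p) \<le> - \<gamma> * \<rho>^2"
    and ball: "\<And>n t. 0 \<le> t \<Longrightarrow> t \<le> T n \<Longrightarrow> norm (Y n t - p) \<le> \<rho>"
    and decay: "\<And>n t. 0 \<le> t \<Longrightarrow> t \<le> T n \<Longrightarrow>
      \<gamma> * (norm (Y n t - p))^2 \<le> C * \<rho>^2 * exp (- (\<delta> / C * (T n - t)))"
    by metis
  have T_lower: "K * T n \<ge> ln ((real n + 1) * (\<rho> / (a * norm e)))" for n
  proof -
    have "(real n + 1) * (\<rho> / (a * norm e)) \<le> exp (K * T n)"
      using T[of n] a e(1) by (simp add: s_def field_simps)
    then have "ln ((real n + 1) * (\<rho> / (a * norm e))) \<le> ln (exp (K * T n))"
      using a e(1) pos by (subst ln_le_cancel_iff) (auto intro!: mult_pos_pos divide_pos_pos)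
    then show ?thesis by simp
  qed
  have T_infty: "\<exists>N. \<forall>n\<ge>N. t \<le> T n" for t
  proof -
    obtain N where N: "exp (K * t) / (\<rho> / (a * norm e)) \<le> real N" using real_arch_simple by blast
    have "t \<le> T n" if "n \<ge> N" for n
    proof -
      have "exp (K * t) \<le> (real n + 1) * (\<rho> / (a * norm e))"
      proof -
        have "exp (K * t) / (\<rho> / (a * norm e)) \<le> real n + 1" using N that by linarith
        moreover have "\<rho> / (a * norm e) > 0" using a e(1) pos by auto
        ultimately show ?thesis by (simp only: pos_divide_le_eq)
      qed
      then have "ln (exp (K * t)) \<le> ln ((real n + 1) * (\<rho> / (a * norm e)))"
        by (subst ln_le_cancel_iff) (use a e(1) pos in \<open>auto intro!: mult_pos_pos divide_pos_pos\<close>)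
      then have "K * t \<le> K * T n" using T_lower[of n] by simp
      then show ?thesis using Lip(1) by simp
    qed
    then show ?thesis by blast
  qed
  have "compact (sphere p \<rho>)" by simp
  moreover have "\<forall>n. Y n (T n) \<in> sphere p \<rho>" using YT by (simp add: dist_norm norm_minus_commute)
  ultimately obtain z r where r: "strict_mono r" "(\<lambda>n. Y (r n) (T (r n))) \<longlonglongrightarrow> z"
    unfolding compact_def by (force simp: o_def)
  obtain X where X0: "X 0 = z" and X: "\<And>t. (X has_vector_derivative G (X t)) (at t)"
    using global_solution_exists[OF Lip] by blast
  have lim: "(\<lambda>n. Y (r n) (T (r n) + t)) \<longlonglongrightarrow> X t" for t
  proof -
    have le: "norm (Y (r n) (T (r n) + t) - X t) \<le> norm (Y (r n) (T (r n)) - z) * exp (K * \<bar>t\<bar>)" for n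
    proof -
      have shift: "((\<lambda>t. Y (r n) (T (r n) + t)) has_vector_derivative G (Y (r n) (T (r n) + u))) (at u)" for u
        by (rule has_vector_derivative_shift) (rule Y)
      show ?thesis
        using solutions_diverge_exp[OF Lip(2) shift X, of t] X0 by (simp add: mult.commute)
    qed
    have "(\<lambda>n. norm (Y (r n) (T (r n)) - z) * exp (K * \<bar>t\<bar>)) \<longlonglongrightarrow> 0"
      using r(2) by (intro tendsto_mult_left_zero tendsto_norm_zero) (rule LIM_zero)
    from Lim_null_comparison[OF always_eventually[OF allI[OF le]] this]
    show ?thesis by (rule LIM_zero_cancel)
  qed
  have late: "\<forall>\<^sub>F n in sequentially. - t \<le> T (r n)" for t
  proof -
    obtain N where "\<forall>n\<ge>N. - t \<le> T n" using T_infty by blast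
    then have "\<forall>n\<ge>N. - t \<le> T (r n)" using seq_suble[OF r(1)] by (meson order_trans)
    then show ?thesis by (auto simp: eventually_sequentially)
  qed
  have X_ball: "norm (X t - p) \<le> \<rho>" if "t \<le> 0" for t
  proof (rule tendsto_upperbound)
    show "(\<lambda>n. norm (Y (r n) (T (r n) + t) - p)) \<longlonglongrightarrow> norm (X t - p)"
      by (intro tendsto_intros lim)
    show "\<forall>\<^sub>F n in sequentially. norm (Y (r n) (T (r n) + t) - p) \<le> \<rho>"
      using late[of t] by eventually_elim (use that in \<open>auto intro!: ball\<close>)
  qed auto
  have X_decay: "\<gamma> * (norm (X t - p))^2 \<le> C * \<rho>^2 * exp (\<delta> / C * t)" if "t \<le> 0" for t
  proof (rule tendsto_upperbound)
    show "(\<lambda>n. \<gamma> * (norm (Y (r n) (T (r n) + t) - p))^2) \<longlonglongrightarrow> \<gamma> * (norm (X t - p))^2"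
      by (intro tendsto_intros lim)
    show "\<forall>\<^sub>F n in sequentially. \<gamma> * (norm (Y (r n) (T (r n) + t) - p))^2 \<le> C * \<rho>^2 * exp (\<delta> / C * t)"
      using late[of t]
    proof eventually_elim
      case (elim n)
      then show ?case using decay[of "T (r n) + t" "r n"] that by simp
    qed
  qed auto
  have "(X \<longlongrightarrow> p) at_bot"
  proof -
    have "LIM t at_bot. \<delta> / C * t :> at_bot"
      using pos by (intro filterlim_tendsto_pos_mult_at_bot[OF tendsto_const]) (auto simp: filterlim_ident)
    then have "((\<lambda>t. exp (\<delta> / C * t)) \<longlongrightarrow> 0) at_bot"
      by (rule filterlim_compose[OF exp_at_bot])
    then have "((\<lambda>t. C * \<rho>^2 / \<gamma> * exp (\<delta> / C * t)) \<longlongrightarrow> 0) at_bot"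
      by (rule tendsto_mult_right_zero)
    then have "((\<lambda>t. (norm (X t - p))\<^sup>2) \<longlongrightarrow> 0) at_bot"
    proof (rule Lim_null_comparison[rotated])
      show "\<forall>\<^sub>F t in at_bot. norm ((norm (X t - p))^2) \<le> C * \<rho>^2 / \<gamma> * exp (\<delta> / C * t)"
        using eventually_le_at_bot[of 0]
      proof eventually_elim
        case (elim t)
        then show ?case using X_decay[of t] pos by (simp add: field_simps)
      qed
    qed
    then have "((\<lambda>t. norm (X t - p)) \<longlongrightarrow> 0) at_bot"
      using tendsto_real_sqrt by fastforce
    then show ?thesis by (simp add: tendsto_norm_zero_iff LIM_zero_iff)
  qed
  moreover have "X 0 - p \<in> E"
    by (rule closed_sequentially[OF E(1), of "\<lambda>n. Y (r n) (T (r n)) - p"])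
      (use YT X0 r(2) in \<open>auto intro!: tendsto_intros\<close>)
  moreover have "q (X 0 - p) \<le> - \<gamma> * \<rho>^2"
  proof (rule tendsto_upperbound)
    have "isCont q (X 0 - p)" by (rule has_derivative_continuous[OF q'])
    then show "(\<lambda>n. q (Y (r n) (T (r n)) - p)) \<longlonglongrightarrow> q (X 0 - p)"
      by (rule isCont_tendsto_compose) (use X0 r(2) in \<open>auto intro!: tendsto_intros\<close>)
    show "\<forall>\<^sub>F n in sequentially. q (Y (r n) (T (r n)) - p) \<le> - \<gamma> * \<rho>^2"
      using YT(3) by simp
  qed auto
  ultimately show ?thesis using that X X_ball by blast
qed

end

section \<open>Trapping regions and perturbed zeros\<close>

text \<open>
  The set \<open>{x \<in> E. V x \<le> V (X 0)}\<close> is closed and lies in the open set \<open>interior E \<inter> {V < c}\<close>, in which \<open>V\<close> decreases;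
  so there is no first exit from the latter, and the decrease of \<open>V\<close> never stops.
\<close>

lemma trapped_solution_converges:
  fixes X :: "real \<Rightarrow> 'a::real_normed_vector" and V :: "'a \<Rightarrow> real"
  assumes X: "\<And>t. (X has_vector_derivative G (X t)) (at t)"
    and V': "\<And>x. (V has_derivative V' x) (at x)"
    and E: "closed E" "\<And>x. x \<in> E \<Longrightarrow> V x < c \<Longrightarrow> x \<in> interior E"
    and coercive: "b > 0" "\<And>x. x \<in> E \<Longrightarrow> b * (norm x)^2 \<le> V x"
    and decrease: "l > 0" "\<And>x. x \<in> E \<Longrightarrow> V x < c \<Longrightarrow> V' x (G x) \<le> - l * V x"
    and X0: "X 0 \<in> E" "V (X 0) < c"
  shows "\<And>t. t \<ge> 0 \<Longrightarrow> X t \<in> E \<and> V (X t) < c" and "(X \<longlongrightarrow> 0) at_top"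
proof -
  have contX: "continuous_on S X" for S by (rule solution_continuous) (rule X)
  have contV: "continuous_on S V" for S
    using V' by (meson continuous_at_imp_continuous_on has_derivative_continuous)
  define W where "W = interior E \<inter> V -` {..<c}"
  have "open W" unfolding W_def
    using contV[of UNIV] by (intro open_Int open_vimage) auto
  have W_iff: "x \<in> W \<longleftrightarrow> x \<in> E \<and> V x < c" for x
    using E(2) interior_subset by (auto simp: W_def)
  have decay: "V (X t) \<le> V (X 0) * exp (- l * (t - 0))"
    if "t \<ge> 0" and inW: "\<And>u. 0 \<le> u \<Longrightarrow> u \<le> t \<Longrightarrow> X u \<in> W" for t
  proof (rule differential_inequality_exp[OF that(1)])
    fix u assume "0 \<le> u" "u \<le> t"
    then show "V' (X u) (G (X u)) \<le> - l * V (X u)"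
      using inW W_iff decrease(2) by auto
    show "((\<lambda>t. V (X t)) has_real_derivative V' (X u) (G (X u))) (at u)"
      by (rule has_real_derivative_along_solution[OF V' X])
  qed
  have V0: "V (X 0) \<ge> 0"
    using coercive(2)[OF X0(1)] coercive(1) by (smt (verit) mult_nonneg_nonneg zero_le_power2)
  have stay: "X t \<in> W" if "t \<ge> 0" for t
  proof (rule ccontr)
    assume "X t \<notin> W"
    then have ex: "\<exists>t\<ge>0. X t \<notin> W" using that by blast
    obtain T where T: "T \<ge> 0" "X T \<notin> W" "\<And>t. 0 \<le> t \<Longrightarrow> t < T \<Longrightarrow> X t \<in> W"
      using first_exit[OF contX \<open>open W\<close> ex] by blast
    have "T > 0" using T X0 W_iff by (cases "T = 0") auto
    let ?S = "E \<inter> V -` {..V (X 0)}"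
    have "closed ?S"
      using contV[of UNIV] E(1) by (intro closed_Int closed_vimage) auto
    have "X t \<in> ?S" if "0 < t" "t < T" for t
    proof -
      have "V (X t) \<le> V (X 0) * exp (- l * (t - 0))" using decay[of t] T(3) that by auto
      also have "\<dots> \<le> V (X 0) * 1" using V0 that decrease(1) by (intro mult_left_mono) auto
      finally show ?thesis using T(3)[of t] that W_iff by auto
    qed
    then have "X ` {0<..<T} \<subseteq> ?S" by auto
    then have "X ` closure {0<..<T} \<subseteq> ?S"
      using image_closure_subset[OF contX \<open>closed ?S\<close>] by blast
    moreover have "X T \<in> X ` closure {0<..<T}" using \<open>T > 0\<close> by simp
    ultimately have "X T \<in> ?S" by blast
    then show False using T(2) X0 W_iff by auto
  qed
  then show "X t \<in> E \<and> V (X t) < c" if "t \<ge> 0" for t using that W_iff by auto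
  have "((\<lambda>t. (norm (X t))\<^sup>2) \<longlongrightarrow> 0) at_top"
  proof (rule Lim_null_comparison)
    have "LIM t at_top. - l * t :> at_bot"
      using decrease(1) by (intro filterlim_tendsto_neg_mult_at_bot[OF tendsto_const]) (auto simp: filterlim_ident)
    then have "((\<lambda>t. exp (- l * t)) \<longlongrightarrow> 0) at_top"
      by (rule filterlim_compose[OF exp_at_bot])
    then show "((\<lambda>t. V (X 0) / b * exp (- l * t)) \<longlongrightarrow> 0) at_top"
      by (rule tendsto_mult_right_zero)
    show "\<forall>\<^sub>F t in at_top. norm ((norm (X t))^2) \<le> V (X 0) / b * exp (- l * t)"
      using eventually_ge_at_top[of 0]
    proof eventually_elim
      case (elim t)
      have "b * (norm (X t))^2 \<le> V (X 0) * exp (- l * (t - 0))"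
        using decay[of t] stay W_iff coercive(2)[of "X t"] elim by force
      then show ?case using coercive(1) by (simp add: field_simps)
    qed
  qed
  then have "((\<lambda>t. norm (X t)) \<longlongrightarrow> 0) at_top"
    using tendsto_real_sqrt by fastforce
  then show "(X \<longlongrightarrow> 0) at_top" by (simp add: tendsto_norm_zero_iff)
qed

lemma nondegenerate_zero_lower_bound:
  fixes f :: "'a::euclidean_space \<Rightarrow> 'a"
  assumes f': "(f has_derivative M) (at P)" and "f P = 0" and inj: "\<And>z. M z = 0 \<Longrightarrow> z = 0"
  obtains n r where "n > 0" "r > 0" "\<And>y. norm y \<le> r \<Longrightarrow> n * norm y \<le> norm (f (P + y))"
proof -
  have lin: "linear M" using f' has_derivative_linear by blast
  then have "inj M" using inj by (simp add: linear_injective_0)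
  then obtain B where B: "B > 0" "\<And>x. B * norm x \<le> norm (M x)"
    using linear_inj_bounded_below_pos[OF lin] by blast
  obtain d where d: "d > 0"
    "\<And>y. norm (y - P) < d \<Longrightarrow> norm (f y - f P - M (y - P)) \<le> B / 2 * norm (y - P)"
    using f' B(1) unfolding has_derivative_at_alt by (meson half_gt_zero)
  have "B / 2 * norm y \<le> norm (f (P + y))" if "norm y \<le> d / 2" for y
  proof -
    have "norm (f (P + y) - M y) \<le> B / 2 * norm y"
      using d(2)[of "P + y"] that d(1) \<open>f P = 0\<close> by simp
    moreover have "norm (M y) \<le> norm (f (P + y)) + norm (f (P + y) - M y)"
      using norm_triangle_ineq3[of "M y" "f (P + y)"] by (simp add: norm_minus_commute)
    ultimately show ?thesis using B(2)[of y] by linarith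
  qed
  then show ?thesis using that[of "B / 2" "d / 2"] B(1) d(1) by simp
qed

text \<open>
  Brouwer's theorem for the simplified Newton map \<open>x - M\<inverse> (f x + g x)\<close> on a ball of radius proportional to
  \<open>m\<close>. The constants \<open>A\<close> and \<open>r\<close> must not depend on \<open>g\<close>.
\<close>

lemma perturbed_zero:
  fixes f :: "'a::euclidean_space \<Rightarrow> 'a"
  assumes f': "(f has_derivative M) (at P)" and "f P = 0" and inj: "\<And>z. M z = 0 \<Longrightarrow> z = 0"
    and contf: "continuous_on UNIV f" and "r0 > 0"
  obtains A r where "A > 0" "r > 0"
    "\<And>g m. \<lbrakk>continuous_on (cball P r0) g; \<And>x. x \<in> cball P r0 \<Longrightarrow> norm (g x) \<le> m; A * m \<le> r\<rbrakk>
      \<Longrightarrow> \<exists>p. norm (p - P) \<le> A * m \<and> f p + g p = 0"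
proof -
  have lin: "linear M" using f' has_derivative_linear by blast
  then have "inj M" using inj by (simp add: linear_injective_0)
  then obtain T where T: "linear T" "\<And>x. T (M x) = x" "\<And>x. M (T x) = x"
    using linear_injective_isomorphism[OF lin] by blast
  obtain B where B: "B > 0" "\<And>x. norm (T x) \<le> B * norm x"
    using linear_bounded_pos[OF T(1)] by blast
  have contT: "continuous_on S T" for S
    using T(1) by (simp add: linear_continuous_on linear_conv_bounded_linear)
  have "1 / (2 * B) > 0" using B by simp
  then obtain d where d: "d > 0"
    "\<And>y. norm (y - P) < d \<Longrightarrow> norm (f y - f P - M (y - P)) \<le> 1 / (2 * B) * norm (y - P)"
    using f' unfolding has_derivative_at_alt by meson
  define r where "r = min r0 (d / 2)"
  have "\<exists>p. norm (p - P) \<le> 2 * B * m \<and> f p + g p = 0"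
    if g: "continuous_on (cball P r0) g" and m: "\<And>x. x \<in> cball P r0 \<Longrightarrow> norm (g x) \<le> m"
      and r: "2 * B * m \<le> r" for g m
  proof -
    have "m \<ge> 0" using order_trans[OF norm_ge_zero m[of P]] \<open>r0 > 0\<close> by simp
    have sub: "cball P (2 * B * m) \<subseteq> cball P r0" using r by (auto simp: r_def)
    define \<phi> where "\<phi> x = x - T (f x + g x)" for x
    have maps: "\<phi> x \<in> cball P (2 * B * m)" if x: "x \<in> cball P (2 * B * m)" for x
    proof -
      have xP: "norm (x - P) \<le> 2 * B * m" using x by (simp add: dist_norm norm_minus_commute)
      then have "norm (x - P) < d" using r d(1) by (auto simp: r_def)
      then have "norm (f x - M (x - P)) \<le> 1 / (2 * B) * norm (x - P)"
        using d(2) \<open>f P = 0\<close> by fastforce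
      also have "\<dots> \<le> 1 / (2 * B) * (2 * B * m)" using B xP by (intro mult_left_mono) auto
      also have "\<dots> = m" using B by simp
      finally have 1: "norm (f x - M (x - P)) \<le> m" .
      have "norm (\<phi> x - P) = norm (T (f x - M (x - P) + g x))"
        using T by (simp add: \<phi>_def linear_add linear_diff algebra_simps norm_minus_commute)
      also have "\<dots> \<le> B * norm (f x - M (x - P) + g x)" by (rule B)
      also have "\<dots> \<le> B * (m + m)"
        using B 1 m[of x] x sub by (intro mult_left_mono norm_triangle_mono) auto
      finally show ?thesis by (simp add: dist_norm norm_minus_commute)
    qed
    have "continuous_on (cball P (2 * B * m)) \<phi>"
      unfolding \<phi>_def
      by (intro continuous_intros continuous_on_compose2[OF contT[of UNIV]]
          continuous_on_subset[OF contf] continuous_on_subset[OF g] sub) auto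
    moreover have "cball P (2 * B * m) \<noteq> {}"
      using B(1) \<open>m \<ge> 0\<close> by (simp add: not_less)
    ultimately obtain p where p: "p \<in> cball P (2 * B * m)" "\<phi> p = p"
      using brouwer[of "cball P (2 * B * m)" \<phi>, OF compact_cball convex_cball] maps by auto
    then have "T (f p + g p) = 0" by (simp add: \<phi>_def)
    then have "f p + g p = 0" using T(3) lin linear_0 by metis
    then show ?thesis using p by (auto simp: dist_norm norm_minus_commute)
  qed
  then show ?thesis using that[of "2 * B" r] B(1) d(1) \<open>r0 > 0\<close> by (simp add: r_def)
qed

text \<open>
  Uniform continuity of the derivative on a compact ball makes the increments of \<open>f\<close> at \<open>p\<close> and at \<open>P\<close> agree to first
  order in \<open>y\<close>, not merely up to a constant. This is what allows a Lyapunov function centred at \<open>P\<close> to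
  be used at the perturbed equilibrium \<open>p\<close>.
\<close>

lemma translated_increment_bound:
  fixes f :: "'a::euclidean_space \<Rightarrow> 'a" and f' :: "'a \<Rightarrow> 'a \<Rightarrow>\<^sub>L 'a"
  assumes f': "\<And>x. (f has_derivative blinfun_apply (f' x)) (at x)" "continuous_on UNIV f'"
    and "w > 0"
  obtains d where "d > 0" "\<And>p y. norm (p - P) < d \<Longrightarrow> norm y \<le> r \<Longrightarrow>
    norm (f (p + y) - f p - (f (P + y) - f P)) \<le> w * norm y"
proof -
  have "uniformly_continuous_on (cball P (r + 1)) f'"
    by (intro compact_uniformly_continuous continuous_on_subset[OF f'(2)]) auto
  then obtain d where d: "d > 0"
    "\<And>x x'. x \<in> cball P (r + 1) \<Longrightarrow> x' \<in> cball P (r + 1) \<Longrightarrow> dist x' x < d \<Longrightarrow> dist (f' x') (f' x) < w"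
    using \<open>w > 0\<close> unfolding uniformly_continuous_on_def by metis
  have "norm (f (p + y) - f p - (f (P + y) - f P)) \<le> w * norm y"
    if p: "norm (p - P) < min d 1" and y: "norm y \<le> r" for p y
  proof -
    let ?h = "\<lambda>y. f (p + y) - f (P + y)"
    have "norm (?h y - ?h 0) \<le> w * norm (y - 0)"
    proof (rule differentiable_bound[of "cball 0 r" ?h "\<lambda>y. blinfun_apply (f' (p + y) - f' (P + y))"])
      fix x :: 'a assume x: "x \<in> cball 0 r"
      have "((\<lambda>y. f (c + y)) has_derivative blinfun_apply (f' (c + x))) (at x)" for c
      proof -
        have "((\<lambda>y. c + y) has_derivative (\<lambda>h. h)) (at x)"
          by (auto intro!: derivative_eq_intros)
        from has_derivative_compose[OF this f'(1)] show ?thesis .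
      qed
      then have "(?h has_derivative blinfun_apply (f' (p + x) - f' (P + x))) (at x)"
        unfolding blinfun.diff_left by (intro has_derivative_diff)
      then show "(?h has_derivative blinfun_apply (f' (p + x) - f' (P + x))) (at x within cball 0 r)"
        by (rule has_derivative_at_withinI)
      have "norm (P - (p + x)) \<le> norm (p - P) + norm x"
        using norm_triangle_ineq4[of "P - p" x] by (simp add: algebra_simps norm_minus_commute)
      then have "p + x \<in> cball P (r + 1)" using x p by (simp add: dist_norm)
      moreover have "P + x \<in> cball P (r + 1)" using x by (simp add: dist_norm)
      ultimately have "dist (f' (p + x)) (f' (P + x)) < w"
        using p by (intro d) (auto simp: dist_norm)
      then show "onorm (blinfun_apply (f' (p + x) - f' (P + x))) \<le> w"
        by (simp add: dist_norm norm_blinfun.rep_eq)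
    qed (use y norm_ge_zero[of y] in \<open>auto simp del: norm_ge_zero\<close>)
    then show ?thesis by (simp add: algebra_simps)
  qed
  then show ?thesis using that[of "min d 1"] d(1) by simp
qed

lemma C1_lipschitz_on_ball:
  fixes f :: "'a::euclidean_space \<Rightarrow> 'a" and f' :: "'a \<Rightarrow> 'a \<Rightarrow>\<^sub>L 'a"
  assumes f': "\<And>x. (f has_derivative blinfun_apply (f' x)) (at x)" "continuous_on UNIV f'"
  obtains L where "L > 0" "\<And>x y. norm x \<le> R \<Longrightarrow> norm y \<le> R \<Longrightarrow> norm (f x - f y) \<le> L * norm (x - y)"
proof -
  have "bounded (f' ` cball 0 R)"
    by (intro compact_imp_bounded compact_continuous_image continuous_on_subset[OF f'(2)]) auto
  then obtain L where L: "L > 0" "\<And>x. norm x \<le> R \<Longrightarrow> norm (f' x) \<le> L"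
    unfolding bounded_pos by auto
  have "norm (f x - f y) \<le> L * norm (x - y)" if "norm x \<le> R" "norm y \<le> R" for x y
    by (rule differentiable_bound[of "cball 0 R" f "\<lambda>x. blinfun_apply (f' x)"])
      (use that L(2) f'(1) in \<open>auto intro: has_derivative_at_withinI simp flip: norm_blinfun.rep_eq\<close>)
  then show ?thesis using that L(1) by blast
qed

section \<open>Persistence of the connection at a mountain pass\<close>

definition connects_to_zero :: "('a::real_normed_vector \<Rightarrow> 'a) \<Rightarrow> 'a \<Rightarrow> (real \<Rightarrow> 'a) \<Rightarrow> bool" where
  "connects_to_zero F p X \<longleftrightarrow> F p = 0 \<and> p \<noteq> 0 \<and>
     (\<forall>t. (X has_vector_derivative F (X t)) (at t)) \<and> (X \<longlongrightarrow> p) at_bot \<and> (X \<longlongrightarrow> 0) at_top"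

text \<open>
  An unperturbed field \<open>f\<close> with nondegenerate zeros \<open>0\<close> and \<open>P\<close> and a strict Lyapunov function \<open>V\<close> on the ball of
  radius \<open>R\<close>. The well \<open>E\<close> is closed, and within \<open>{V < V P}\<close> it is also open, which
  expresses that \<open>V P\<close> is the lowest level on its boundary. The ray from \<open>P\<close> in the direction \<open>e\<close>, along which
  \<open>V\<close> falls off quadratically, supplies starting points close to the unstable branch.
\<close>

locale mountain_pass =
  fixes f :: "'a::euclidean_space \<Rightarrow> 'a" and f' :: "'a \<Rightarrow> 'a \<Rightarrow>\<^sub>L 'a"
    and V :: "'a \<Rightarrow> real" and V' :: "'a \<Rightarrow> 'a \<Rightarrow> real"
    and E :: "'a set" and P e :: 'a and R b \<delta> C \<gamma>0 s0 :: real
  assumes f': "\<And>x. (f has_derivative blinfun_apply (f' x)) (at x)" "continuous_on UNIV f'"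
    and zeros: "f 0 = 0" "f P = 0"
    and nondegenerate: "\<And>z. f' 0 z = 0 \<Longrightarrow> z = 0" "\<And>z. f' P z = 0 \<Longrightarrow> z = 0"
    and pos: "R > 0" "b > 0" "\<delta> > 0" "C > 0" "\<gamma>0 > 0" "s0 > 0"
    and P: "P \<noteq> 0" "norm P < R"
    and V': "\<And>x. (V has_derivative V' x) (at x)"
    and V_decrease: "\<And>x. norm x \<le> R \<Longrightarrow> V' x (f x) \<le> - \<delta> * (norm (f x))^2"
    and V_gradient: "\<And>x z. norm x \<le> R \<Longrightarrow> \<bar>V' x z\<bar> \<le> C * norm (f x) * norm z"
    and V0: "V 0 = 0"
    and E: "closed E" "\<And>x. x \<in> E \<Longrightarrow> V x < V P \<Longrightarrow> x \<in> interior E"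
    and coercive: "\<And>x. x \<in> E \<Longrightarrow> b * (norm x)^2 \<le> V x" "V P < b * R^2"
    and only_zero: "\<And>x. x \<in> E \<Longrightarrow> V x < V P \<Longrightarrow> f x = 0 \<Longrightarrow> x = 0"
    and departure: "e \<noteq> 0"
      "\<And>s. 0 < s \<Longrightarrow> s \<le> s0 \<Longrightarrow> P + s *\<^sub>R e \<in> E \<and> V (P + s *\<^sub>R e) \<le> V P - \<gamma>0 * s^2"
begin

text \<open>
  Vanishing at \<open>0\<close> makes the Lipschitz constant also bound \<open>g\<close> itself by a multiple of \<open>\<bar>x\<bar>\<close>,
  which keeps \<open>V\<close> strictly decreasing near \<open>0\<close>.
\<close>

definition perturbation :: "real \<Rightarrow> ('a \<Rightarrow> 'a) \<Rightarrow> bool" where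
  "perturbation \<eta> g \<longleftrightarrow> g 0 = 0 \<and>
     (\<forall>x y. norm x \<le> R \<longrightarrow> norm y \<le> R \<longrightarrow> norm (g x - g y) \<le> \<eta> * norm (x - y))"

text \<open>
  Composition with the nearest-point projection onto the ball gives a globally Lipschitz field, for which solutions exist for
  all times. The orbits constructed below stay in the ball, where both fields agree.
\<close>

definition truncated :: "('a \<Rightarrow> 'a) \<Rightarrow> 'a \<Rightarrow> 'a" where
  "truncated g x = (let y = closest_point (cball 0 R) x in f y + g y)"

definition departs :: "real \<Rightarrow> ('a \<Rightarrow> 'a) \<Rightarrow> 'a \<Rightarrow> (real \<Rightarrow> 'a) \<Rightarrow> bool" where
  "departs \<theta> g p X \<longleftrightarrow> f p + g p = 0 \<and>
     (\<forall>t. (X has_vector_derivative truncated g (X t)) (at t)) \<and>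
     (X \<longlongrightarrow> p) at_bot \<and> (\<forall>t\<le>0. norm (X t) \<le> R) \<and>
     P + (X 0 - p) \<in> E \<and> V (P + (X 0 - p)) \<le> V P - \<theta>"

lemma truncated_eq: "norm x \<le> R \<Longrightarrow> truncated g x = f x + g x"
  by (simp add: truncated_def closest_point_self)

lemma perturbation_bound: "perturbation \<eta> g \<Longrightarrow> norm x \<le> R \<Longrightarrow> norm (g x) \<le> \<eta> * norm x"
  unfolding perturbation_def using pos(1) by (metis diff_zero norm_zero less_imp_le)

lemma truncated_lipschitz:
  obtains K where "K > 0"
    "\<And>\<eta> g x y. perturbation \<eta> g \<Longrightarrow> \<eta> \<le> 1 \<Longrightarrow>
      norm (truncated g x - truncated g y) \<le> K * norm (x - y)"
proof -
  obtain L where L: "L > 0"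
    "\<And>x y. norm x \<le> R \<Longrightarrow> norm y \<le> R \<Longrightarrow> norm (f x - f y) \<le> L * norm (x - y)"
    using C1_lipschitz_on_ball[OF f'] by blast
  have "norm (truncated g x - truncated g y) \<le> (L + 1) * norm (x - y)"
    if g: "perturbation \<eta> g" "\<eta> \<le> 1" for \<eta> g x y
  proof -
    let ?x = "closest_point (cball 0 R) x" and ?y = "closest_point (cball 0 R) y"
    have in_ball: "norm ?x \<le> R" "norm ?y \<le> R"
      using closest_point_in_set[of "cball 0 R"] pos by auto
    have le: "norm (?x - ?y) \<le> norm (x - y)"
      using closest_point_lipschitz[of "cball 0 R" x y] pos by (auto simp: dist_norm)
    have "norm (truncated g x - truncated g y) = norm ((f ?x - f ?y) + (g ?x - g ?y))"
      by (simp add: truncated_def Let_def algebra_simps)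
    also have "\<dots> \<le> L * norm (?x - ?y) + \<eta> * norm (?x - ?y)"
      using L(2)[OF in_ball] g(1) in_ball
      by (intro norm_triangle_mono) (auto simp: perturbation_def)
    also have "\<dots> \<le> (L + 1) * norm (?x - ?y)"
      using mult_right_mono[OF g(2) norm_ge_zero[of "?x - ?y"]]
      by (simp only: distrib_right add_left_mono)
    also have "\<dots> \<le> (L + 1) * norm (x - y)"
      using le L(1) by (intro mult_left_mono) auto
    finally show ?thesis .
  qed
  then show ?thesis using that[of "L + 1"] L(1) by simp
qed

lemma V_continuous: "continuous_on S V"
  using V' by (meson continuous_at_imp_continuous_on has_derivative_continuous)

lemma f_continuous: "continuous_on S f"
  using f' by (meson continuous_at_imp_continuous_on has_derivative_continuous)

lemma E_sublevel_bounded: "x \<in> E \<Longrightarrow> V x \<le> V P \<Longrightarrow> norm x \<le> R"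
proof -
  assume "x \<in> E" "V x \<le> V P"
  then have "b * (norm x)^2 \<le> b * R^2" using coercive by fastforce
  then have "(norm x)^2 \<le> R^2" using pos by simp
  then show "norm x \<le> R" using pos by (simp add: power2_le_iff_abs_le)
qed

lemma E_sublevel_compact: "c \<le> V P \<Longrightarrow> compact (E \<inter> V -` {..c})"
proof -
  assume "c \<le> V P"
  then have "E \<inter> V -` {..c} \<subseteq> cball 0 R" using E_sublevel_bounded by auto
  then have "bounded (E \<inter> V -` {..c})" by (rule bounded_subset[OF bounded_cball])
  moreover have "closed (E \<inter> V -` {..c})"
    using V_continuous[of UNIV] E(1) by (intro closed_Int closed_vimage) auto
  ultimately show ?thesis by (simp add: compact_eq_bounded_closed)
qed

text \<open>
  The gradient of \<open>V\<close> vanishes at a zero of \<open>f\<close>, at least linearly, so \<open>V\<close> varies quadratically there.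
\<close>

lemma V_increment_bound:
  assumes "f z = 0" and seg: "norm (z + y) \<le> R" "norm z \<le> R"
    and L: "\<And>x. norm x \<le> R \<Longrightarrow> norm (f x) \<le> L * norm (x - z)" "L > 0"
  shows "\<bar>V (z + y) - V z\<bar> \<le> C * L * (norm y)^2"
proof -
  have "\<exists>s>0. s < 1 \<and> V (z + 1 *\<^sub>R y) - V (z + 0 *\<^sub>R y) = (1 - 0) * V' (z + s *\<^sub>R y) y"
  proof (rule MVT2)
    fix s :: real
    have "((\<lambda>s. z + s *\<^sub>R y) has_vector_derivative y) (at s)"
      by (auto intro!: derivative_eq_intros)
    then show "((\<lambda>s. V (z + s *\<^sub>R y)) has_real_derivative V' (z + s *\<^sub>R y) y) (at s)"
      by (rule has_real_derivative_along_solution[OF V'])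
  qed simp
  then obtain s where s: "0 < s" "s < 1" "V (z + y) - V z = V' (z + s *\<^sub>R y) y" by auto
  have "z + s *\<^sub>R y = (1 - s) *\<^sub>R z + s *\<^sub>R (z + y)" by (simp add: algebra_simps)
  then have "z + s *\<^sub>R y \<in> cball 0 R"
    using convexD[OF convex_cball, of z 0 R "z + y" "1 - s" s] seg s by simp
  then have in_ball: "norm (z + s *\<^sub>R y) \<le> R" by simp
  have "\<bar>V (z + y) - V z\<bar> \<le> C * norm (f (z + s *\<^sub>R y)) * norm y"
    unfolding s(3) by (rule V_gradient[OF in_ball])
  also have "\<dots> \<le> C * (L * (1 * norm y)) * norm y"
  proof -
    have "norm (f (z + s *\<^sub>R y)) \<le> L * (s * norm y)" using L(1)[OF in_ball] s by simp
    also have "\<dots> \<le> L * (1 * norm y)" using s L(2) by (intro mult_left_mono mult_right_mono) auto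
    finally show ?thesis using pos by (intro mult_right_mono mult_left_mono) auto
  qed
  finally show ?thesis by (simp add: power2_eq_square mult_ac)
qed

lemma zero_of_perturbation:
  obtains A \<eta>1 where "A > 0" "\<eta>1 > 0"
    "\<And>\<eta> g. \<eta> < \<eta>1 \<Longrightarrow> perturbation \<eta> g \<Longrightarrow> \<exists>p. norm (p - P) \<le> A * \<eta> \<and> f p + g p = 0"
proof -
  define r0 where "r0 = R - norm P"
  have "r0 > 0" using P by (simp add: r0_def)
  have sub: "norm x \<le> R" if "x \<in> cball P r0" for x
    using that norm_triangle_ineq2[of x P] by (simp add: r0_def dist_norm norm_minus_commute)
  obtain A r where A: "A > 0" "r > 0"
    "\<And>g m. \<lbrakk>continuous_on (cball P r0) g; \<And>x. x \<in> cball P r0 \<Longrightarrow> norm (g x) \<le> m; A * m \<le> r\<rbrakk>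
      \<Longrightarrow> \<exists>p. norm (p - P) \<le> A * m \<and> f p + g p = 0"
    using perturbed_zero[OF f'(1) zeros(2) nondegenerate(2) f_continuous \<open>r0 > 0\<close>] by blast
  have "\<exists>p. norm (p - P) \<le> (A * R) * \<eta> \<and> f p + g p = 0"
    if "\<eta> < r / (A * R)" and g: "perturbation \<eta> g" for \<eta> g
  proof -
    have "norm (g P) \<le> \<eta> * norm P" using perturbation_bound[OF g, of P] P by simp
    then have "0 \<le> \<eta> * norm P" using norm_ge_zero order_trans by blast
    then have "\<eta> \<ge> 0" using P by (simp add: zero_le_mult_iff)
    have "norm (g x) \<le> \<eta> * R" if "x \<in> cball P r0" for x
    proof -
      have "norm (g x) \<le> \<eta> * norm x" by (rule perturbation_bound[OF g sub[OF that]])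
      also have "\<dots> \<le> \<eta> * R" using sub[OF that] \<open>\<eta> \<ge> 0\<close> by (rule mult_left_mono)
      finally show ?thesis .
    qed
    moreover have "continuous_on (cball P r0) g"
      using g sub \<open>\<eta> \<ge> 0\<close> unfolding perturbation_def
      by (intro lipschitz_on_continuous_on[of \<eta>] lipschitz_onI) (auto simp: dist_norm)
    moreover have "A * (\<eta> * R) \<le> r"
      using that(1) A pos by (simp add: field_simps)
    ultimately show ?thesis using A(3)[of g "\<eta> * R"] by (simp add: mult_ac)
  qed
  then show ?thesis using that[of "A * R" "r / (A * R)"] A pos by simp
qed

text \<open>
  The Lyapunov function stays centred at the unperturbed zero \<open>P\<close>, while the flow is written in coordinates
  centred at the perturbed zero \<open>p\<close>; the mismatch is of first order in the displacement with a small
  factor. Hence the conclusion is about \<open>P + (X 0 - p)\<close> rather than about \<open>X 0\<close>.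
\<close>

lemma departing_orbit:
  obtains A \<theta> \<eta>1 where "A > 0" "\<theta> > 0" "\<eta>1 > 0"
    "\<And>\<eta> g. 0 \<le> \<eta> \<Longrightarrow> \<eta> < \<eta>1 \<Longrightarrow> perturbation \<eta> g \<Longrightarrow>
      \<exists>p X. norm (p - P) \<le> A * \<eta> \<and> departs \<theta> g p X"
proof -
  obtain A \<eta>A where A: "A > 0" "\<eta>A > 0"
    "\<And>\<eta> g. \<eta> < \<eta>A \<Longrightarrow> perturbation \<eta> g \<Longrightarrow> \<exists>p. norm (p - P) \<le> A * \<eta> \<and> f p + g p = 0"
    using zero_of_perturbation by blast
  obtain K where K: "K > 0"
    "\<And>\<eta> g x y. perturbation \<eta> g \<Longrightarrow> \<eta> \<le> 1 \<Longrightarrow>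
      norm (truncated g x - truncated g y) \<le> K * norm (x - y)"
    using truncated_lipschitz by blast
  obtain L where L: "L > 0"
    "\<And>x y. norm x \<le> R \<Longrightarrow> norm y \<le> R \<Longrightarrow> norm (f x - f y) \<le> L * norm (x - y)"
    using C1_lipschitz_on_ball[OF f'] by blast
  obtain n r where n: "n > 0" "r > 0" "\<And>y. norm y \<le> r \<Longrightarrow> n * norm y \<le> norm (f (P + y))"
    using nondegenerate_zero_lower_bound[OF f'(1) zeros(2) nondegenerate(2)] by blast
  define \<rho> where "\<rho> = min r ((R - norm P) / 2)"
  have "\<rho> \<le> (R - norm P) / 2" unfolding \<rho>_def by (rule min.cobounded2)
  then have \<rho>: "\<rho> > 0" "\<rho> \<le> r" "norm P + 2 * \<rho> \<le> R" using n P by (auto simp: \<rho>_def)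
  \<comment> \<open>Two errors of relative size \<open>w / n\<close> cost at most half of the decrease of \<open>V\<close>.\<close>
  define w where "w = \<delta> * n / (4 * C)"
  have "w > 0" using n pos by (simp add: w_def)
  obtain d where d: "d > 0" "\<And>p y. norm (p - P) < d \<Longrightarrow> norm y \<le> \<rho> \<Longrightarrow>
    norm (f (p + y) - f p - (f (P + y) - f P)) \<le> w * norm y"
    using translated_increment_bound[OF f' \<open>w > 0\<close>] by blast
  define \<delta>1 where "\<delta>1 = \<delta> / 2 * n^2"
  have "\<delta>1 > 0" using n pos by (simp add: \<delta>1_def)
  \<comment> \<open>Small enough for the invariance of the cone, and for the starting ray to lie in it.\<close>
  define \<gamma> where "\<gamma> = min (\<delta>1 / (2 * K)) (\<gamma>0 / (norm e)^2)"
  have \<gamma>: "\<gamma> > 0" "2 * \<gamma> * K \<le> \<delta>1" "\<gamma> * (norm e)^2 \<le> \<gamma>0"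
    using \<open>\<delta>1 > 0\<close> K pos departure(1) by (auto simp: \<gamma>_def min_def field_simps)
  define q where "q y = V (P + y) - V P" for y
  define \<eta>1 where "\<eta>1 = Min {\<eta>A, 1, w, min d \<rho> / A}"
  have \<eta>1: "\<eta>1 > 0" "\<eta>1 \<le> \<eta>A" "\<eta>1 \<le> 1" "\<eta>1 \<le> w" "\<eta>1 \<le> min d \<rho> / A"
    using A d \<rho> \<open>w > 0\<close> by (auto simp: \<eta>1_def)
  have "\<exists>p X. norm (p - P) \<le> A * \<eta> \<and> departs (\<gamma> * \<rho>^2) g p X"
    if \<eta>: "0 \<le> \<eta>" "\<eta> < \<eta>1" and g: "perturbation \<eta> g" for \<eta> g
  proof -
    obtain p where p: "norm (p - P) \<le> A * \<eta>" "f p + g p = 0" using A(3)[OF _ g] \<eta> \<eta>1 by auto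
    have "\<eta> < min d \<rho> / A" by (rule less_le_trans[OF \<eta>(2) \<eta>1(5)])
    then have "A * \<eta> < min d \<rho>"
      using A(1) by (simp only: pos_less_divide_eq mult.commute)
    then have pP: "norm (p - P) < d" "norm (p - P) < \<rho>" using p(1) by auto
    have pR: "norm (p + y) \<le> R" if "norm y \<le> \<rho>" for y
    proof -
      have "norm (p + y) \<le> norm P + norm (p - P) + norm y"
        using norm_triangle_ineq[of "P + (p - P)" y] norm_triangle_ineq[of P "p - P"] by simp
      then show ?thesis using pP that \<rho> by simp
    qed
    have "norm p \<le> R" using pR[of 0] \<rho>(1) by simp
    have PR: "norm (P + y) \<le> R" if "norm y \<le> \<rho>" for y
      using norm_triangle_ineq[of P y] that \<rho> by simp
    have q': "(q has_derivative V' (P + y)) (at y)" for y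
    proof -
      have "((\<lambda>y. P + y) has_derivative (\<lambda>h. h)) (at y)"
        by (auto intro!: derivative_eq_intros)
      from has_derivative_compose[OF this V'] show ?thesis
        unfolding q_def by (auto intro!: derivative_eq_intros)
    qed
    have decrease: "V' (P + y) (truncated g (p + y)) \<le> - \<delta>1 * (norm y)^2" if y: "norm y \<le> \<rho>" for y
    proof -
      let ?F = "norm (f (P + y))"
      let ?D = "truncated g (p + y) - f (P + y)"
      have "?D = (f (p + y) - f p - (f (P + y) - f P)) + (g (p + y) - g p)"
        using p(2) zeros truncated_eq[OF pR[OF y]] by (simp add: algebra_simps add_eq_0_iff2)
      also have "norm \<dots> \<le> w * norm y + \<eta> * norm (p + y - p)"
      proof (rule norm_triangle_mono)
        show "norm (g (p + y) - g p) \<le> \<eta> * norm (p + y - p)"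
          using g pR[OF y] \<open>norm p \<le> R\<close> unfolding perturbation_def by blast
      qed (rule d(2)[OF pP(1) y])
      also have "\<dots> \<le> w * norm y + w * norm y"
      proof -
        have "\<eta> \<le> w" using \<eta> \<eta>1 by linarith
        from mult_right_mono[OF this norm_ge_zero[of y]] show ?thesis by simp
      qed
      also have "\<dots> = \<delta> / (2 * C) * (n * norm y)"
        using pos by (simp add: w_def field_simps)
      also have "\<dots> \<le> \<delta> / (2 * C) * ?F"
        using n(3)[of y] y \<rho> pos by (intro mult_left_mono) auto
      finally have D: "norm ?D \<le> \<delta> / (2 * C) * ?F" .
      have "V' (P + y) (truncated g (p + y)) = V' (P + y) (f (P + y)) + V' (P + y) ?D"
        using linear_add[OF has_derivative_linear[OF V'], of "P + y" "f (P + y)" ?D] by simp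
      also have "\<dots> \<le> - \<delta> * ?F^2 + C * ?F * norm ?D"
        using V_decrease[OF PR[OF y]] V_gradient[OF PR[OF y], of ?D] by linarith
      also have "\<dots> \<le> - \<delta> * ?F^2 + C * ?F * (\<delta> / (2 * C) * ?F)"
        using D pos by (intro add_left_mono mult_left_mono) auto
      also have "\<dots> = - (\<delta> / 2) * ?F^2"
        using pos by (simp add: field_simps power2_eq_square)
      also have "\<dots> \<le> - (\<delta> / 2) * (n * norm y)^2"
        using n(1) n(3)[of y] y \<rho> pos by (intro mult_left_mono_neg power_mono) auto
      finally show ?thesis by (simp add: \<delta>1_def power_mult_distrib)
    qed
    have Lf: "norm (f x) \<le> L * norm (x - P)" if "norm x \<le> R" for x
      using L(2)[OF that, of P] P zeros by simp
    interpret saddle_flow "truncated g" K p e q "\<lambda>y. V' (P + y)" "(\<lambda>y. P + y) -` E" \<rho> \<delta>1 \<gamma> "C * L" s0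
    proof
      show "truncated g p = 0" using p(2) truncated_eq[of p] pR[of 0] \<rho> by simp
      show "norm (truncated g x - truncated g y) \<le> K * norm (x - y)" for x y
        using K(2)[OF g] \<eta> \<eta>1 by simp
      show "- (C * L) * (norm y)^2 \<le> q y" if "norm y \<le> \<rho>" for y
        using V_increment_bound[OF zeros(2) PR[OF that] _ Lf L(1)] P by (simp add: q_def)
      show "closed ((\<lambda>y. P + y) -` E)"
        using E(1) by (intro closed_vimage) (auto intro: continuous_intros)
      show "y \<in> interior ((\<lambda>y. P + y) -` E)" if "y \<in> (\<lambda>y. P + y) -` E" "q y < 0" for y
      proof -
        have "P + y \<in> interior E" using E(2)[of "P + y"] that by (simp add: q_def)
        moreover have "open ((\<lambda>y. P + y) -` interior E)"
          by (intro open_vimage) (auto intro: continuous_intros)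
        ultimately show ?thesis
          using interior_maximal[of "(\<lambda>y. P + y) -` interior E" "(\<lambda>y. P + y) -` E"] interior_subset
          by blast
      qed
      show "s *\<^sub>R e \<in> (\<lambda>y. P + y) -` E \<and> q (s *\<^sub>R e) \<le> - \<gamma> * (norm (s *\<^sub>R e))^2"
        if "0 < s" "s \<le> s0" for s
      proof -
        have "\<gamma> * (norm e)^2 * s^2 \<le> \<gamma>0 * s^2" using \<gamma>(3) by (rule mult_right_mono) simp
        then show ?thesis
          using departure(2)[OF that] by (simp add: q_def power_mult_distrib mult_ac)
      qed
    qed (use K \<rho> \<gamma> \<open>\<delta>1 > 0\<close> pos L departure(1) q' decrease in auto)
    obtain X where X: "\<And>t. (X has_vector_derivative truncated g (X t)) (at t)"
      "(X \<longlongrightarrow> p) at_bot" "\<And>t. t \<le> 0 \<Longrightarrow> norm (X t - p) \<le> \<rho>"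
      "X 0 - p \<in> (\<lambda>y. P + y) -` E" "q (X 0 - p) \<le> - \<gamma> * \<rho>^2"
      using unstable_orbit by blast
    have "norm (X t) \<le> R" if "t \<le> 0" for t
      using pR[OF X(3)[OF that]] by simp
    then show ?thesis using p X by (intro exI[of _ p] exI[of _ X]) (auto simp: q_def departs_def)
  qed
  moreover have "\<gamma> * \<rho>^2 > 0" using \<gamma> \<rho> by simp
  ultimately show ?thesis using that[of A "\<gamma> * \<rho>^2" \<eta>1] A(1) \<eta>1(1) by blast
qed

text \<open>
  Near \<open>0\<close> this is nondegeneracy; away from \<open>0\<close> it is compactness, because \<open>f\<close> has no other zero there.
\<close>

lemma f_lower_bound_on_sublevel:
  assumes "c < V P"
  obtains n where "n > 0" "\<And>x. x \<in> E \<Longrightarrow> V x \<le> c \<Longrightarrow> n * norm x \<le> norm (f x)"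
proof -
  obtain n r where n: "n > 0" "r > 0" "\<And>y. norm y \<le> r \<Longrightarrow> n * norm y \<le> norm (f (0 + y))"
    using nondegenerate_zero_lower_bound[OF f'(1) zeros(1) nondegenerate(1)] by blast
  let ?S = "E \<inter> V -` {..c} - ball 0 r"
  have "compact ?S" using E_sublevel_compact[of c] assms by (intro compact_diff) auto
  have cont: "continuous_on ?S (\<lambda>x. norm (f x) / norm x)"
    using n(2) by (intro continuous_intros f_continuous) auto
  show ?thesis
  proof (cases "?S = {}")
    case True
    then have "n * norm x \<le> norm (f x)" if "x \<in> E" "V x \<le> c" for x
      using that n(3)[of x] by (force simp: dist_norm)
    then show ?thesis using that n(1) by blast
  next
    case False
    obtain m where m: "m \<in> ?S" "\<And>x. x \<in> ?S \<Longrightarrow> norm (f m) / norm m \<le> norm (f x) / norm x"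
      using continuous_attains_inf[OF \<open>compact ?S\<close> False cont] by blast
    let ?k = "norm (f m) / norm m"
    have "m \<noteq> 0" using m(1) n(2) by auto
    then have "f m \<noteq> 0" using only_zero[of m] m(1) assms by auto
    then have k: "?k > 0" using \<open>m \<noteq> 0\<close> by simp
    have "min n ?k * norm x \<le> norm (f x)" if x: "x \<in> E" "V x \<le> c" for x
    proof (cases "norm x < r")
      case True
      have "min n ?k * norm x \<le> n * norm x" by (intro mult_right_mono) auto
      then show ?thesis using n(3)[of x] True by simp
    next
      case False
      then have "x \<in> ?S" using x by simp
      then have "?k \<le> norm (f x) / norm x" by (rule m(2))
      moreover have "norm x > 0" using False n(2) by linarith
      ultimately have "?k * norm x \<le> norm (f x)" by (simp only: pos_le_divide_eq)
      moreover have "min n ?k * norm x \<le> ?k * norm x" by (intro mult_right_mono) auto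
      ultimately show ?thesis by linarith
    qed
    then show ?thesis using that[of "min n ?k"] n(1) k by simp
  qed
qed

text \<open>
  The set \<open>{x \<in> E. V x \<le> V P - \<theta>}\<close> is a compact subset of the open set \<open>interior E \<inter> {V < V P - \<theta>/2}\<close>. This
  leaves room \<open>d\<close> for the displacement between \<open>P\<close> and the perturbed zero.
\<close>

lemma captured_orbit:
  assumes "\<theta> > 0"
  obtains d \<eta>2 where "d > 0" "\<eta>2 > 0"
    "\<And>\<eta> g X x0. 0 \<le> \<eta> \<Longrightarrow> \<eta> < \<eta>2 \<Longrightarrow> perturbation \<eta> g \<Longrightarrow>
      (\<And>t. (X has_vector_derivative truncated g (X t)) (at t)) \<Longrightarrow>
      x0 \<in> E \<Longrightarrow> V x0 \<le> V P - \<theta> \<Longrightarrow> norm (X 0 - x0) < d \<Longrightarrow>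
      (X \<longlongrightarrow> 0) at_top \<and> (\<forall>t\<ge>0. norm (X t) \<le> R)"
proof -
  define c where "c = V P - \<theta> / 2"
  have c: "V P - \<theta> < c" "c < V P" using assms by (auto simp: c_def)
  obtain n where n: "n > 0" "\<And>x. x \<in> E \<Longrightarrow> V x \<le> c \<Longrightarrow> n * norm x \<le> norm (f x)"
    using f_lower_bound_on_sublevel[OF c(2)] by blast
  obtain L where L: "L > 0"
    "\<And>x y. norm x \<le> R \<Longrightarrow> norm y \<le> R \<Longrightarrow> norm (f x - f y) \<le> L * norm (x - y)"
    using C1_lipschitz_on_ball[OF f'] by blast
  have "open (interior E \<inter> V -` {..<c})"
    using V_continuous[of UNIV] by (intro open_Int open_vimage) auto
  moreover have "E \<inter> V -` {..V P - \<theta>} \<subseteq> interior E \<inter> V -` {..<c}"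
    using c E(2) by auto
  moreover have "compact (E \<inter> V -` {..V P - \<theta>})"
    using E_sublevel_compact[of "V P - \<theta>"] assms by simp
  ultimately obtain d where d: "d > 0"
    "(\<Union>x\<in>E \<inter> V -` {..V P - \<theta>}. ball x d) \<subseteq> interior E \<inter> V -` {..<c}"
    using compact_subset_open_imp_ball_epsilon_subset by metis
  define l where "l = \<delta> / 2 * n^2 / (C * L)"
  have "l > 0" using n pos L by (simp add: l_def)
  have "(X \<longlongrightarrow> 0) at_top \<and> (\<forall>t\<ge>0. norm (X t) \<le> R)"
    if \<eta>: "0 \<le> \<eta>" "\<eta> < \<delta> * n / (2 * C)" and g: "perturbation \<eta> g"
      and X: "\<And>t. (X has_vector_derivative truncated g (X t)) (at t)"
      and x0: "x0 \<in> E" "V x0 \<le> V P - \<theta>" "norm (X 0 - x0) < d" for \<eta> g X x0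
  proof -
    have "X 0 \<in> ball x0 d" using x0(3) by (simp add: dist_norm norm_minus_commute)
    then have "X 0 \<in> interior E \<inter> V -` {..<c}"
      using d(2) x0(1,2) by blast
    then have X0: "X 0 \<in> E" "V (X 0) < c"
      using interior_subset by auto
    have decrease: "V' x (truncated g x) \<le> - l * V x" if x: "x \<in> E" "V x < c" for x
    proof -
      have R: "norm x \<le> R" using E_sublevel_bounded x c by simp
      have fx: "n * norm x \<le> norm (f x)" using n(2) x by simp
      have "V' x (truncated g x) = V' x (f x) + V' x (g x)"
        using linear_add[OF has_derivative_linear[OF V'], of x "f x" "g x"] truncated_eq[OF R] by simp
      also have "\<dots> \<le> - \<delta> * (norm (f x))^2 + C * norm (f x) * norm (g x)"
        using V_decrease[OF R] V_gradient[OF R, of "g x"] by linarith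
      also have "\<dots> \<le> - \<delta> * (norm (f x))^2 + C * norm (f x) * (\<delta> / (2 * C) * norm (f x))"
      proof -
        have "norm (g x) \<le> \<eta> * norm x" by (rule perturbation_bound[OF g R])
        also have "\<dots> \<le> \<delta> * n / (2 * C) * norm x" using \<eta> by (intro mult_right_mono) auto
        also have "\<dots> = \<delta> / (2 * C) * (n * norm x)" by simp
        also have "\<dots> \<le> \<delta> / (2 * C) * norm (f x)"
          using fx pos by (intro mult_left_mono) auto
        finally show ?thesis using pos by (intro add_left_mono mult_left_mono) auto
      qed
      also have "\<dots> = - (\<delta> / 2) * (norm (f x))^2"
        using pos by (simp add: field_simps power2_eq_square)
      also have "\<dots> \<le> - (\<delta> / 2) * (n * norm x)^2"
        using n(1) fx pos by (intro mult_left_mono_neg power_mono) auto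
      also have "\<dots> = - l * (C * L * (norm x)^2)"
        using pos L by (simp add: l_def power_mult_distrib)
      also have "\<dots> \<le> - l * V x"
      proof -
        have "\<bar>V (0 + x) - V 0\<bar> \<le> C * L * (norm x)^2"
          using R pos L zeros(1) L(2)[of _ 0] by (intro V_increment_bound) auto
        then show ?thesis using \<open>l > 0\<close> V0 by simp
      qed
      finally show ?thesis .
    qed
    have inter: "x \<in> interior E" if "x \<in> E" "V x < c" for x using E(2) that c by simp
    note trap = trapped_solution_converges[OF X V' E(1) inter pos(2) coercive(1) \<open>l > 0\<close> decrease X0]
    then show ?thesis using E_sublevel_bounded c by (meson less_imp_le order_trans)
  qed
  then show ?thesis using that[of d "\<delta> * n / (2 * C)"] d(1) n pos by simp
qed

text \<open>
  The orbit that departs from the perturbed zero arrives, within the tolerance \<open>d\<close>, at a point of the well below the level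
  of the pass, where it is captured.
\<close>

theorem heteroclinic_orbit_persists:
  obtains A \<eta>0 where "A > 0" "\<eta>0 > 0"
    "\<And>\<eta> g. 0 \<le> \<eta> \<Longrightarrow> \<eta> < \<eta>0 \<Longrightarrow> perturbation \<eta> g \<Longrightarrow>
      \<exists>p X. norm (p - P) \<le> A * \<eta> \<and> connects_to_zero (\<lambda>x. f x + g x) p X"
proof -
  obtain A \<theta> \<eta>1 where A: "A > 0" "\<theta> > 0" "\<eta>1 > 0"
    "\<And>\<eta> g. 0 \<le> \<eta> \<Longrightarrow> \<eta> < \<eta>1 \<Longrightarrow> perturbation \<eta> g \<Longrightarrow>
      \<exists>p X. norm (p - P) \<le> A * \<eta> \<and> departs \<theta> g p X"
    using departing_orbit by blast
  obtain d \<eta>2 where d: "d > 0" "\<eta>2 > 0"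
    "\<And>\<eta> g X x0. 0 \<le> \<eta> \<Longrightarrow> \<eta> < \<eta>2 \<Longrightarrow> perturbation \<eta> g \<Longrightarrow>
      (\<And>t. (X has_vector_derivative truncated g (X t)) (at t)) \<Longrightarrow>
      x0 \<in> E \<Longrightarrow> V x0 \<le> V P - \<theta> \<Longrightarrow> norm (X 0 - x0) < d \<Longrightarrow>
      (X \<longlongrightarrow> 0) at_top \<and> (\<forall>t\<ge>0. norm (X t) \<le> R)"
    using captured_orbit[OF A(2)] by blast
  define \<eta>0 where "\<eta>0 = Min {\<eta>1, \<eta>2, d / A, norm P / A}"
  have \<eta>0: "\<eta>0 > 0" "\<eta>0 \<le> \<eta>1" "\<eta>0 \<le> \<eta>2" "\<eta>0 \<le> d / A" "\<eta>0 \<le> norm P / A"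
    using A d P by (auto simp: \<eta>0_def)
  have "\<exists>p X. norm (p - P) \<le> A * \<eta> \<and> connects_to_zero (\<lambda>x. f x + g x) p X"
    if \<eta>: "0 \<le> \<eta>" "\<eta> < \<eta>0" and g: "perturbation \<eta> g" for \<eta> g
  proof -
    obtain p X where p: "norm (p - P) \<le> A * \<eta>" "f p + g p = 0"
      and X: "\<And>t. (X has_vector_derivative truncated g (X t)) (at t)" "(X \<longlongrightarrow> p) at_bot"
        "\<And>t. t \<le> 0 \<Longrightarrow> norm (X t) \<le> R" "P + (X 0 - p) \<in> E" "V (P + (X 0 - p)) \<le> V P - \<theta>"
      using A(4)[OF \<eta>(1) _ g] \<eta> \<eta>0 unfolding departs_def by force
    have "\<eta> < d / A" "\<eta> < norm P / A" using \<eta> \<eta>0(4,5) by auto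
    then have "A * \<eta> < d" "A * \<eta> < norm P"
      using A(1) by (simp_all add: field_simps)
    then have "norm (p - P) < d" "p \<noteq> 0" using p(1) by auto
    then have "norm (X 0 - (P + (X 0 - p))) < d" by simp
    from d(3)[OF \<eta>(1) _ g X(1,4,5) this]
    have "(X \<longlongrightarrow> 0) at_top" "\<And>t. t \<ge> 0 \<Longrightarrow> norm (X t) \<le> R" using \<eta> \<eta>0 by auto
    moreover from this X(3) have "norm (X t) \<le> R" for t by (cases "t \<ge> 0") auto
    then have "(X has_vector_derivative f (X t) + g (X t)) (at t)" for t
      using X(1)[of t] truncated_eq by metis
    ultimately show ?thesis using p X(2) \<open>p \<noteq> 0\<close> unfolding connects_to_zero_def by blast
  qed
  then show ?thesis using that A(1) \<eta>0(1) by blast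
qed

end

section \<open>The amplitude potential along rays\<close>

lemma sum_products_le:
  fixes u v w :: real
  shows "3 * (u * v + v * w + w * u) \<le> (u + v + w)^2"
proof -
  have "(u + v + w)^2 - 3 * (u * v + v * w + w * u) = ((u - v)^2 + (v - w)^2 + (w - u)^2) / 2"
    by (simp add: field_simps power2_eq_square)
  moreover have "\<dots> \<ge> 0" by simp
  ultimately show ?thesis by linarith
qed

lemma product_sum_le:
  fixes u v w :: real
  shows "3 * (u + v + w) * (u * v * w) \<le> (u * v + v * w + w * u)^2"
  using sum_products_le[of "u * v" "v * w" "w * u"] by (simp add: algebra_simps)

lemma product_le_of_zero_sum_products:
  fixes u v w :: real
  assumes "u * v + v * w + w * u = 0" "u + v + w \<ge> 0"
  shows "u * v * w \<le> 0"
proof (cases "u + v + w = 0")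
  case True
  have "(u + v + w)^2 = u^2 + v^2 + w^2 + 2 * (u * v + v * w + w * u)"
    by (simp add: algebra_simps power2_eq_square)
  then have "u^2 + v^2 + w^2 = 0" using True assms by simp
  then have "u = 0" by (smt (verit) zero_le_power2 zero_eq_power2)
  then show ?thesis by simp
next
  case False
  then have pos: "u + v + w > 0" using assms by simp
  have "3 * (u + v + w) * (u * v * w) \<le> 0" using product_sum_le[of u v w] assms by simp
  then show ?thesis using pos by (simp add: mult_le_0_iff)
qed

text \<open>
  For fixed first and second symmetric functions of the three squares, their product is largest when the two smaller
  squares coincide. The common value
  \<open>s\<close> is the smaller critical point of the cubic polynomial with the three squares as roots; at its local maximum this
  polynomial is nonnegative.
\<close>

lemma two_equal_squares:
  fixes x y z :: real
  obtains a d where "0 \<le> a" "a \<le> d" "x^2 + y^2 + z^2 = 2 * a^2 + d^2"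
    "x^2 * y^2 + y^2 * z^2 + z^2 * x^2 = a^4 + 2 * a^2 * d^2"
    "- (a^2 * d) \<le> x * y * z"
proof -
  define e1 e2 where "e1 = x^2 + y^2 + z^2" and "e2 = x^2 * y^2 + y^2 * z^2 + z^2 * x^2"
  have e: "e1 \<ge> 0" "e2 \<ge> 0" by (auto simp: e1_def e2_def)
  have disc: "3 * e2 \<le> e1^2"
    unfolding e1_def e2_def by (rule sum_products_le)
  define w where "w = sqrt (e1^2 - 3 * e2)"
  have w: "w \<ge> 0" "w^2 = e1^2 - 3 * e2" unfolding w_def using disc by simp_all
  have "w \<le> e1" by (rule power2_le_imp_le) (use w e in auto)
  define s r where "s = (e1 - w) / 3" and "r = e1 - 2 * s"
  have "r - s = w" by (simp add: s_def r_def field_simps)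
  then have "s \<le> r" using w(1) by linarith
  moreover have "0 \<le> s" using \<open>w \<le> e1\<close> by (simp add: s_def)
  ultimately have s: "0 \<le> s" "s \<le> r" by auto
  have "3 * s^2 - 2 * e1 * s + e2 = (w^2 - e1\<^sup>2 + 3 * e2) / 3"
    by (simp add: s_def power2_eq_square field_simps)
  then have crit: "3 * s^2 - 2 * e1 * s + e2 = 0" using w(2) by simp
  have "(x^2 - s) * (y^2 - s) * (z^2 - s) \<le> 0"
  proof (rule product_le_of_zero_sum_products)
    show "(x^2 - s) * (y^2 - s) + (y^2 - s) * (z^2 - s) + (z^2 - s) * (x^2 - s) = 0"
      using crit by (simp add: e1_def e2_def algebra_simps power2_eq_square)
    have "x^2 - s + (y^2 - s) + (z^2 - s) = e1 - 3 * s" by (simp add: e1_def)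
    then show "x^2 - s + (y^2 - s) + (z^2 - s) \<ge> 0" using w(1) by (simp add: s_def)
  qed
  moreover have "(x^2 - s) * (y^2 - s) * (z^2 - s) = (x * y * z)^2 - s * e2 + s^2 * e1 - s^3"
    by (simp add: e1_def e2_def algebra_simps power2_eq_square power3_eq_cube)
  moreover have "s * e2 - s\<^sup>2 * e1 + s^3 = s^2 * r + s * (3 * s^2 - 2 * e1 * s + e2)"
    by (simp add: r_def algebra_simps power2_eq_square power3_eq_cube)
  ultimately have le: "(x * y * z)^2 \<le> s^2 * r" using crit by simp
  define a d where "a = sqrt s" and "d = sqrt r"
  have ad: "a^2 = s" "d^2 = r" using s by (auto simp: a_def d_def)
  have "0 \<le> a" "a \<le> d" using s by (auto simp: a_def d_def)
  moreover have "x^2 + y^2 + z^2 = 2 * a^2 + d^2" unfolding ad by (simp add: r_def e1_def)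
  moreover have "e2 = a^4 + 2 * a^2 * d^2"
  proof -
    have "a^4 = s^2" using ad(1) by (simp add: power4_eq_xxxx power2_eq_square)
    then show ?thesis unfolding ad using crit by (simp add: r_def algebra_simps power2_eq_square)
  qed
  moreover have "- (a^2 * d) \<le> x * y * z"
  proof -
    have "(x * y * z)^2 \<le> (a^2 * d)^2" using le unfolding power_mult_distrib ad by simp
    then have "\<bar>x * y * z\<bar> \<le> \<bar>a^2 * d\<bar>" by (simp only: abs_le_square_iff)
    moreover have "\<bar>a^2 * d\<bar> = a^2 * d" using \<open>0 \<le> a\<close> \<open>a \<le> d\<close> by simp
    ultimately show ?thesis by linarith
  qed
  ultimately show ?thesis using that[of a d] by (simp add: e2_def)
qed

text \<open>
  The parameter \<open>\<mu>\<close> is \<open>\<mu>\<^sub>0\<close> and \<open>\<beta>\<close> is \<open>\<beta>\<^sub>2\<close>.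
\<close>

locale amplitude_potential =
  fixes \<mu> \<beta> K0 K2 :: real
  assumes \<mu>: "\<mu> > 0" and \<beta>: "\<beta> \<ge> 0" and K: "K0 < 0" "K2 < 0"
begin

definition U :: "real \<Rightarrow> real \<Rightarrow> real \<Rightarrow> real" where
  "U x y z = \<mu> / 2 * (x^2 + y^2 + z^2) + \<beta> * x * y * z
     + K0 / 4 * (x^4 + y^4 + z^4) + K2 / 2 * (x^2 * y^2 + y^2 * z^2 + z^2 * x^2)"

text \<open>
  The radial derivative \<open>A \<bullet> \<nabla>U\<close>. Its nonzero zeros form the Nehari manifold of \<open>U\<close>.
\<close>

definition radial :: "real \<Rightarrow> real \<Rightarrow> real \<Rightarrow> real" where
  "radial x y z = \<mu> * (x^2 + y^2 + z^2) + 3 * \<beta> * x * y * z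
     + K0 * (x^4 + y^4 + z^4) + 2 * K2 * (x^2 * y^2 + y^2 * z^2 + z^2 * x^2)"

definition quadratic_part :: "real \<Rightarrow> real \<Rightarrow> real \<Rightarrow> real" where
  "quadratic_part x y z = \<mu> * (x^2 + y^2 + z^2)"

definition quartic_part :: "real \<Rightarrow> real \<Rightarrow> real \<Rightarrow> real" where
  "quartic_part x y z = - K0 * (x^4 + y^4 + z^4) - 2 * K2 * (x^2 * y^2 + y^2 * z^2 + z^2 * x^2)"

lemma parts_nonneg: "0 \<le> quadratic_part x y z" "0 \<le> quartic_part x y z"
proof -
  have "0 \<le> - K0 * (x^4 + y^4 + z^4)" "0 \<le> - (2 * K2) * (x^2 * y^2 + y^2 * z^2 + z^2 * x^2)"
    using K by (intro mult_nonneg_nonneg; simp)+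
  then show "0 \<le> quartic_part x y z" by (simp add: quartic_part_def)
  show "0 \<le> quadratic_part x y z" using \<mu> by (simp add: quadratic_part_def)
qed

lemma U_ray: "U (t * x) (t * y) (t * z)
    = quadratic_part x y z / 2 * t^2 + \<beta> * x * y * z * t^3 - quartic_part x y z / 4 * t^4"
  and radial_ray: "radial (t * x) (t * y) (t * z)
    = quadratic_part x y z * t^2 + 3 * (\<beta> * x * y * z) * t^3 - quartic_part x y z * t^4"
  by (simp_all add: U_def radial_def quadratic_part_def quartic_part_def field_simps
      power2_eq_square power3_eq_cube power4_eq_xxxx)

text \<open>
  Eliminating the cubic part between \<open>U\<close> and \<open>radial\<close> leaves a sixth of the quadratic part plus a twelfth of the
  quartic part as a lower bound.
\<close>

lemma U_coercive:
  assumes "radial x y z \<ge> 0"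
  shows "\<mu> / 6 * (x^2 + y^2 + z^2) \<le> U x y z"
proof -
  have "quadratic_part x y z / 6 \<le> U x y z"
    using assms parts_nonneg[of x y z] U_ray[of 1 x y z] radial_ray[of 1 x y z] by simp
  then show ?thesis by (simp add: quadratic_part_def)
qed

lemma cubic_part_on_rim:
  "radial x y z = 0 \<Longrightarrow> \<beta> * x * y * z = (quartic_part x y z - quadratic_part x y z) / 3"
  using radial_ray[of 1 x y z] by simp

text \<open>
  On the rim the cubic part is determined by the other two, and the difference of the two levels is then \<open>(1 - t)\<^sup>2\<close> times a
  polynomial in \<open>t\<close> with nonnegative coefficients.
\<close>

lemma U_max_on_ray:
  assumes "radial x y z = 0" and "t \<ge> 0"
  shows "U x y z - U (t * x) (t * y) (t * z) \<ge> \<mu> / 6 * (x^2 + y^2 + z^2) * (1 - t)^2"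
proof -
  define s Q where "s = quadratic_part x y z" and "Q = quartic_part x y z"
  have "s \<ge> 0" "Q \<ge> 0" using parts_nonneg by (auto simp: s_def Q_def)
  have "U x y z - U (t * x) (t * y) (t * z)
      = s / 6 * (1 - t)^2 * (1 + 2 * t) + Q / 12 * (1 - t)^2 * (1 + 2 * t + 3 * t^2)"
    using U_ray[of 1 x y z] unfolding U_ray[of t] cubic_part_on_rim[OF assms(1)] s_def[symmetric] Q_def[symmetric]
    by (simp add: field_simps power2_eq_square power3_eq_cube power4_eq_xxxx)
  moreover have "s / 6 * (1 - t)^2 * (1 + 2 * t) \<ge> s / 6 * (1 - t)^2 * 1"
    using \<open>s \<ge> 0\<close> \<open>t \<ge> 0\<close> by (intro mult_left_mono) auto
  moreover have "Q / 12 * (1 - t)^2 * (1 + 2 * t + 3 * t^2) \<ge> 0"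
    using \<open>Q \<ge> 0\<close> \<open>t \<ge> 0\<close> by simp
  ultimately show ?thesis by (simp add: s_def quadratic_part_def)
qed

text \<open>
  To bound \<open>U\<close> from below at a point of the rim it is enough to do so at one point of its ray.
\<close>

lemma radial_zero_ge:
  assumes "radial x y z = 0" "t \<ge> 0" "U (t * x) (t * y) (t * z) \<ge> c"
  shows "U x y z \<ge> c"
proof -
  have "\<mu> / 6 * (x^2 + y^2 + z^2) * (1 - t)^2 \<ge> 0" using \<mu> by (intro mult_nonneg_nonneg) auto
  then show ?thesis using U_max_on_ray[OF assms(1,2)] assms(3) by linarith
qed

lemma U_ge_two_equal:
  assumes "x^2 + y^2 + z^2 = 2 * a^2 + d^2"
    "x^2 * y^2 + y^2 * z^2 + z^2 * x^2 = a^4 + 2 * a^2 * d^2"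
    "- (a^2 * d) \<le> x * y * z"
  shows "U a a (- d) \<le> U x y z"
proof -
  have four: "x^4 + y^4 + z^4 = (x^2 + y^2 + z^2)^2 - 2 * (x^2 * y^2 + y^2 * z^2 + z^2 * x^2)" for x y z :: real
    by (simp add: algebra_simps power2_eq_square power4_eq_xxxx)
  have "x^4 + y^4 + z^4 = 2 * a^4 + d^4"
    unfolding four assms by (simp add: algebra_simps power2_eq_square power4_eq_xxxx)
  moreover have "\<beta> * - (a^2 * d) \<le> \<beta> * (x * y * z)" using assms(3) \<beta> by (rule mult_left_mono)
  ultimately show ?thesis
    using assms(1,2) by (simp add: U_def algebra_simps power2_eq_square power4_eq_xxxx)
qed

section \<open>The lowest point on the boundary of the well\<close>

text \<open>
  The common amplitude of the down-hexagons is \<open>- hex\<close>.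
\<close>

definition hex :: real where
  "hex = (\<beta> - sqrt (\<beta>^2 - 4 * \<mu> * (K0 + 2 * K2))) / (2 * (K0 + 2 * K2))"

lemma hex_eq: "hex > 0" "\<mu> = - (K0 + 2 * K2) * hex^2 + \<beta> * hex"
proof -
  define w where "w = sqrt (\<beta>^2 - 4 * \<mu> * (K0 + 2 * K2))"
  have neg: "K0 + 2 * K2 < 0" using K by simp
  then have "4 * \<mu> * (K0 + 2 * K2) < 0" using \<mu> by (intro mult_pos_neg) auto
  then have gt: "\<beta>^2 < \<beta>^2 - 4 * \<mu> * (K0 + 2 * K2)" by linarith
  then have "0 \<le> \<beta>^2 - 4 * \<mu> * (K0 + 2 * K2)" using zero_le_power2[of \<beta>] by linarith
  then have w: "w^2 = \<beta>^2 - 4 * \<mu> * (K0 + 2 * K2)" "\<beta>^2 < w^2" "w \<ge> 0"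
    using gt unfolding w_def by auto
  have "\<beta> < w" by (rule power2_less_imp_less[OF w(2,3)])
  then show "hex > 0" using neg by (simp add: hex_def w_def[symmetric] zero_less_divide_iff)
  define g where "g = K0 + 2 * K2"
  have h: "2 * g * hex = \<beta> - w" using neg by (simp add: hex_def w_def g_def)
  have "4 * g * (- g * hex^2 + \<beta> * hex) = - (2 * g * hex)\<^sup>2 + 2 * \<beta> * (2 * g * hex)"
    by (simp add: algebra_simps power2_eq_square)
  also have "\<dots> = 4 * g * \<mu>"
    unfolding h using w(1) by (simp add: g_def algebra_simps power2_eq_square)
  finally show "\<mu> = - (K0 + 2 * K2) * hex^2 + \<beta> * hex" using neg by (simp add: g_def)
qed


text \<open>
  On the sphere through the hexagon the cubic part is smallest at the hexagon, by the inequality of arithmetic and geometric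
  means. For \<open>K2 \<le> K0\<close> the same holds for the quartic part, which depends only on the sum of the products of the squares.
\<close>

lemma hex_lowest_of_K2_le_K0:
  assumes "K2 \<le> K0" "radial x y z = 0" "(x, y, z) \<noteq> (0, 0, 0)"
  shows "U (- hex) (- hex) (- hex) \<le> U x y z"
proof -
  define s where "s = x^2 + y^2 + z^2"
  have "s > 0" using assms(3) by (auto simp: s_def add_nonneg_pos add_pos_nonneg)
  \<comment> \<open>The factor that moves the point onto the sphere through the hexagon.\<close>
  define t where "t = sqrt 3 * hex / sqrt s"
  have t: "t \<ge> 0" "t^2 * s = 3 * hex^2"
    using \<open>s > 0\<close> hex_eq(1) by (auto simp: t_def power_divide power_mult_distrib)
  define u v w where "u = t * x" and "v = t * y" and "w = t * z"
  have sq: "u^2 + v^2 + w^2 = 3 * hex^2"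
    using t(2) by (simp add: u_def v_def w_def s_def power_mult_distrib algebra_simps)
  define e2 where "e2 = u^2 * v^2 + v^2 * w^2 + w^2 * u^2"
  have "3 * e2 \<le> (3 * hex^2)^2"
    using sum_products_le[of "u^2" "v^2" "w^2"] unfolding sq e2_def .
  then have e2: "e2 \<le> 3 * hex^4" by (simp add: power2_eq_square power4_eq_xxxx)
  have "3 * (3 * hex^2) * (u^2 * v^2 * w^2) \<le> e2^2"
    using product_sum_le[of "u^2" "v^2" "w^2"] unfolding sq e2_def .
  also have "\<dots> \<le> (3 * hex^4)^2"
    using e2 by (intro power_mono) (auto simp: e2_def)
  also have "\<dots> = 3 * (3 * hex^2) * (hex^3)^2"
    by (simp add: power2_eq_square power3_eq_cube power4_eq_xxxx)
  finally have "u^2 * v^2 * w^2 \<le> (hex^3)^2"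
    by (rule mult_left_le_imp_le) (use hex_eq(1) in simp)
  then have "(u * v * w)^2 \<le> (hex^3)^2" by (simp only: power_mult_distrib)
  then have "\<bar>u * v * w\<bar> \<le> \<bar>hex^3\<bar>" by (simp only: abs_le_square_iff)
  moreover have "\<bar>hex^3\<bar> = hex^3" using hex_eq(1) by simp
  ultimately have p: "- (hex^3) \<le> u * v * w" by linarith
  have "\<beta> * - (hex^3) \<le> \<beta> * (u * v * w)" using p \<beta> by (rule mult_left_mono)
  moreover have "(K2 - K0) / 2 * (3 * hex^4) \<le> (K2 - K0) / 2 * e2"
    using e2 assms(1) by (intro mult_left_mono_neg) auto
  moreover have "U u v w = \<mu> / 2 * (3 * hex^2) + \<beta> * (u * v * w) + K0 / 4 * (3 * hex^2)^2 + (K2 - K0) / 2 * e2"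
    unfolding sq[symmetric]
    by (simp add: U_def e2_def field_simps power2_eq_square power4_eq_xxxx)
  moreover have "U (- hex) (- hex) (- hex) =
      \<mu> / 2 * (3 * hex^2) + \<beta> * - (hex^3) + K0 / 4 * (3 * hex^2)^2 + (K2 - K0) / 2 * (3 * hex^4)"
    by (simp add: U_def field_simps power2_eq_square power3_eq_cube power4_eq_xxxx)
  ultimately have "U (- hex) (- hex) (- hex) \<le> U u v w" by linarith
  then show ?thesis
    using radial_zero_ge[OF assms(2) t(1)] by (simp add: u_def v_def w_def)
qed

definition roll :: real where "roll = sqrt (- \<mu> / K0)"

lemma roll_eq: "roll > 0" "\<mu> = - K0 * roll^2"
proof -
  have "- \<mu> / K0 > 0" using divide_pos_neg[OF \<mu> K(1)] by simp
  then show "roll > 0" "\<mu> = - K0 * roll^2" using K by (auto simp: roll_def)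
qed

lemma hex_less_roll: "hex < roll"
proof (rule power2_less_imp_less)
  have "K2 * hex^2 < 0" using K hex_eq(1) by (simp add: mult_neg_pos)
  moreover have "\<beta> * hex \<ge> 0" using \<beta> hex_eq(1) by simp
  ultimately have "- K0 * hex^2 < - K0 * roll^2"
    using hex_eq(2) roll_eq(2) by (simp add: algebra_simps)
  then show "hex^2 < roll^2" using K by simp
qed (use roll_eq in simp)

text \<open>
  The maximum of \<open>U (a, a, - x)\<close> over \<open>a\<^sup>2\<close>, when \<open>a\<^sup>2\<close> is allowed to be negative: for fixed \<open>x\<close>, the potential is a
  concave quadratic polynomial in \<open>a\<^sup>2\<close>.
\<close>

definition ridge :: "real \<Rightarrow> real" where
  "ridge x = (\<mu> - \<beta> * x + K2 * x^2)^2 / (- 2 * (K0 + K2)) + \<mu> / 2 * x^2 + K0 / 4 * x^4"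

lemma U_two_equal_ridge:
  "U a a (- x) = ridge x - (\<mu> - \<beta> * x + K2 * x^2 + (K0 + K2) * a^2)\<^sup>2 / (- 2 * (K0 + K2))"
proof -
  have "K0 + K2 \<noteq> 0" using K by simp
  then show ?thesis
    by (simp add: U_def ridge_def divide_simps)
      (simp add: algebra_simps power2_eq_square power4_eq_xxxx)
qed

text \<open>
  Where the maximum is attained at some \<open>a\<^sup>2 > 0\<close>, a critical point of the ridge is one of \<open>U\<close> with \<open>A1 = A2\<close>: a hexagon, or a
  mixed mode with \<open>x = \<beta> / (K2 - K0)\<close>. These give the two factors.
\<close>

lemma ridge_deriv:
  "(ridge has_real_derivative
     (- (K0 + 2 * K2) * x^2 + \<beta> * x - \<mu>) * (\<beta> + (K0 - K2) * x) / (- (K0 + K2))) (at x)"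
proof -
  have "K0 + K2 \<noteq> 0" using K by simp
  then show ?thesis unfolding ridge_def
    by (auto intro!: derivative_eq_intros simp: divide_simps)
      (simp add: algebra_simps power2_eq_square power3_eq_cube power4_eq_xxxx)
qed

text \<open>
  Between the hexagon and the roll wave the first factor of the derivative is nonnegative and the second one is decreasing,
  so the ridge increases up to the mixed mode and decreases afterwards.
\<close>

lemma ridge_ge:
  assumes K2: "K0 < K2" and x: "hex \<le> x" "x \<le> roll"
  shows "min (ridge hex) (ridge roll) \<le> ridge x"
proof -
  let ?d = "\<lambda>y. (- (K0 + 2 * K2) * y^2 + \<beta> * y - \<mu>) * (\<beta> + (K0 - K2) * y) / (- (K0 + K2))"
  have first: "- (K0 + 2 * K2) * y^2 + \<beta> * y - \<mu> \<ge> 0" if "hex \<le> y" for y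
  proof -
    have "- (K0 + 2 * K2) * hex^2 \<le> - (K0 + 2 * K2) * y^2"
      using that hex_eq(1) K by (intro mult_left_mono power_mono) auto
    moreover have "\<beta> * hex \<le> \<beta> * y" using that \<beta> by (rule mult_left_mono)
    ultimately show ?thesis using hex_eq(2) by linarith
  qed
  show ?thesis
  proof (cases "\<beta> + (K0 - K2) * x \<ge> 0")
    case True
    have "ridge hex \<le> ridge x"
    proof (rule DERIV_nonneg_imp_nondecreasing[OF x(1)])
      fix y assume y: "hex \<le> y" "y \<le> x"
      have "(K0 - K2) * x \<le> (K0 - K2) * y" using y K2 by (intro mult_left_mono_neg) auto
      then have "\<beta> + (K0 - K2) * y \<ge> 0" using True by linarith
      then have "?d y \<ge> 0"
        using first[OF y(1)] K by (intro divide_nonneg_pos mult_nonneg_nonneg) auto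
      then show "\<exists>d. (ridge has_real_derivative d) (at y) \<and> 0 \<le> d" using ridge_deriv by blast
    qed
    then show ?thesis by simp
  next
    case False
    have "ridge roll \<le> ridge x"
    proof (rule DERIV_nonpos_imp_nonincreasing[OF x(2)])
      fix y assume y: "x \<le> y" "y \<le> roll"
      have "(K0 - K2) * y \<le> (K0 - K2) * x" using y K2 by (intro mult_left_mono_neg) auto
      then have "\<beta> + (K0 - K2) * y \<le> 0" using False by linarith
      then have "?d y \<le> 0"
        using first[of y] x y K by (intro divide_nonpos_pos mult_nonneg_nonpos) auto
      then show "\<exists>d. (ridge has_real_derivative d) (at y) \<and> d \<le> 0" using ridge_deriv by blast
    qed
    then show ?thesis by simp
  qed
qed

lemma ridge_hex: "ridge hex = U (- hex) (- hex) (- hex)"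
proof -
  have "\<mu> - \<beta> * hex + K2 * hex^2 + (K0 + K2) * hex^2 = 0" using hex_eq(2) by (simp add: algebra_simps)
  then have "U hex hex (- hex) = ridge hex" using U_two_equal_ridge[of hex hex] by simp
  then show ?thesis by (simp add: U_def)
qed

lemma U_roll_two_equal:
  "U a a (- roll) = U 0 0 roll + a^2 * (\<mu> - \<beta> * roll + K2 * roll^2 + (K0 + K2) / 2 * a^2)"
  by (simp add: U_def field_simps power2_eq_square power4_eq_xxxx)

lemma ridge_roll: "U 0 0 roll \<le> ridge roll"
proof -
  have "(\<mu> - \<beta> * roll + K2 * roll^2)^2 / (- 2 * (K0 + K2)) \<ge> 0" using K by (intro divide_nonneg_pos) auto
  then show ?thesis by (simp add: ridge_def U_def)
qed

text \<open>
  By symmetry of \<open>U\<close> and \<open>two_equal_squares\<close> the direction may be taken as \<open>(w, w, - 1)\<close> with \<open>0 \<le> w \<le> 1\<close>. Its ray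
  either meets the ridge between the hexagon and the roll wave, or it meets the plane \<open>x = roll\<close> before the ridge does.
  In this plane \<open>U\<close> is concave in \<open>a\<^sup>2\<close> and increases from the roll wave towards the ridge.
\<close>

lemma hex_or_roll_lowest:
  assumes "K0 < K2" "radial x y z = 0" "(x, y, z) \<noteq> (0, 0, 0)"
  shows "min (U (- hex) (- hex) (- hex)) (U 0 0 roll) \<le> U x y z"
proof -
  obtain a d where ad: "0 \<le> a" "a \<le> d" "x^2 + y^2 + z^2 = 2 * a^2 + d^2"
    "x^2 * y^2 + y^2 * z^2 + z^2 * x^2 = a^4 + 2 * a^2 * d^2"
    "- (a^2 * d) \<le> x * y * z"
    using two_equal_squares by blast
  have "x^2 + y^2 + z^2 \<noteq> 0" using assms(3) by (auto simp: add_nonneg_eq_0_iff)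
  then have "d > 0" using ad(1,2,3) by (cases "d = 0") auto
  define w where "w = a / d"
  have w: "0 \<le> w" "w \<le> 1" using ad \<open>d > 0\<close> by (auto simp: w_def)
  have "\<exists>X\<ge>0. min (U (- hex) (- hex) (- hex)) (U 0 0 roll) \<le> U (w * X) (w * X) (- X)"
  proof -
    \<comment> \<open>The sign of \<open>h\<close> tells on which side of the ridge the point of the ray with third coordinate \<open>- X\<close> lies.\<close>
    define h where "h X = \<mu> - \<beta> * X + K2 * X^2 + (K0 + K2) * (w * X)^2" for X
    show ?thesis
    proof (cases "h roll \<ge> 0")
      case True
      have "(K0 + K2) / 2 * (w * roll)^2 \<ge> (K0 + K2) * (w * roll)^2"
        using K by (intro mult_right_mono) auto
      then have "\<mu> - \<beta> * roll + K2 * roll^2 + (K0 + K2) / 2 * (w * roll)^2 \<ge> 0"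
        using True unfolding h_def by linarith
      then have "U 0 0 roll \<le> U (w * roll) (w * roll) (- roll)"
        unfolding U_roll_two_equal[of "w * roll"] by simp
      then show ?thesis using roll_eq(1) by (intro exI[of _ roll]) auto
    next
      case False
      have "(K0 + K2) * hex^2 \<le> (K0 + K2) * (w * hex)^2"
        using w hex_eq(1) K by (intro mult_left_mono_neg power_mono) (auto simp: mult_le_cancel_right1)
      then have "h hex \<ge> 0" using hex_eq(2) unfolding h_def by (simp add: algebra_simps)
      have "continuous_on {hex..roll} h" unfolding h_def by (intro continuous_intros)
      then obtain X where X: "hex \<le> X" "X \<le> roll" "h X = 0"
        using IVT2'[of h roll 0 hex] False \<open>h hex \<ge> 0\<close> hex_less_roll by auto
      have "U (w * X) (w * X) (- X) = ridge X"
        using X(3) unfolding U_two_equal_ridge[of "w * X" X] h_def by simp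
      then show ?thesis
        using ridge_ge[OF assms(1) X(1,2)] ridge_hex ridge_roll hex_eq(1) X(1)
        by (intro exI[of _ X]) auto
    qed
  qed
  then obtain X where X: "X \<ge> 0" "min (U (- hex) (- hex) (- hex)) (U 0 0 roll) \<le> U (w * X) (w * X) (- X)"
    by blast
  define t where "t = X / d"
  have t: "t \<ge> 0" using X \<open>d > 0\<close> by (simp add: t_def)
  have "U (t * a) (t * a) (- (t * d)) \<le> U (t * x) (t * y) (t * z)"
  proof (rule U_ge_two_equal)
    show "(t * x)^2 + (t * y)^2 + (t * z)^2 = 2 * (t * a)^2 + (t * d)^2"
    proof -
      have "(t * x)^2 + (t * y)^2 + (t * z)^2 = t^2 * (x^2 + y^2 + z^2)" by (simp add: algebra_simps power2_eq_square)
      then show ?thesis unfolding ad(3) by (simp add: algebra_simps power2_eq_square)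
    qed
    show "(t * x)^2 * (t * y)^2 + (t * y)^2 * (t * z)^2 + (t * z)^2 * (t * x)^2 = (t * a)^4 + 2 * (t * a)^2 * (t * d)^2"
    proof -
      have "(t * x)^2 * (t * y)^2 + (t * y)^2 * (t * z)^2 + (t * z)^2 * (t * x)^2
          = t^4 * (x^2 * y^2 + y^2 * z^2 + z^2 * x^2)"
        by (simp add: algebra_simps power2_eq_square power4_eq_xxxx)
      then show ?thesis unfolding ad(4) by (simp add: algebra_simps power2_eq_square power4_eq_xxxx)
    qed
    have "t^3 * - (a^2 * d) \<le> t^3 * (x * y * z)" using ad(5) t by (intro mult_left_mono) auto
    then show "- ((t * a)^2 * (t * d)) \<le> t * x * (t * y) * (t * z)"
      by (simp add: algebra_simps power2_eq_square power3_eq_cube)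
  qed
  moreover have "t * a = w * X" "t * d = X" using \<open>d > 0\<close> by (auto simp: t_def w_def)
  ultimately show ?thesis using radial_zero_ge[OF assms(2) t] X(2) by simp
qed

section \<open>The threshold between hexagons and roll waves\<close>

text \<open>
  The second factor is a quadratic polynomial in the hexagon amplitude. For \<open>K0 < K2\<close> its nonnegative root is the threshold
  amplitude \<open>h1\<close> of the next lemma.
\<close>

lemma level_difference:
  "- 4 * K0 * (U 0 0 roll - U (- hex) (- hex) (- hex))
     = hex^2 * (\<beta>^2 - 4 * K2 * \<beta> * hex - 2 * (K0 + 2 * K2) * (K0 - K2) * hex^2)"
proof -
  have hex: "M^2 + 4 * K0 * (M / 2 * (3 * h^2) - \<beta> * h^3 + 3 / 4 * (K0 + 2 * K2) * h^4)
      = h^2 * (\<beta>^2 - 4 * K2 * \<beta> * h - 2 * (K0 + 2 * K2) * (K0 - K2) * h^2)"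
    if M: "M = - (K0 + 2 * K2) * h^2 + \<beta> * h" for M h
    unfolding M by (simp add: field_simps power2_eq_square power3_eq_cube power4_eq_xxxx)
  have r: "K0 * roll^2 = - \<mu>" using roll_eq(2) by simp
  have "- 4 * K0 * U 0 0 roll = - 2 * \<mu> * (K0 * roll^2) - (K0 * roll^2)\<^sup>2"
    by (simp add: U_def algebra_simps power2_eq_square power4_eq_xxxx)
  also have "\<dots> = \<mu>^2" unfolding r by (simp add: power2_eq_square)
  finally have "- 4 * K0 * (U 0 0 roll - U (- hex) (- hex) (- hex))
      = \<mu>^2 + 4 * K0 * U (- hex) (- hex) (- hex)" by (simp add: algebra_simps)
  also have "\<dots> = \<mu>^2 + 4 * K0 * (\<mu> / 2 * (3 * hex^2) - \<beta> * hex^3 + 3 / 4 * (K0 + 2 * K2) * hex^4)"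
    by (simp add: U_def field_simps power2_eq_square power3_eq_cube power4_eq_xxxx)
  also have "\<dots> = hex^2 * (\<beta>^2 - 4 * K2 * \<beta> * hex - 2 * (K0 + 2 * K2) * (K0 - K2) * hex^2)"
    by (rule hex) (rule hex_eq)
  finally show ?thesis .
qed

text \<open>
  Here \<open>h1\<close> is the hexagon amplitude at which hexagons and roll waves have the same level, and \<open>mu1\<close> is the parameter
  that belongs to it. The bounds on \<open>h1\<close> and on the denominator \<open>D\<close> say that neither of the two states loses
  its transverse stability on its side of the threshold.
\<close>

lemma mu1_threshold:
  assumes "K0 < K2" and k: "k = - K0" and m: "m = - K2"
  obtains h1 D where "2 * (k + 2 * m) * (k - m) * h1^2 = 4 * m * \<beta> * h1 + \<beta>^2"
    "0 \<le> h1" "(k - m) * h1 \<le> \<beta>" "0 < D" "D \<le> (k - m)^2"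
    "mu1 \<beta> K0 K2 = (k + 2 * m) * h1^2 + \<beta> * h1" "mu1 \<beta> K0 K2 = \<beta>^2 * k / D"
proof -
  have km: "k > m" "m > 0" "k > 0" using assms(1) K by (auto simp: k m)
  define w where "w = sqrt (2 * k * (k + m))"
  define D where "D = 2 * (k + m) * w - 2 * k * (k + 3 * m)"
  have w: "w \<ge> 0" "w^2 = 2 * k * (k + m)" using km by (auto simp: w_def)
  define g where "g = k + 2 * m"
  have g: "g > 0" using km by (simp add: g_def)
  define N where "N = 2 * g * (k - m)"
  have N: "N > 0" using km g by (simp add: N_def)
  define h1 where "h1 = \<beta> * (2 * m + w) / N"
  have h1: "N * h1 = \<beta> * (2 * m + w)" using N by (simp add: h1_def)
  have c2: "0 \<le> h1" unfolding h1_def using \<beta> km w(1) N by (intro divide_nonneg_pos mult_nonneg_nonneg) auto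
  have "N * (N * h1^2 - 4 * m * \<beta> * h1 - \<beta>\<^sup>2) = (N * h1)^2 - 4 * m * \<beta> * (N * h1) - N * \<beta>^2"
    by (simp add: algebra_simps power2_eq_square)
  also have "\<dots> = \<beta>^2 * (w^2 - 4 * m^2 - N)"
    unfolding h1 by (simp add: algebra_simps power2_eq_square)
  also have "\<dots> = 0" unfolding w(2) by (simp add: N_def g_def algebra_simps power2_eq_square)
  finally have root: "N * h1^2 = 4 * m * \<beta> * h1 + \<beta>^2" using N by simp
  then have c1: "2 * (k + 2 * m) * (k - m) * h1^2 = 4 * m * \<beta> * h1 + \<beta>^2" by (simp add: N_def g_def)
  have "w \<le> 2 * (k + m)"
  proof (rule power2_le_imp_le)
    have "0 \<le> (k + m) * (2 * k + 4 * m)" using km by (intro mult_nonneg_nonneg) auto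
    then show "w^2 \<le> (2 * (k + m))^2" unfolding w(2) by (simp add: algebra_simps power2_eq_square)
  qed (use km in simp)
  then have "\<beta> * (2 * m + w) \<le> \<beta> * (2 * g)" using \<beta> by (intro mult_left_mono) (auto simp: g_def)
  then have "2 * g * ((k - m) * h1) \<le> 2 * g * \<beta>" using h1 by (simp add: N_def mult_ac)
  then have c3: "(k - m) * h1 \<le> \<beta>" using g by simp
  \<comment> \<open>The conjugate of \<open>D\<close>, by which both expressions for \<open>mu1\<close> are compared.\<close>
  have key: "(2 * k * (k + 3 * m) + 2 * (k + m) * w) * D = 4 * k * (k - m)^2 * g"
  proof -
    have "(2 * k * (k + 3 * m) + 2 * (k + m) * w) * D = 4 * (k + m)^2 * w^2 - 4 * k^2 * (k + 3 * m)^2"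
      by (simp add: D_def algebra_simps power2_eq_square)
    also have "\<dots> = 4 * k * (k - m)^2 * g"
      unfolding w(2) by (simp add: g_def algebra_simps power2_eq_square)
    finally show ?thesis .
  qed
  have "4 * k * (k - m)^2 * g > 0" using km g by simp
  moreover have "2 * k * (k + 3 * m) + 2 * (k + m) * w > 0"
    using km w(1) by (intro add_pos_nonneg mult_pos_pos mult_nonneg_nonneg) auto
  ultimately have c4: "D > 0" using key by (metis zero_less_mult_pos)
  have "2 * w \<le> 3 * k + m"
  proof (rule power2_le_imp_le)
    have "(2 * w)^2 = 8 * k * (k + m)" using w(2) by (simp add: power_mult_distrib)
    also have "\<dots> = (3 * k + m)^2 - (k - m)\<^sup>2" by (simp add: algebra_simps power2_eq_square)
    finally show "(2 * w)^2 \<le> (3 * k + m)^2" by simp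
  qed (use km in simp)
  then have "(k + m) * (2 * w) \<le> (k + m) * (3 * k + m)" using km by (intro mult_left_mono) auto
  then have c5: "D \<le> (k - m)^2" by (simp add: D_def algebra_simps power2_eq_square)
  have "sqrt 2 * sqrt (K0 * (K0 + K2)^3) = sqrt (((k + m) * w)^2)"
    unfolding real_sqrt_mult[symmetric] power_mult_distrib w(2)
    by (simp add: k m algebra_simps power2_eq_square power3_eq_cube)
  also have "\<dots> = (k + m) * w" using km w(1) by simp
  finally have "2 * sqrt 2 * sqrt (K0 * (K0 + K2)^3) - 2 * K0 * (K0 + 3 * K2) = D"
    by (simp add: D_def k m algebra_simps)
  then have mu1: "mu1 \<beta> K0 K2 = \<beta>^2 * k / D" by (simp add: mu1_def k)
  have "2 * (k - m) * (g * h1^2 + \<beta> * h1) = \<beta>^2 + 2 * (k + m) * \<beta> * h1"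
    using root by (simp add: N_def algebra_simps)
  then have "N * (2 * (k - m) * (g * h1^2 + \<beta> * h1)) = \<beta>^2 * N + 2 * (k + m) * \<beta> * (N * h1)"
    by (simp add: algebra_simps)
  also have "\<dots> = \<beta>^2 * (2 * k * (k + 3 * m) + 2 * (k + m) * w)"
    unfolding h1 by (simp add: N_def g_def algebra_simps power2_eq_square)
  finally have "N * (2 * (k - m) * (g * h1^2 + \<beta> * h1)) * D = \<beta>^2 * (4 * k * (k - m)^2 * g)"
    unfolding key[symmetric] by (simp add: mult_ac)
  moreover have "N * (2 * (k - m) * (g * h1^2 + \<beta> * h1)) * D = (4 * (k - m)^2 * g) * ((g * h1^2 + \<beta> * h1) * D)"
    by (simp add: N_def power2_eq_square)
  moreover have "\<beta>^2 * (4 * k * (k - m)^2 * g) = (4 * (k - m)^2 * g) * (\<beta>^2 * k)"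
    by simp
  ultimately have "(4 * (k - m)^2 * g) * ((g * h1^2 + \<beta> * h1) * D) = (4 * (k - m)^2 * g) * (\<beta>^2 * k)"
    by metis
  then have "(g * h1^2 + \<beta> * h1) * D = \<beta>^2 * k" using km g by simp
  then have c6: "mu1 \<beta> K0 K2 = (k + 2 * m) * h1^2 + \<beta> * h1"
    unfolding mu1 using c4 by (simp add: g_def field_simps)
  show ?thesis by (rule that[OF c1 c2 c3 c4 c5 c6 mu1])
qed

lemma weighted_squares_mono:
  fixes x y k b :: real
  assumes "0 \<le> x" "x \<le> y" "0 \<le> k"
  shows "x^2 * (k * y + b^2) \<le> y^2 * (k * x + b^2)"
proof -
  have "x * y * k * x \<le> x * y * k * y" using assms by (intro mult_left_mono) auto
  moreover have "x^2 * b^2 \<le> y^2 * b^2" using assms by (intro mult_right_mono power_mono) auto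
  ultimately show ?thesis by (simp add: algebra_simps power2_eq_square)
qed

text \<open>
  \<open>\<mu>\<close> is an increasing function of the hexagon amplitude, so \<open>\<mu> < mu1\<close> means \<open>hex < h1\<close>.
\<close>

lemma hex_level_le_roll_level:
  assumes "K0 < K2" "\<mu> < mu1 \<beta> K0 K2"
  shows "U (- hex) (- hex) (- hex) \<le> U 0 0 roll" "0 < \<beta> + (K0 - K2) * hex"
proof -
  define k m where "k = - K0" and "m = - K2"
  obtain h1 D where th: "2 * (k + 2 * m) * (k - m) * h1^2 = 4 * m * \<beta> * h1 + \<beta>^2"
    "0 \<le> h1" "(k - m) * h1 \<le> \<beta>" "0 < D" "D \<le> (k - m)^2"
    "mu1 \<beta> K0 K2 = (k + 2 * m) * h1^2 + \<beta> * h1" "mu1 \<beta> K0 K2 = \<beta>^2 * k / D"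
    using mu1_threshold[OF assms(1) k_def m_def] by blast
  have km: "k > m" "m > 0" using assms(1) K by (auto simp: k_def m_def)
  have less: "hex < h1"
  proof (rule ccontr)
    assume "\<not> hex < h1"
    then have "(k + 2 * m) * h1^2 + \<beta> * h1 \<le> (k + 2 * m) * hex^2 + \<beta> * hex"
      using th(2) km \<beta> by (intro add_mono mult_left_mono power_mono) auto
    then show False using assms(2) th(6) hex_eq(2) by (simp add: k_def m_def)
  qed
  have "(k - m) * hex < (k - m) * h1" using less km by simp
  then show "0 < \<beta> + (K0 - K2) * hex" using th(3) by (simp add: k_def m_def algebra_simps)
  define c where "c = 2 * (k + 2 * m) * (k - m)"
  have root: "c * h1^2 = 4 * m * \<beta> * h1 + \<beta>^2" using th(1) by (simp add: c_def)
  have "h1^2 * (c * hex^2) = hex^2 * (4 * m * \<beta> * h1 + \<beta>^2)" unfolding root[symmetric] by simp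
  also have "\<dots> \<le> h1^2 * (4 * m * \<beta> * hex + \<beta>^2)"
    using less hex_eq(1) km \<beta> by (intro weighted_squares_mono) auto
  finally have "c * hex^2 \<le> 4 * m * \<beta> * hex + \<beta>^2"
    by (rule mult_left_le_imp_le) (use less hex_eq(1) in simp)
  then have "0 \<le> hex^2 * (\<beta>^2 - 4 * K2 * \<beta> * hex - 2 * (K0 + 2 * K2) * (K0 - K2) * hex^2)"
    by (intro mult_nonneg_nonneg) (auto simp: c_def k_def m_def algebra_simps)
  then have "0 \<le> - 4 * K0 * (U 0 0 roll - U (- hex) (- hex) (- hex))" unfolding level_difference .
  then have "- 4 * K0 * U (- hex) (- hex) (- hex) \<le> - 4 * K0 * U 0 0 roll"
    unfolding right_diff_distrib by linarith
  then show "U (- hex) (- hex) (- hex) \<le> U 0 0 roll"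
    by (rule mult_left_le_imp_le) (use K in simp)
qed

lemma roll_level_le_hex_level:
  assumes "K0 < K2" "mu1 \<beta> K0 K2 < \<mu>"
  shows "U 0 0 roll \<le> U (- hex) (- hex) (- hex)" "\<beta> + (K0 - K2) * roll < 0"
proof -
  define k m where "k = - K0" and "m = - K2"
  obtain h1 D where th: "2 * (k + 2 * m) * (k - m) * h1^2 = 4 * m * \<beta> * h1 + \<beta>^2"
    "0 \<le> h1" "(k - m) * h1 \<le> \<beta>" "0 < D" "D \<le> (k - m)^2"
    "mu1 \<beta> K0 K2 = (k + 2 * m) * h1^2 + \<beta> * h1" "mu1 \<beta> K0 K2 = \<beta>^2 * k / D"
    using mu1_threshold[OF assms(1) k_def m_def] by blast
  have km: "k > m" "m > 0" using assms(1) K by (auto simp: k_def m_def)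
  have less: "h1 \<le> hex"
  proof (rule ccontr)
    assume "\<not> h1 \<le> hex"
    then have "(k + 2 * m) * hex^2 + \<beta> * hex \<le> (k + 2 * m) * h1^2 + \<beta> * h1"
      using hex_eq(1) km \<beta> by (intro add_mono mult_left_mono power_mono) auto
    then show False using assms(2) th(6) hex_eq(2) by (simp add: k_def m_def)
  qed
  have "\<beta>^2 * k < \<mu> * D" using assms(2) th(4) unfolding th(7) by (simp add: field_simps)
  also have "\<dots> \<le> \<mu> * (k - m)^2" using th(5) \<mu> by (intro mult_left_mono) auto
  also have "\<dots> = ((k - m) * roll)^2 * k"
    by (subst roll_eq(2)) (simp add: k_def power_mult_distrib)
  finally have "\<beta>^2 < ((k - m) * roll)^2" using km by simp
  then have "\<beta> < (k - m) * roll" by (rule power2_less_imp_less) (use km roll_eq in simp)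
  then show "\<beta> + (K0 - K2) * roll < 0" by (simp add: k_def m_def algebra_simps)
  define c where "c = 2 * (k + 2 * m) * (k - m)"
  have c: "c > 0" using km by (simp add: c_def)
  have root: "c * h1^2 = 4 * m * \<beta> * h1 + \<beta>^2" using th(1) by (simp add: c_def)
  have "c * hex^2 \<ge> 4 * m * \<beta> * hex + \<beta>^2"
  proof (cases "h1 = 0")
    case True
    then have "\<beta> = 0" using root by simp
    then show ?thesis using c by simp
  next
    case False
    then have pos: "h1 > 0" using th(2) by simp
    have "h1^2 * (4 * m * \<beta> * hex + \<beta>^2) \<le> hex^2 * (4 * m * \<beta> * h1 + \<beta>^2)"
      using less pos km \<beta> by (intro weighted_squares_mono) auto
    also have "\<dots> = h1^2 * (c * hex^2)" unfolding root[symmetric] by simp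
    finally have "h1^2 * (4 * m * \<beta> * hex + \<beta>^2) \<le> h1^2 * (c * hex^2)" .
    then show ?thesis by (rule mult_left_le_imp_le) (use pos in simp)
  qed
  then have "hex^2 * (\<beta>^2 - 4 * K2 * \<beta> * hex - 2 * (K0 + 2 * K2) * (K0 - K2) * hex^2) \<le> 0"
    by (intro mult_nonneg_nonpos) (auto simp: c_def k_def m_def algebra_simps)
  then have "- 4 * K0 * (U 0 0 roll - U (- hex) (- hex) (- hex)) \<le> 0" unfolding level_difference .
  then have "- 4 * K0 * U 0 0 roll \<le> - 4 * K0 * U (- hex) (- hex) (- hex)"
    unfolding right_diff_distrib by linarith
  then show "U 0 0 roll \<le> U (- hex) (- hex) (- hex)"
    by (rule mult_left_le_imp_le) (use K in simp)
qed

end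

section \<open>Continuously differentiable maps and norms of states\<close>

text \<open>
  Closure under sums and products yields a continuous derivative of the polynomial field below, as a bounded linear map,
  without writing this derivative down.
\<close>

definition C1_map :: "('a::euclidean_space \<Rightarrow> 'b::real_normed_vector) \<Rightarrow> bool" where
  "C1_map f \<longleftrightarrow> (\<exists>f'. (\<forall>x. (f has_derivative blinfun_apply (f' x)) (at x)) \<and> continuous_on UNIV f')"

lemma C1_mapI:
  assumes "\<And>x. (f has_derivative blinfun_apply (f' x)) (at x)" "continuous_on UNIV f'"
  shows "C1_map f"
  using assms unfolding C1_map_def by (intro exI[of _ f']) auto

lemma C1_map_linear: "bounded_linear f \<Longrightarrow> C1_map f"
  unfolding C1_map_def
  by (rule exI[of _ "\<lambda>_. Blinfun f"])
    (auto simp: bounded_linear_Blinfun_apply bounded_linear_imp_has_derivative)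

lemma C1_map_const: "C1_map (\<lambda>_. c)"
  by (rule C1_mapI[of _ "\<lambda>_. 0"]) (auto simp: zero_blinfun.rep_eq)

lemma C1_map_add:
  assumes "C1_map f" "C1_map g"
  shows "C1_map (\<lambda>x. f x + g x)"
proof -
  obtain f' g' where f': "\<And>x. (f has_derivative blinfun_apply (f' x)) (at x)" "continuous_on UNIV f'"
    and g': "\<And>x. (g has_derivative blinfun_apply (g' x)) (at x)" "continuous_on UNIV g'"
    using assms unfolding C1_map_def by metis
  have "((\<lambda>x. f x + g x) has_derivative blinfun_apply (f' x + g' x)) (at x)" for x
    unfolding blinfun.add_left by (intro has_derivative_add f'(1) g'(1))
  moreover have "continuous_on UNIV (\<lambda>x. f' x + g' x)" by (intro continuous_intros f'(2) g'(2))
  ultimately show ?thesis by (rule C1_mapI)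
qed

lemma C1_map_mult:
  fixes f g :: "'a::euclidean_space \<Rightarrow> real"
  assumes "C1_map f" "C1_map g"
  shows "C1_map (\<lambda>x. f x * g x)"
proof -
  obtain f' g' where f': "\<And>x. (f has_derivative blinfun_apply (f' x)) (at x)" "continuous_on UNIV f'"
    and g': "\<And>x. (g has_derivative blinfun_apply (g' x)) (at x)" "continuous_on UNIV g'"
    using assms unfolding C1_map_def by metis
  have cont: "continuous_on UNIV f" "continuous_on UNIV g"
    using f'(1) g'(1) by (meson continuous_at_imp_continuous_on has_derivative_continuous)+
  have "((\<lambda>x. f x * g x) has_derivative blinfun_apply (f x *\<^sub>R g' x + g x *\<^sub>R f' x)) (at x)" for x
  proof -
    have "((\<lambda>x. f x * g x) has_derivative (\<lambda>h. f x * g' x h + f' x h * g x)) (at x)"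
      by (rule has_derivative_mult[OF f'(1) g'(1)])
    moreover have "(\<lambda>h. f x * g' x h + f' x h * g x) = blinfun_apply (f x *\<^sub>R g' x + g x *\<^sub>R f' x)"
      by (auto simp: blinfun.add_left blinfun.scaleR_left)
    ultimately show ?thesis by metis
  qed
  moreover have "continuous_on UNIV (\<lambda>x. f x *\<^sub>R g' x + g x *\<^sub>R f' x)"
    by (intro continuous_intros f'(2) g'(2) cont)
  ultimately show ?thesis by (rule C1_mapI)
qed

lemma C1_map_scaleR_const:
  fixes f :: "'a::euclidean_space \<Rightarrow> real"
  assumes "C1_map f"
  shows "C1_map (\<lambda>x. f x *\<^sub>R v)"
proof -
  obtain f' where f': "\<And>x. (f has_derivative blinfun_apply (f' x)) (at x)" "continuous_on UNIV f'"
    using assms unfolding C1_map_def by metis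
  have "((\<lambda>x. f x *\<^sub>R v) has_derivative blinfun_apply (blinfun_scaleR_left v o\<^sub>L f' x)) (at x)" for x
  proof -
    have "((\<lambda>x. f x *\<^sub>R v) has_derivative (\<lambda>h. f' x h *\<^sub>R v)) (at x)"
      by (rule has_derivative_scaleR_left[OF f'(1)])
    moreover have "(\<lambda>h. f' x h *\<^sub>R v) = blinfun_apply (blinfun_scaleR_left v o\<^sub>L f' x)" by auto
    ultimately show ?thesis by metis
  qed
  moreover have "continuous_on UNIV (\<lambda>x. blinfun_scaleR_left v o\<^sub>L f' x)"
    by (intro continuous_intros f'(2))
  ultimately show ?thesis by (rule C1_mapI)
qed

lemma norm_state_squared: "(norm (a, b, c, d, e))^2 = a^2 + b^2 + c^2 + d^2 + e^2"
  for a b c d e :: real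
  by (simp add: norm_Pair)

lemma component_le_norm_state:
  fixes a b c d e :: real
  shows "\<bar>a\<bar> \<le> norm (a, b, c, d, e) \<and> \<bar>b\<bar> \<le> norm (a, b, c, d, e) \<and> \<bar>c\<bar> \<le> norm (a, b, c, d, e) \<and>
    \<bar>d\<bar> \<le> norm (a, b, c, d, e) \<and> \<bar>e\<bar> \<le> norm (a, b, c, d, e)"
  by (intro conjI; rule power2_le_imp_le; simp add: norm_state_squared)

lemma norm_state_le: "norm (a, b, c, d, e) \<le> \<bar>a\<bar> + \<bar>b\<bar> + \<bar>c\<bar> + \<bar>d\<bar> + \<bar>e\<bar>" for a b c d e :: real
  using norm_Pair_le[of a "(b, c, d, e)"] norm_Pair_le[of b "(c, d, e)"] norm_Pair_le[of c "(d, e)"]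
    norm_Pair_le[of d e] by simp

text \<open>
  The contribution of \<open>(B + g)\<^sup>2\<close> to the derivative of the Lyapunov function, where \<open>g\<close> is a partial derivative of \<open>U\<close> and
  \<open>w\<close> its rate of change: the term \<open>- g\<^sup>2 / 3\<close> dominates up to multiples of the dissipation \<open>S\<close>.
\<close>

lemma cross_term_bound:
  fixes b g w c S w0 :: real
  assumes "w^2 \<le> w0 * S" "b^2 \<le> S"
  shows "(b + g) * ((- c * b - g) / 3 + w) \<le> - g\<^sup>2 / 6 + (1 + 4 * w0 + (c + 1)^2 + \<bar>c\<bar>) * S"
proof -
  have S: "S \<ge> 0" "w0 * S \<ge> 0" using assms zero_le_power2 order_trans by blast+
  define W B2 where "W = (w - (c + 1) / 3 * b)^2" and "B2 = ((c + 1) / 3 * b)^2"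
  define p q where "p = g * (w - (c + 1) / 3 * b)" and "q = - c / 3 * b^2"
  define cS where "cS = (c + 1)^2 * S"
  have "(b + g) * ((- c * b - g) / 3 + w) = - g\<^sup>2 / 3 + p + q + b * w"
    by (simp add: p_def q_def field_simps power2_eq_square)
  moreover have "p \<le> g^2 / 6 + 3 / 2 * W"
  proof -
    have "0 \<le> 3 / 2 * (g / 3 - (w - (c + 1) / 3 * b))^2" by simp
    also have "\<dots> = g^2 / 6 + 3 / 2 * W - p"
      unfolding W_def p_def power2_diff[of "g / 3"] by (simp add: power_divide)
    finally show ?thesis by simp
  qed
  moreover have "W \<le> 2 * w^2 + 2 * B2"
  proof -
    have "W + (w + (c + 1) / 3 * b)^2 = 2 * w^2 + 2 * B2"
      unfolding W_def B2_def power2_diff power2_sum by simp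
    then show ?thesis using zero_le_power2[of "w + (c + 1) / 3 * b"] by linarith
  qed
  moreover have "B2 \<le> cS / 9"
    using mult_left_mono[OF assms(2), of "(c + 1)^2 / 9"]
    by (simp add: B2_def cS_def power_mult_distrib power_divide)
  moreover have "q \<le> \<bar>c\<bar> * S"
  proof -
    have "q \<le> \<bar>c\<bar> * b^2" unfolding q_def by (intro mult_right_mono) auto
    also have "\<dots> \<le> \<bar>c\<bar> * S" using assms(2) by (intro mult_left_mono) auto
    finally show ?thesis .
  qed
  moreover have "b * w \<le> b^2 / 2 + w^2 / 2"
    using zero_le_power2[of "b - w"] by (simp add: power2_diff)
  moreover have "cS \<ge> 0" using S by (simp add: cS_def)
  moreover have "(1 + 4 * w0 + (c + 1)^2 + \<bar>c\<bar>) * S = S + 4 * (w0 * S) + cS + \<bar>c\<bar> * S"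
    by (simp add: cS_def algebra_simps)
  ultimately show ?thesis using assms S by linarith
qed

lemma square_three_le: "(p + q + r)^2 \<le> 3 * (p^2 + q^2 + r^2)" for p q r :: real
proof -
  have "3 * (p^2 + q^2 + r^2) - (p + q + r)\<^sup>2 = (p - q)^2 + (q - r)^2 + (p - r)^2"
    by (simp add: algebra_simps power2_eq_square)
  then show ?thesis
    using zero_le_power2[of "p - q"] zero_le_power2[of "q - r"] zero_le_power2[of "p - r"] by linarith
qed

lemma abs_product_le: "\<bar>h * b\<bar> \<le> m * T" if "\<bar>h\<bar> \<le> m" "\<bar>b\<bar> \<le> T" for h b m T :: real
  using mult_mono[OF that] that by (simp add: abs_mult)

lemma has_derivative_divide_const:
  fixes c :: real
  assumes "(f has_derivative f') F"
  shows "((\<lambda>x. f x / c) has_derivative (\<lambda>h. f' h / c)) F"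
  using has_derivative_mult_left[OF assms, of "inverse c"] by (simp add: divide_inverse)

lemma proj_derivs:
  fixes s :: state
  shows "(fst has_derivative fst) (at s)"
    "((\<lambda>s. fst (snd s)) has_derivative (\<lambda>s. fst (snd s))) (at s)"
    "((\<lambda>s. fst (snd (snd s))) has_derivative (\<lambda>s. fst (snd (snd s)))) (at s)"
    "((\<lambda>s. fst (snd (snd (snd s)))) has_derivative (\<lambda>s. fst (snd (snd (snd s))))) (at s)"
    "((\<lambda>s. snd (snd (snd (snd s)))) has_derivative (\<lambda>s. snd (snd (snd (snd s))))) (at s)"
  by (rule bounded_linear_imp_has_derivative bounded_linear_fst has_derivative_fst has_derivative_snd
      has_derivative_ident)+

text \<open>
  Of the bounds on a higher-order term, the one on its derivative is enough: together with its zero at the origin it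
  makes the term a perturbation of size \<open>C * \<epsilon>\<close> in the sense of the locale \<open>mountain_pass\<close>.
\<close>

lemma higher_order_term_lipschitz:
  assumes "higher_order_term r"
  obtains C e1 where "C \<ge> 0" "e1 > 0"
    "\<And>\<epsilon> s t. 0 \<le> \<epsilon> \<Longrightarrow> \<epsilon> < e1 \<Longrightarrow> norm s \<le> R \<Longrightarrow> norm t \<le> R \<Longrightarrow>
      \<bar>r \<epsilon> s - r \<epsilon> t\<bar> \<le> C * \<epsilon> * norm (s - t)"
proof -
  obtain C e1 where C: "e1 > 0" "\<And>\<epsilon> x. 0 \<le> \<epsilon> \<Longrightarrow> \<epsilon> < e1 \<Longrightarrow> norm x \<le> R \<Longrightarrow>
      onorm (frechet_derivative (r \<epsilon>) (at x)) \<le> C * \<epsilon>"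
    using assms unfolding higher_order_term_def by (metis atLeastLessThan_iff)
  have "\<bar>r \<epsilon> s - r \<epsilon> t\<bar> \<le> \<bar>C\<bar> * \<epsilon> * norm (s - t)"
    if \<epsilon>: "0 \<le> \<epsilon>" "\<epsilon> < e1" and st: "norm s \<le> R" "norm t \<le> R" for \<epsilon> s t
  proof -
    have "norm (r \<epsilon> s - r \<epsilon> t) \<le> \<bar>C\<bar> * \<epsilon> * norm (s - t)"
    proof (rule differentiable_bound[of "cball 0 R" "r \<epsilon>" "\<lambda>x. frechet_derivative (r \<epsilon>) (at x)"])
      fix x :: state assume "x \<in> cball 0 R"
      have "r \<epsilon> differentiable (at x)" using assms \<epsilon>(1) unfolding higher_order_term_def by blast
      then show "(r \<epsilon> has_derivative frechet_derivative (r \<epsilon>) (at x)) (at x within cball 0 R)"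
        using frechet_derivative_works has_derivative_at_withinI by blast
      have "onorm (frechet_derivative (r \<epsilon>) (at x)) \<le> C * \<epsilon>" using C(2)[OF \<epsilon>] \<open>x \<in> cball 0 R\<close> by simp
      also have "\<dots> \<le> \<bar>C\<bar> * \<epsilon>" using \<epsilon> by (intro mult_right_mono) auto
      finally show "onorm (frechet_derivative (r \<epsilon>) (at x)) \<le> \<bar>C\<bar> * \<epsilon>" .
    qed (use st in auto)
    then show ?thesis by simp
  qed
  then show ?thesis using that[of "\<bar>C\<bar>" e1] C(1) by simp
qed

section \<open>The reduced system and its Lyapunov function\<close>

locale reduced_system = amplitude_potential +
  fixes c0 :: real
  assumes c0: "c0 > 0"
begin

text \<open>
  The partial derivative of \<open>U\<close> in the first argument. As \<open>U\<close> is symmetric, the other two are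
  \<open>grad y x z\<close> and \<open>grad z x y\<close>.
\<close>

definition grad :: "real \<Rightarrow> real \<Rightarrow> real \<Rightarrow> real" where
  "grad x y z = \<mu> * x + \<beta> * y * z + (K0 * x^2 + K2 * (y^2 + z^2)) * x"

definition hess_diag :: "real \<Rightarrow> real \<Rightarrow> real \<Rightarrow> real" where
  "hess_diag x y z = \<mu> + 3 * K0 * x^2 + K2 * (y^2 + z^2)"

definition hess_off :: "real \<Rightarrow> real \<Rightarrow> real \<Rightarrow> real" where
  "hess_off x y z = \<beta> * z + 2 * K2 * x * y"

text \<open>
  The derivative of \<open>grad\<close> at \<open>(x, y, z)\<close> in the direction \<open>(dx, dy, dz)\<close>: a row of the Hessian of \<open>U\<close>.
\<close>

definition dgrad :: "real \<Rightarrow> real \<Rightarrow> real \<Rightarrow> real \<Rightarrow> real \<Rightarrow> real \<Rightarrow> real" where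
  "dgrad x y z dx dy dz = hess_diag x y z * dx + hess_off x y z * dy + hess_off x z y * dz"

lemma has_derivative_grad:
  fixes X Y Z :: "'a::real_normed_vector \<Rightarrow> real"
  assumes "(X has_derivative X') (at s)" "(Y has_derivative Y') (at s)" "(Z has_derivative Z') (at s)"
  shows "((\<lambda>s. grad (X s) (Y s) (Z s)) has_derivative
    (\<lambda>h. dgrad (X s) (Y s) (Z s) (X' h) (Y' h) (Z' h))) (at s)"
  unfolding grad_def power2_eq_square
  by (rule has_derivative_eq_rhs, (rule assms has_derivative_add has_derivative_mult has_derivative_const)+)
    (simp add: dgrad_def hess_diag_def hess_off_def fun_eq_iff algebra_simps power2_eq_square)

lemma has_derivative_U:
  fixes X Y Z :: "'a::real_normed_vector \<Rightarrow> real"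
  assumes "(X has_derivative X') (at s)" "(Y has_derivative Y') (at s)" "(Z has_derivative Z') (at s)"
  shows "((\<lambda>s. U (X s) (Y s) (Z s)) has_derivative
    (\<lambda>h. grad (X s) (Y s) (Z s) * X' h + grad (Y s) (X s) (Z s) * Y' h + grad (Z s) (X s) (Y s) * Z' h)) (at s)"
  unfolding U_def power2_eq_square power4_eq_xxxx
  by (rule has_derivative_eq_rhs, (rule assms has_derivative_add has_derivative_mult has_derivative_const)+)
    (simp add: grad_def fun_eq_iff field_simps power2_eq_square)

lemma radial_grad: "radial x y z = x * grad x y z + y * grad y x z + z * grad z x y"
  by (simp add: radial_def grad_def algebra_simps power2_eq_square power4_eq_xxxx)

text \<open>
  The reduced field at \<open>\<epsilon> = 0\<close>.
\<close>

definition field :: "state \<Rightarrow> state" where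
  "field = (\<lambda>(x, b1, y, z, b3). (b1, (- c0 * b1 - grad x y z) / 3, - grad y x z / c0, b3,
     (- c0 * b3 - grad z x y) / 3))"

definition dfield :: "state \<Rightarrow> state \<Rightarrow> state" where
  "dfield = (\<lambda>(x, b1, y, z, b3) (dx, db1, dy, dz, db3).
     (db1, (- c0 * db1 - dgrad x y z dx dy dz) / 3, - dgrad y x z dy dx dz / c0, db3,
     (- c0 * db3 - dgrad z x y dz dx dy) / 3))"

lemma has_derivative_field: "(field has_derivative dfield s) (at s)"
proof -
  obtain x b1 y z b3 where s: "s = (x, b1, y, z, b3)" by (cases s) auto
  have fd: "field = (\<lambda>s. (fst (snd s),
     (- c0 * fst (snd s) - grad (fst s) (fst (snd (snd s))) (fst (snd (snd (snd s))))) / 3,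
     - grad (fst (snd (snd s))) (fst s) (fst (snd (snd (snd s)))) / c0,
     snd (snd (snd (snd s))),
     (- c0 * snd (snd (snd (snd s))) - grad (fst (snd (snd (snd s)))) (fst s) (fst (snd (snd s)))) / 3))"
    by (simp add: field_def fun_eq_iff)
  show ?thesis unfolding fd
    by (rule has_derivative_eq_rhs,
        (rule has_derivative_grad has_derivative_Pair has_derivative_divide_const has_derivative_diff
          has_derivative_minus has_derivative_mult has_derivative_const proj_derivs)+)
      (simp add: s dfield_def fun_eq_iff split_beta)
qed

lemma C1_map_grad:
  fixes X Y Z :: "'a::euclidean_space \<Rightarrow> real"
  assumes "C1_map X" "C1_map Y" "C1_map Z"
  shows "C1_map (\<lambda>s. grad (X s) (Y s) (Z s))"
  unfolding grad_def power2_eq_square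
  by (rule assms C1_map_const C1_map_add C1_map_mult)+

lemma C1_map_field: "C1_map field"
proof -
  have fd: "field = (\<lambda>s. fst (snd s) *\<^sub>R (1, 0, 0, 0, 0)
     + (- c0 / 3 * fst (snd s) + - 1 / 3 * grad (fst s) (fst (snd (snd s))) (fst (snd (snd (snd s))))) *\<^sub>R (0, 1, 0, 0, 0)
     + (- 1 / c0 * grad (fst (snd (snd s))) (fst s) (fst (snd (snd (snd s))))) *\<^sub>R (0, 0, 1, 0, 0)
     + snd (snd (snd (snd s))) *\<^sub>R (0, 0, 0, 1, 0)
     + (- c0 / 3 * snd (snd (snd (snd s))) + - 1 / 3 * grad (fst (snd (snd (snd s)))) (fst s) (fst (snd (snd s)))) *\<^sub>R (0, 0, 0, 0, 1))"
    by (simp add: field_def fun_eq_iff diff_divide_distrib)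
  have proj: "C1_map (fst :: state \<Rightarrow> real)" "C1_map (\<lambda>s::state. fst (snd s))"
    "C1_map (\<lambda>s::state. fst (snd (snd s)))" "C1_map (\<lambda>s::state. fst (snd (snd (snd s))))"
    "C1_map (\<lambda>s::state. snd (snd (snd (snd s))))"
    by (rule C1_map_linear, (rule bounded_linear_fst bounded_linear_compose[OF bounded_linear_fst]
          bounded_linear_compose[OF bounded_linear_snd] bounded_linear_snd)+)+
  show ?thesis unfolding fd
    by (rule proj C1_map_scaleR_const C1_map_grad C1_map_const C1_map_add C1_map_mult)+
qed

text \<open>
  The squares vanish at equilibria and are nonnegative elsewhere; hence a bound on \<open>lyapunov\<close> is one on \<open>U\<close>.
  Their derivatives supply the terms \<open>- (\<partial>\<^sub>1U)\<^sup>2\<close> and \<open>- (\<partial>\<^sub>3U)\<^sup>2\<close> that the dissipation of the energy lacks.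
\<close>

definition lyapunov :: "real \<Rightarrow> state \<Rightarrow> real" where
  "lyapunov \<kappa> = (\<lambda>(x, b1, y, z, b3). 3 / 2 * (b1^2 + b3^2) + U x y z
     + \<kappa> * ((b1 + grad x y z)^2 + (b3 + grad z x y)^2))"

definition dlyapunov :: "real \<Rightarrow> state \<Rightarrow> state \<Rightarrow> real" where
  "dlyapunov \<kappa> = (\<lambda>(x, b1, y, z, b3) (dx, db1, dy, dz, db3).
     3 * b1 * db1 + 3 * b3 * db3 + (grad x y z * dx + grad y x z * dy + grad z x y * dz)
     + 2 * \<kappa> * ((b1 + grad x y z) * (db1 + dgrad x y z dx dy dz)
        + (b3 + grad z x y) * (db3 + dgrad z x y dz dx dy)))"

lemma has_derivative_lyapunov: "(lyapunov \<kappa> has_derivative dlyapunov \<kappa> s) (at s)"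
proof -
  obtain x b1 y z b3 where s: "s = (x, b1, y, z, b3)" by (cases s) auto
  have fd: "lyapunov \<kappa> = (\<lambda>s. 3 / 2 * ((fst (snd s))^2 + (snd (snd (snd (snd s))))^2)
     + U (fst s) (fst (snd (snd s))) (fst (snd (snd (snd s))))
     + \<kappa> * ((fst (snd s) + grad (fst s) (fst (snd (snd s))) (fst (snd (snd (snd s)))))^2
       + (snd (snd (snd (snd s))) + grad (fst (snd (snd (snd s)))) (fst s) (fst (snd (snd s))))^2))"
    by (simp add: lyapunov_def fun_eq_iff)
  show ?thesis unfolding fd power2_eq_square
    by (rule has_derivative_eq_rhs,
        (rule has_derivative_grad has_derivative_U has_derivative_add
          has_derivative_mult has_derivative_const proj_derivs)+)
      (simp add: s dlyapunov_def fun_eq_iff split_beta algebra_simps)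
qed

lemma hess_bound:
  assumes "R > 0"
  obtains m where "m > 0" "\<And>x y z. \<bar>x\<bar> \<le> R \<Longrightarrow> \<bar>y\<bar> \<le> R \<Longrightarrow> \<bar>z\<bar> \<le> R \<Longrightarrow>
    \<bar>hess_diag x y z\<bar> \<le> m \<and> \<bar>hess_off x y z\<bar> \<le> m"
proof -
  let ?m = "\<mu> - 3 * (K0 * R^2) - 2 * (K2 * R^2) + \<beta> * R"
  have neg: "K0 * R^2 \<le> 0" "K2 * R^2 \<le> 0" "\<beta> * R \<ge> 0"
    using K \<beta> assms by (auto intro: mult_nonpos_nonneg)
  have "\<bar>hess_diag x y z\<bar> \<le> ?m \<and> \<bar>hess_off x y z\<bar> \<le> ?m"
    if xyz: "\<bar>x\<bar> \<le> R" "\<bar>y\<bar> \<le> R" "\<bar>z\<bar> \<le> R" for x y z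
  proof -
    have sq: "x^2 \<le> R^2" "y^2 \<le> R^2" "z^2 \<le> R^2"
      using power_mono[OF xyz(1), of 2] power_mono[OF xyz(2), of 2] power_mono[OF xyz(3), of 2] by simp_all
    have "\<bar>K2 * (x * y)\<bar> \<le> - K2 * (R * R)" using K xyz by (intro abs_product_le) auto
    then have xy: "\<bar>K2 * (x * y)\<bar> \<le> - (K2 * R^2)" by (simp add: power2_eq_square)
    have z: "\<bar>\<beta> * z\<bar> \<le> \<beta> * R" using \<beta> xyz by (intro abs_product_le) auto
    have lower: "K0 * R^2 \<le> K0 * x^2" "K2 * R^2 \<le> K2 * y^2" "K2 * R^2 \<le> K2 * z^2"
      using sq K by (auto intro!: mult_left_mono_neg)
    have upper: "K0 * x^2 \<le> 0" "K2 * y^2 \<le> 0" "K2 * z^2 \<le> 0"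
      using K by (auto intro: mult_nonpos_nonneg)
    have "hess_diag x y z = \<mu> + 3 * (K0 * x^2) + K2 * y^2 + K2 * z^2"
      "hess_off x y z = \<beta> * z + 2 * (K2 * (x * y))"
      by (simp_all add: hess_diag_def hess_off_def algebra_simps)
    then show ?thesis using \<mu> neg xy z lower upper unfolding abs_le_iff by linarith
  qed
  moreover have "?m > 0" using \<mu> neg by linarith
  ultimately show ?thesis using that by blast
qed

lemma dgrad_bound:
  assumes "\<bar>hess_diag x y z\<bar> \<le> m" "\<bar>hess_off x y z\<bar> \<le> m" "\<bar>hess_off x z y\<bar> \<le> m"
  shows "(dgrad x y z p q r)^2 \<le> 3 * m^2 * (p^2 + q^2 + r^2)"
proof -
  have sq: "h^2 * p^2 \<le> m^2 * p^2" if "\<bar>h\<bar> \<le> m" for h p :: real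
    using power_mono[OF that, of 2] by (intro mult_right_mono) auto
  have "(dgrad x y z p q r)^2 \<le> 3 * ((hess_diag x y z * p)^2 + (hess_off x y z * q)^2 + (hess_off x z y * r)^2)"
    unfolding dgrad_def by (rule square_three_le)
  also have "\<dots> \<le> 3 * (m^2 * p^2 + m^2 * q^2 + m^2 * r^2)"
    unfolding power_mult_distrib by (intro mult_left_mono add_mono sq assms) auto
  finally show ?thesis by (simp add: algebra_simps)
qed

lemma abs_dgrad_le:
  assumes "\<bar>hess_diag x y z\<bar> \<le> m" "\<bar>hess_off x y z\<bar> \<le> m" "\<bar>hess_off x z y\<bar> \<le> m"
    and "\<bar>p\<bar> \<le> T" "\<bar>q\<bar> \<le> T" "\<bar>r\<bar> \<le> T"
  shows "\<bar>dgrad x y z p q r\<bar> \<le> 3 * m * T"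
  using abs_product_le[OF assms(1,4)] abs_product_le[OF assms(2,5)] abs_product_le[OF assms(3,6)]
  unfolding dgrad_def by linarith

text \<open>
  The energy dissipates \<open>c0 (b1\<^sup>2 + b3\<^sup>2) + g2\<^sup>2 / c0\<close>, which absorbs the error terms of \<open>cross_term_bound\<close>
  when \<open>\<kappa>\<close> is small.
\<close>

lemma lyapunov_decrease:
  assumes "R > 0"
  obtains k where "k > 0" "\<And>\<kappa>. 0 < \<kappa> \<Longrightarrow> \<kappa> \<le> k \<Longrightarrow>
    \<exists>\<delta>>0. \<forall>s. norm s \<le> R \<longrightarrow> dlyapunov \<kappa> s (field s) \<le> - \<delta> * (norm (field s))^2"
proof -
  obtain m where m: "m > 0" "\<And>x y z. \<bar>x\<bar> \<le> R \<Longrightarrow> \<bar>y\<bar> \<le> R \<Longrightarrow> \<bar>z\<bar> \<le> R \<Longrightarrow>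
    \<bar>hess_diag x y z\<bar> \<le> m \<and> \<bar>hess_off x y z\<bar> \<le> m"
    using hess_bound[OF assms] by blast
  define w0 where "w0 = 3 * m^2 * (1 + 1 / c0^2)"
  define M where "M = 1 + 4 * w0 + (c0 + 1)^2 + \<bar>c0\<bar>"
  have w0: "w0 > 0" using m(1) c0 by (auto simp: w0_def intro!: mult_pos_pos add_pos_pos)
  then have M: "M > 0" by (auto simp: M_def intro!: add_pos_nonneg)
  define a where "a = min c0 (1 / c0)"
  have a: "a > 0" "a \<le> c0" "a \<le> 1 / c0" using c0 by (auto simp: a_def)
  define N where "N = 2 + c0^2 + 1 / c0^2"
  have N: "N > 0" using c0 by (auto simp: N_def intro!: add_pos_nonneg)
  have "\<exists>\<delta>>0. \<forall>s. norm s \<le> R \<longrightarrow> dlyapunov \<kappa> s (field s) \<le> - \<delta> * (norm (field s))^2"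
    if \<kappa>: "0 < \<kappa>" "\<kappa> \<le> a / (8 * M)" for \<kappa>
  proof -
    define \<delta> where "\<delta> = min (a / 2) (\<kappa> / 3)"
    have \<delta>: "\<delta> > 0" "\<delta> \<le> a / 2" "\<delta> \<le> \<kappa> / 3" using a \<kappa> by (auto simp: \<delta>_def)
    have "dlyapunov \<kappa> s (field s) \<le> - (\<delta> / N) * (norm (field s))^2" if "norm s \<le> R" for s
    proof -
      obtain x b1 y z b3 where s: "s = (x, b1, y, z, b3)" by (cases s) auto
      have xyz: "\<bar>x\<bar> \<le> R" "\<bar>y\<bar> \<le> R" "\<bar>z\<bar> \<le> R"
        using component_le_norm_state[of x b1 y z b3] that by (auto simp: s)
      define g1 g2 g3 where "g1 = grad x y z" and "g2 = grad y x z" and "g3 = grad z x y"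
      define S where "S = b1^2 + b3^2 + g2^2"
      define w1 w3 where "w1 = dgrad x y z b1 (- g2 / c0) b3" and "w3 = dgrad z x y b3 b1 (- g2 / c0)"
      have S: "b1^2 \<le> S" "b3^2 \<le> S" "g2^2 \<le> S" "0 \<le> S" by (auto simp: S_def)
      have vel: "b1^2 + (- g2 / c0)^2 + b3^2 \<le> (1 + 1 / c0^2) * S"
      proof -
        have "(- g2 / c0)^2 = 1 / c0^2 * g2^2" by (simp add: power_divide)
        also have "\<dots> \<le> 1 / c0^2 * S" using S by (intro mult_left_mono) auto
        finally have "(- g2 / c0)^2 \<le> 1 / c0^2 * S" .
        moreover have "b1^2 + b3^2 \<le> S" by (simp add: S_def)
        ultimately show ?thesis unfolding distrib_right by linarith
      qed
      have w_le: "3 * m^2 * (b1^2 + (- g2 / c0)^2 + b3^2) \<le> w0 * S"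
        using mult_left_mono[OF vel, of "3 * m^2"] by (simp add: w0_def mult_ac)
      have "w1^2 \<le> w0 * S"
        using dgrad_bound[of x y z m b1 "- g2 / c0" b3] m(2)[OF xyz] m(2)[OF xyz(1,3,2)] w_le
        by (simp add: w1_def)
      note c1 = cross_term_bound[OF this S(1), of g1 c0, folded M_def]
      have "w3^2 \<le> w0 * S"
        using dgrad_bound[of z x y m b3 b1 "- g2 / c0"] m(2)[OF xyz(3,1,2)] m(2)[OF xyz(3,2,1)] w_le
        by (simp add: w3_def add_ac)
      note c3 = cross_term_bound[OF this S(2), of g3 c0, folded M_def]
      have "dlyapunov \<kappa> s (field s) = - c0 * (b1^2 + b3^2) - g2\<^sup>2 / c0
          + 2 * \<kappa> * ((b1 + g1) * ((- c0 * b1 - g1) / 3 + w1) + (b3 + g3) * ((- c0 * b3 - g3) / 3 + w3))"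
      proof -
        have "3 * b * ((- c0 * b - g) / 3) + g * b = - c0 * b^2" for b g
          by (simp add: field_simps power2_eq_square)
        from this[of b1 g1] this[of b3 g3]
        have "3 * b1 * ((- c0 * b1 - g1) / 3) + 3 * b3 * ((- c0 * b3 - g3) / 3)
            + (g1 * b1 + g2 * (- g2 / c0) + g3 * b3) = - c0 * (b1^2 + b3^2) - g2\<^sup>2 / c0"
          by (simp add: power2_eq_square distrib_left)
        moreover have "dlyapunov \<kappa> s (field s) = 3 * b1 * ((- c0 * b1 - g1) / 3) + 3 * b3 * ((- c0 * b3 - g3) / 3)
            + (g1 * b1 + g2 * (- g2 / c0) + g3 * b3)
            + 2 * \<kappa> * ((b1 + g1) * ((- c0 * b1 - g1) / 3 + w1) + (b3 + g3) * ((- c0 * b3 - g3) / 3 + w3))"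
          unfolding s dlyapunov_def field_def g1_def g2_def g3_def w1_def w3_def by simp
        ultimately show ?thesis by simp
      qed
      also have "\<dots> \<le> - a * S + 2 * \<kappa> * ((- g1\<^sup>2 / 6 + M * S) + (- g3\<^sup>2 / 6 + M * S))"
      proof (intro add_mono mult_left_mono)
        have "a * (b1^2 + b3^2) \<le> c0 * (b1^2 + b3^2)" using a by (intro mult_right_mono) auto
        moreover have "a * g2^2 \<le> 1 / c0 * g2^2" using a by (intro mult_right_mono) auto
        ultimately show "- c0 * (b1^2 + b3^2) - g2\<^sup>2 / c0 \<le> - a * S"
          by (simp add: S_def algebra_simps)
      qed (use c1 c3 \<kappa> in auto)
      also have "\<dots> = - a * S + 4 * (\<kappa> * M) * S - \<kappa> / 3 * (g1^2 + g3^2)"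
        by (simp add: algebra_simps)
      also have "\<dots> \<le> - a * S + a / 2 * S - \<kappa> / 3 * (g1^2 + g3^2)"
      proof -
        have "4 * (\<kappa> * M) \<le> a / 2" using \<kappa>(2) M by (simp add: field_simps)
        then have "4 * (\<kappa> * M) * S \<le> a / 2 * S" using S(4) by (rule mult_right_mono)
        then show ?thesis by linarith
      qed
      also have "\<dots> = - (a / 2) * S - \<kappa> / 3 * (g1^2 + g3^2)" by (simp add: algebra_simps)
      also have "\<dots> \<le> - \<delta> * S - \<delta> * (g1^2 + g3^2)"
        using mult_right_mono[OF \<delta>(2) S(4)] mult_right_mono[OF \<delta>(3), of "g1^2 + g3^2"] by simp
      also have "\<dots> = - (\<delta> / N) * (N * (S + g1^2 + g3^2))" using N by (simp add: algebra_simps)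
      also have "\<dots> \<le> - (\<delta> / N) * (norm (field s))^2"
      proof (rule mult_left_mono_neg)
        have "((- c0 * b - g) / 3)^2 \<le> c0^2 * b^2 + g^2" for b g
        proof -
          define u where "u = c0 * b"
          have "9 * (u^2 + g^2) - (- u - g)\<^sup>2 = (u - g)^2 + 7 * u^2 + 7 * g^2"
            by (simp add: algebra_simps power2_eq_square)
          moreover have "0 \<le> (u - g)^2 + 7 * u^2 + 7 * g^2" by simp
          ultimately have "(- u - g)^2 \<le> 9 * (u^2 + g^2)" by linarith
          then have "((- u - g) / 3)^2 \<le> u^2 + g^2" by (simp add: power_divide)
          then show ?thesis by (simp add: u_def power_mult_distrib)
        qed
        from this[of b1 g1] this[of b3 g3]
        have "(norm (field s))^2 \<le> b1^2 + (c0^2 * b1^2 + g1^2) + 1 / c0^2 * g2^2 + b3^2 + (c0^2 * b3^2 + g3^2)"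
          by (simp add: s field_def norm_state_squared g1_def g2_def g3_def power_divide)
        also have "\<dots> \<le> N * (S + g1^2 + g3^2)"
        proof -
          have "1 / c0^2 * b^2 \<ge> 0" "c0^2 * b^2 \<ge> 0" "b^2 \<ge> 0" for b :: real by simp_all
          from this[of b1] this[of b3] this[of g1] this[of g2] this[of g3]
          show ?thesis unfolding N_def S_def distrib_left distrib_right by linarith
        qed
        finally show "(norm (field s))^2 \<le> N * (S + g1^2 + g3^2)" .
      qed (use \<delta> N in simp)
      finally show ?thesis .
    qed
    moreover have "\<delta> / N > 0" using \<delta> N by simp
    ultimately show ?thesis by blast
  qed
  moreover have "a / (8 * M) > 0" using a M by simp
  ultimately show ?thesis using that by blast
qed

text \<open>
  Every term of the differential contains \<open>b1\<close>, \<open>b3\<close> or a partial derivative of \<open>U\<close>, and these are linear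
  combinations of the components of the field.
\<close>

lemma lyapunov_gradient:
  assumes "R > 0" "\<kappa> > 0"
  obtains C where "C > 0"
    "\<And>s h. norm s \<le> R \<Longrightarrow> \<bar>dlyapunov \<kappa> s h\<bar> \<le> C * norm (field s) * norm h"
proof -
  obtain m where m: "m > 0" "\<And>x y z. \<bar>x\<bar> \<le> R \<Longrightarrow> \<bar>y\<bar> \<le> R \<Longrightarrow> \<bar>z\<bar> \<le> R \<Longrightarrow>
    \<bar>hess_diag x y z\<bar> \<le> m \<and> \<bar>hess_off x y z\<bar> \<le> m"
    using hess_bound[OF assms(1)] by blast
  let ?C = "(9 + 8 * \<kappa> * (1 + 3 * m)) * (3 + c0)"
  have "\<bar>dlyapunov \<kappa> s h\<bar> \<le> ?C * norm (field s) * norm h" if "norm s \<le> R" for s h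
  proof -
    obtain x b1 y z b3 where s: "s = (x, b1, y, z, b3)" by (cases s) auto
    obtain dx d1 dy dz d3 where h: "h = (dx, d1, dy, dz, d3)" by (cases h) auto
    have xyz: "\<bar>x\<bar> \<le> R" "\<bar>y\<bar> \<le> R" "\<bar>z\<bar> \<le> R"
      using component_le_norm_state[of x b1 y z b3] that by (auto simp: s)
    define F H where "F = norm (field s)" and "H = norm h"
    have F: "F \<ge> 0" by (simp add: F_def)
    have hb: "\<bar>dx\<bar> \<le> H" "\<bar>d1\<bar> \<le> H" "\<bar>dy\<bar> \<le> H" "\<bar>dz\<bar> \<le> H" "\<bar>d3\<bar> \<le> H"
      using component_le_norm_state[of dx d1 dy dz d3] by (simp_all add: H_def h)
    have f: "\<bar>b1\<bar> \<le> F" "\<bar>(- c0 * b1 - grad x y z) / 3\<bar> \<le> F" "\<bar>- grad y x z / c0\<bar> \<le> F"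
      "\<bar>b3\<bar> \<le> F" "\<bar>(- c0 * b3 - grad z x y) / 3\<bar> \<le> F"
      using component_le_norm_state[of b1 "(- c0 * b1 - grad x y z) / 3" "- grad y x z / c0" b3
          "(- c0 * b3 - grad z x y) / 3"]
      by (simp_all add: F_def s field_def)
    define T where "T = (3 + c0) * F"
    have cF: "0 \<le> c0 * F" using c0 F by simp
    have FT: "F \<le> T" using F cF by (simp add: T_def distrib_right)
    then have b: "\<bar>b1\<bar> \<le> T" "\<bar>b3\<bar> \<le> T" using f by auto
    have g: "\<bar>g\<bar> \<le> T" if "\<bar>b\<bar> \<le> F" "\<bar>(- c0 * b - g) / 3\<bar> \<le> F" for b g
    proof -
      have "\<bar>c0 * b\<bar> \<le> c0 * F" using that(1) c0 by (intro abs_product_le) auto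
      moreover have "\<bar>- c0 * b - g\<bar> \<le> 3 * F" using that(2) by simp
      ultimately show ?thesis unfolding T_def distrib_right by linarith
    qed
    have "\<bar>grad y x z\<bar> = c0 * \<bar>- grad y x z / c0\<bar>" using c0 by (simp add: abs_mult)
    also have "\<dots> \<le> c0 * F" using f(3) c0 by (intro mult_left_mono) auto
    also have "\<dots> \<le> T" using F by (simp add: T_def distrib_right)
    finally have g2: "\<bar>grad y x z\<bar> \<le> T" .
    have g1: "\<bar>grad x y z\<bar> \<le> T" and g3: "\<bar>grad z x y\<bar> \<le> T"
      using g[OF f(1,2)] g[OF f(4,5)] by auto
    have w1: "\<bar>d1 + dgrad x y z dx dy dz\<bar> \<le> (1 + 3 * m) * H"
      using abs_dgrad_le[of x y z m dx H dy dz] m(2)[OF xyz] m(2)[OF xyz(1,3,2)] hb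
      by (simp add: algebra_simps)
    have w3: "\<bar>d3 + dgrad z x y dz dx dy\<bar> \<le> (1 + 3 * m) * H"
      using abs_dgrad_le[of z x y m dz H dx dy] m(2)[OF xyz(3,1,2)] m(2)[OF xyz(3,2,1)] hb
      by (simp add: algebra_simps)
    have z1: "\<bar>b1 + grad x y z\<bar> \<le> 2 * T" and z3: "\<bar>b3 + grad z x y\<bar> \<le> 2 * T"
      using b g1 g3 by linarith+
    define Q where "Q = (b1 + grad x y z) * (d1 + dgrad x y z dx dy dz)
        + (b3 + grad z x y) * (d3 + dgrad z x y dz dx dy)"
    have Q: "\<bar>Q\<bar> \<le> 4 * (1 + 3 * m) * (T * H)"
      using abs_product_le[OF z1 w1] abs_product_le[OF z3 w3] unfolding Q_def by (simp add: algebra_simps)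
    have "\<bar>2 * \<kappa> * Q\<bar> \<le> 2 * \<kappa> * (4 * (1 + 3 * m) * (T * H))"
      using Q assms(2) by (intro abs_product_le) auto
    moreover have "dlyapunov \<kappa> s h = 3 * (b1 * d1) + 3 * (b3 * d3)
        + (grad x y z * dx + grad y x z * dy + grad z x y * dz) + 2 * \<kappa> * Q"
      by (simp add: s h dlyapunov_def Q_def)
    ultimately have "\<bar>dlyapunov \<kappa> s h\<bar> \<le> 9 * (T * H) + 2 * \<kappa> * (4 * (1 + 3 * m) * (T * H))"
      using abs_product_le[OF b(1) hb(2)] abs_product_le[OF b(2) hb(5)] abs_product_le[OF g1 hb(1)]
        abs_product_le[OF g2 hb(3)] abs_product_le[OF g3 hb(4)] by linarith
    also have "\<dots> = ?C * F * H" by (simp add: T_def algebra_simps)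
    finally show ?thesis by (simp add: F_def H_def)
  qed
  moreover have "?C > 0" using c0 m(1) assms(2) by (intro mult_pos_pos add_pos_pos) auto
  ultimately show ?thesis using that by blast
qed

section \<open>The well of the reduced system\<close>

definition nehari_region :: "state set" where
  "nehari_region = {(x, b1, y, z, b3). 0 \<le> radial x y z}"

lemma mem_nehari_region [simp]: "(x, b1, y, z, b3) \<in> nehari_region \<longleftrightarrow> 0 \<le> radial x y z"
  by (simp add: nehari_region_def)

lemma continuous_radial:
  "continuous_on S (\<lambda>s::state. radial (fst s) (fst (snd (snd s))) (fst (snd (snd (snd s)))))"
  unfolding radial_def by (intro continuous_intros)

lemma closed_nehari_region: "closed nehari_region"
proof -
  have "nehari_region = {s. 0 \<le> radial (fst s) (fst (snd (snd s))) (fst (snd (snd (snd s))))}"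
    by (auto simp: nehari_region_def)
  then show ?thesis
    using closed_Collect_le[OF continuous_on_const continuous_radial, of 0] by simp
qed

lemma radial_nonneg_near_zero:
  obtains r where "r > 0" "\<And>x y z. x\<^sup>2 + y^2 + z^2 < r^2 \<Longrightarrow> 0 \<le> radial x y z"
proof -
  define k where "k = - K0 - K2"
  have k: "k > 0" using K by (simp add: k_def)
  define r where "r = min 1 (\<mu> / (3 * \<beta> + 2 * k))"
  have den: "3 * \<beta> + 2 * k > 0" using \<beta> k by simp
  have "r \<le> \<mu> / (3 * \<beta> + 2 * k)" unfolding r_def by (rule min.cobounded2)
  then have "r * (3 * \<beta> + 2 * k) \<le> \<mu>" using den by (simp only: pos_le_divide_eq)
  then have r: "r > 0" "r \<le> 1" "r * (3 * \<beta> + 2 * k) \<le> \<mu>"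
    using \<mu> den by (auto simp: r_def)
  have "0 \<le> radial x y z" if "x^2 + y^2 + z^2 < r^2" for x y z
  proof -
    define s where "s = x^2 + y^2 + z^2"
    have s: "0 \<le> s" "s \<le> r^2" using that by (auto simp: s_def)
    have "x^2 \<le> r^2" using that zero_le_power2[of y] zero_le_power2[of z] by linarith
    then have x: "\<bar>x\<bar> \<le> r" using r(1) abs_le_square_iff[of x r] by simp
    have "\<bar>y * z\<bar> \<le> s"
    proof -
      have "2 * \<bar>y * z\<bar> \<le> y^2 + z^2"
        using sum_squares_bound[of "\<bar>y\<bar>" "\<bar>z\<bar>"] by (simp add: abs_mult)
      moreover have "0 \<le> x^2" "0 \<le> \<bar>y * z\<bar>" by simp_all
      ultimately show ?thesis unfolding s_def by linarith
    qed
    from abs_product_le[OF x this] have "\<bar>x * y * z\<bar> \<le> r * s" by (simp add: mult.assoc)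
    then have p: "\<beta> * (x * y * z) \<ge> - (\<beta> * (r * s))"
      using mult_left_mono[of "- (r * s)" "x * y * z" \<beta>] \<beta> by simp
    have "s^2 = (x^4 + y^4 + z^4) + 2 * (x^2 * y^2 + y^2 * z^2 + z^2 * x^2)"
      by (simp add: s_def algebra_simps power2_eq_square power4_eq_xxxx)
    moreover have "0 \<le> x^4 + y^4 + z^4" "0 \<le> x^2 * y^2 + y^2 * z^2 + z^2 * x^2" by simp_all
    ultimately have "x^4 + y^4 + z^4 \<le> s^2" "2 * (x^2 * y^2 + y^2 * z^2 + z^2 * x^2) \<le> s^2" by simp_all
    then have "K0 * (x^4 + y^4 + z^4) \<ge> K0 * s^2"
      "K2 * (2 * (x^2 * y^2 + y^2 * z^2 + z^2 * x^2)) \<ge> K2 * s^2"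
      using K by (auto intro!: mult_left_mono_neg)
    then have q: "K0 * (x^4 + y^4 + z^4) + 2 * K2 * (x^2 * y^2 + y^2 * z^2 + z^2 * x^2) \<ge> - (k * s^2)"
      by (simp add: k_def algebra_simps)
    have "s^2 \<le> r * s"
    proof -
      have "r^2 \<le> r" using r by (simp add: power2_eq_square mult_left_le)
      then have "s * s \<le> r * s" using s by (intro mult_right_mono) auto
      then show ?thesis by (simp add: power2_eq_square)
    qed
    then have "k * s^2 \<le> k * (r * s)" using k by simp
    moreover have "r * (3 * \<beta> + 2 * k) * s \<le> \<mu> * s" using r(3) s(1) by (rule mult_right_mono)
    moreover have "0 \<le> k * (r * s)" using k r s by simp
    moreover have "radial x y z = \<mu> * s + 3 * (\<beta> * (x * y * z))
        + (K0 * (x^4 + y^4 + z^4) + 2 * K2 * (x^2 * y^2 + y^2 * z^2 + z^2 * x^2))"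
      by (simp add: radial_def s_def)
    ultimately show ?thesis using p q by (simp add: algebra_simps)
  qed
  then show ?thesis using that r(1) by blast
qed

lemma U_le_lyapunov: "\<kappa> \<ge> 0 \<Longrightarrow> U x y z + 3 / 2 * (b1^2 + b3^2) \<le> lyapunov \<kappa> (x, b1, y, z, b3)"
  by (simp add: lyapunov_def)

lemma U_less_of_lyapunov_less:
  assumes "\<kappa> \<ge> 0" "lyapunov \<kappa> (x, b1, y, z, b3) < c"
  shows "U x y z < c"
proof -
  have "U x y z \<le> U x y z + 3 / 2 * (b1^2 + b3^2)" by simp
  also have "\<dots> \<le> lyapunov \<kappa> (x, b1, y, z, b3)" by (rule U_le_lyapunov[OF assms(1)])
  also have "\<dots> < c" by (rule assms(2))
  finally show ?thesis .
qed

text \<open>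
  On \<open>{U < c}\<close> the radial derivative vanishes only at \<open>A = 0\<close>, and near \<open>A = 0\<close> it is nonnegative.
\<close>

lemma nehari_region_interior:
  assumes min: "\<And>x y z. (x, y, z) \<noteq> (0, 0, 0) \<Longrightarrow> radial x y z = 0 \<Longrightarrow> c \<le> U x y z"
    and "\<kappa> \<ge> 0" "s \<in> nehari_region" "lyapunov \<kappa> s < c"
  shows "s \<in> interior nehari_region"
proof -
  obtain x b1 y z b3 where s: "s = (x, b1, y, z, b3)" by (cases s) auto
  have "U x y z < c"
    using U_less_of_lyapunov_less[OF assms(2)] assms(4) unfolding s .
  show ?thesis
  proof (cases "(x, y, z) = (0, 0, 0)")
    case True
    obtain r where r: "r > 0" "\<And>x y z. x\<^sup>2 + y^2 + z^2 < r^2 \<Longrightarrow> 0 \<le> radial x y z"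
      using radial_nonneg_near_zero by blast
    let ?O = "{s::state. (fst s)\<^sup>2 + (fst (snd (snd s)))^2 + (fst (snd (snd (snd s))))^2 < r^2}"
    have "open ?O" by (intro open_Collect_less continuous_intros)
    moreover have "s \<in> ?O" using True r(1) by (simp add: s)
    moreover have "?O \<subseteq> nehari_region" using r(2) by (auto simp: nehari_region_def)
    ultimately show ?thesis by (meson interiorI)
  next
    case False
    have "radial x y z \<noteq> 0" using min[OF False] \<open>U x y z < c\<close> by force
    then have "radial x y z > 0" using assms(3) by (simp add: s)
    let ?O = "{s::state. 0 < radial (fst s) (fst (snd (snd s))) (fst (snd (snd (snd s))))}"
    have "open ?O" by (intro open_Collect_less continuous_on_const continuous_radial)
    moreover have "s \<in> ?O" using \<open>radial x y z > 0\<close> by (simp add: s)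
    moreover have "?O \<subseteq> nehari_region" by (auto simp: nehari_region_def)
    ultimately show ?thesis by (meson interiorI)
  qed
qed

lemma field_zero_iff:
  "field (x, b1, y, z, b3) = 0 \<longleftrightarrow>
     b1 = 0 \<and> b3 = 0 \<and> grad x y z = 0 \<and> grad y x z = 0 \<and> grad z x y = 0"
  using c0 by (auto simp: field_def zero_prod_def)

lemma dfield_zero_iff:
  "dfield (x, b1, y, z, b3) (dx, d1, dy, dz, d3) = 0 \<longleftrightarrow>
     d1 = 0 \<and> d3 = 0 \<and> dgrad x y z dx dy dz = 0 \<and> dgrad y x z dy dx dz = 0 \<and> dgrad z x y dz dx dy = 0"
  using c0 by (auto simp: dfield_def zero_prod_def)

lemma radial_ray_nonneg:
  assumes "radial x y z = 0" "0 \<le> t" "t \<le> 1"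
  shows "0 \<le> radial (t * x) (t * y) (t * z)"
proof -
  have "radial (t * x) (t * y) (t * z) = t^2 * (1 - t) * (quadratic_part x y z + t * quartic_part x y z)"
    unfolding radial_ray cubic_part_on_rim[OF assms(1)]
    by (simp add: field_simps power2_eq_square power3_eq_cube power4_eq_xxxx)
  also have "\<dots> \<ge> 0" using assms parts_nonneg by simp
  finally show ?thesis .
qed

text \<open>
  A zero of \<open>grad\<close> at \<open>t = 1\<close> gives a factor \<open>1 - t\<close>.
\<close>

lemma grad_ray_bound:
  assumes "grad x y z = 0" "0 \<le> t" "t \<le> 1"
  shows "(grad (t * x) (t * y) (t * z))^2 \<le> (2 * \<bar>\<mu> * x\<bar> + \<bar>\<beta> * y * z\<bar>)^2 * (1 - t)^2"
proof -
  define u v w where "u = \<mu> * x" and "v = \<beta> * y * z" and "w = (K0 * x^2 + K2 * (y^2 + z^2)) * x"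
  have "w = - u - v" using assms(1) by (simp add: grad_def u_def v_def w_def)
  have "grad (t * x) (t * y) (t * z) = t * u + t^2 * v + t^3 * w"
    by (simp add: grad_def u_def v_def w_def algebra_simps power2_eq_square power3_eq_cube)
  also have "\<dots> = (t * (1 + t) * u + t^2 * v) * (1 - t)"
    unfolding \<open>w = - u - v\<close> by (simp add: algebra_simps power2_eq_square power3_eq_cube)
  finally have eq: "grad (t * x) (t * y) (t * z) = (t * (1 + t) * u + t^2 * v) * (1 - t)" .
  have "\<bar>t * (1 + t)\<bar> \<le> 1 * 2" using assms by (intro abs_product_le) auto
  then have "\<bar>t * (1 + t) * u\<bar> \<le> 2 * \<bar>u\<bar>" using abs_product_le[of "t * (1 + t)" 2 u "\<bar>u\<bar>"] by simp
  moreover have "t^2 \<le> 1" using assms by (simp add: power_le_one)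
  then have "\<bar>t^2 * v\<bar> \<le> 1 * \<bar>v\<bar>" by (intro abs_product_le) auto
  ultimately have "\<bar>t * (1 + t) * u + t^2 * v\<bar> \<le> 2 * \<bar>u\<bar> + \<bar>v\<bar>" by linarith
  then have "(t * (1 + t) * u + t^2 * v)^2 \<le> (2 * \<bar>u\<bar> + \<bar>v\<bar>)^2" using power_mono[of "\<bar>t * (1 + t) * u + t^2 * v\<bar>" _ 2] by simp
  then show ?thesis unfolding eq power_mult_distrib u_def v_def by (rule mult_right_mono) simp
qed

text \<open>
  Along the ray towards the origin \<open>U\<close> falls off quadratically from the rim, and the squares in \<open>lyapunov\<close> grow at most quadratically,
  with the small factor \<open>\<kappa>\<close>.
\<close>

lemma lyapunov_ray:
  assumes crit: "grad x y z = 0" "grad y x z = 0" "grad z x y = 0" and ne: "(x, y, z) \<noteq> (0, 0, 0)"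
  obtains k \<gamma> where "k > 0" "\<gamma> > 0"
    "\<And>\<kappa> s. 0 < \<kappa> \<Longrightarrow> \<kappa> \<le> k \<Longrightarrow> 0 < s \<Longrightarrow> s \<le> 1 \<Longrightarrow>
      lyapunov \<kappa> ((1 - s) * x, 0, (1 - s) * y, (1 - s) * z, 0) \<le> U x y z - \<gamma> * s^2"
proof -
  have rad: "radial x y z = 0" using crit by (simp add: radial_grad)
  define \<gamma> where "\<gamma> = \<mu> / 12 * (x^2 + y^2 + z^2)"
  have "x^2 + y^2 + z^2 > 0" using ne by (auto simp: add_nonneg_pos add_pos_nonneg)
  then have \<gamma>: "\<gamma> > 0" using \<mu> by (simp add: \<gamma>_def)
  define G1 G3 where "G1 = (2 * \<bar>\<mu> * x\<bar> + \<bar>\<beta> * y * z\<bar>)^2"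
    and "G3 = (2 * \<bar>\<mu> * z\<bar> + \<bar>\<beta> * x * y\<bar>)^2"
  define G where "G = G1 + G3 + 1"
  have G: "G > 0" unfolding G_def G1_def G3_def by (intro add_nonneg_pos add_nonneg_nonneg) auto
  have "lyapunov \<kappa> ((1 - s) * x, 0, (1 - s) * y, (1 - s) * z, 0) \<le> U x y z - \<gamma> * s^2"
    if \<kappa>: "0 < \<kappa>" "\<kappa> \<le> \<gamma> / G" and s: "0 < s" "s \<le> 1" for \<kappa> s
  proof -
    let ?t = "1 - s"
    have t: "0 \<le> ?t" "?t \<le> 1" using s by auto
    have "(grad (?t * x) (?t * y) (?t * z))^2 + (grad (?t * z) (?t * x) (?t * y))^2 \<le> G * s^2"
    proof -
      have "1 - ?t = s" by simp
      then have "(grad (?t * x) (?t * y) (?t * z))^2 \<le> G1 * s^2"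
        "(grad (?t * z) (?t * x) (?t * y))^2 \<le> G3 * s^2"
        using grad_ray_bound[OF crit(1) t] grad_ray_bound[OF crit(3) t] by (simp_all only: G1_def G3_def)
      moreover have "G * s^2 = G1 * s^2 + G3 * s^2 + s^2" by (simp add: G_def distrib_right)
      moreover have "0 \<le> s^2" by simp
      ultimately show ?thesis by linarith
    qed
    then have "\<kappa> * ((grad (?t * x) (?t * y) (?t * z))^2 + (grad (?t * z) (?t * x) (?t * y))^2) \<le> \<kappa> * (G * s^2)"
      using \<kappa> by (intro mult_left_mono) auto
    also have "\<dots> \<le> \<gamma> * s^2"
      using mult_right_mono[of "\<kappa> * G" \<gamma> "s^2"] \<kappa> G by (simp add: field_simps)
    finally have "\<kappa> * ((grad (?t * x) (?t * y) (?t * z))^2 + (grad (?t * z) (?t * x) (?t * y))^2) \<le> \<gamma> * s^2" .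
    moreover have "U x y z - U (?t * x) (?t * y) (?t * z) \<ge> 2 * \<gamma> * s^2"
      using U_max_on_ray[OF rad t(1)] by (simp add: \<gamma>_def)
    ultimately show ?thesis by (simp add: lyapunov_def)
  qed
  then show ?thesis using that[of "\<gamma> / G" \<gamma>] \<gamma> G by simp
qed

text \<open>
  The radius \<open>R\<close> is fixed before \<open>\<kappa>\<close>, which is possible because the coercivity of \<open>lyapunov\<close> on the well is uniform in \<open>\<kappa>\<close>.
\<close>

theorem lowest_pass_connects_to_zero:
  assumes crit: "grad x0 y0 z0 = 0" "grad y0 x0 z0 = 0" "grad z0 x0 y0 = 0"
    and ne: "(x0, y0, z0) \<noteq> (0, 0, 0)"
    and hess: "\<And>p q r. dgrad x0 y0 z0 p q r = 0 \<Longrightarrow> dgrad y0 x0 z0 q p r = 0 \<Longrightarrow>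
      dgrad z0 x0 y0 r p q = 0 \<Longrightarrow> p = 0 \<and> q = 0 \<and> r = 0"
    and min: "\<And>x y z. (x, y, z) \<noteq> (0, 0, 0) \<Longrightarrow> radial x y z = 0 \<Longrightarrow> U x0 y0 z0 \<le> U x y z"
  obtains R A \<eta>0 where "A > 0" "\<eta>0 > 0"
    "\<And>\<eta> g. \<lbrakk>0 \<le> \<eta>; \<eta> < \<eta>0; g 0 = 0;
        \<forall>s t. norm s \<le> R \<longrightarrow> norm t \<le> R \<longrightarrow> norm (g s - g t) \<le> \<eta> * norm (s - t)\<rbrakk> \<Longrightarrow>
      \<exists>p X. norm (p - (x0, 0, y0, z0, 0)) \<le> A * \<eta> \<and> connects_to_zero (\<lambda>s. field s + g s) p X"
proof -
  define P :: state where "P = (x0, 0, y0, z0, 0)"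
  have rad0: "radial x0 y0 z0 = 0" using crit by (simp add: radial_grad)
  define b where "b = min (\<mu> / 6) (3 / 2)"
  have b: "b > 0" "b \<le> \<mu> / 6" "b \<le> 3 / 2" using \<mu> by (auto simp: b_def)
  have coercive: "b * (norm s)^2 \<le> lyapunov \<kappa> s" if "\<kappa> \<ge> 0" "s \<in> nehari_region" for \<kappa> s
  proof -
    obtain x b1 y z b3 where s: "s = (x, b1, y, z, b3)" by (cases s) auto
    have "b * (norm s)^2 = b * (x^2 + y^2 + z^2) + b * (b1^2 + b3^2)"
      by (simp add: s norm_state_squared algebra_simps)
    also have "\<dots> \<le> \<mu> / 6 * (x^2 + y^2 + z^2) + 3 / 2 * (b1^2 + b3^2)"
      using b by (intro add_mono mult_right_mono) auto
    also have "\<dots> \<le> U x y z + 3 / 2 * (b1^2 + b3^2)" using U_coercive that(2) by (simp add: s)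
    also have "\<dots> \<le> lyapunov \<kappa> s" unfolding s by (rule U_le_lyapunov[OF that(1)])
    finally show ?thesis .
  qed
  define c where "c = U x0 y0 z0"
  have VP: "lyapunov \<kappa> P = c" for \<kappa> using crit by (simp add: P_def lyapunov_def c_def)
  have "P \<in> nehari_region" using rad0 by (simp add: P_def)
  then have "b * (norm P)^2 \<le> c" using coercive[of 0 P] VP by simp
  moreover have "0 \<le> b * (norm P)^2" using b by simp
  ultimately have "c \<ge> 0" by linarith
  \<comment> \<open>Every state of the well with \<open>lyapunov \<le> c\<close> has norm at most \<open>sqrt (c / b)\<close>.\<close>
  define R where "R = sqrt (c / b) + norm P + 1"
  have sqrt_nonneg: "sqrt (c / b) \<ge> 0" using \<open>c \<ge> 0\<close> b by simp
  have R: "R > 0" "norm P < R" using sqrt_nonneg norm_ge_zero[of P] unfolding R_def by linarith+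
  have "c < b * R^2"
  proof -
    have "(sqrt (c / b))^2 < R^2"
      using sqrt_nonneg norm_ge_zero[of P] unfolding R_def by (intro power_strict_mono) linarith+
    then have "c / b < R^2" using \<open>c \<ge> 0\<close> b by simp
    then show ?thesis using b by (simp add: field_simps)
  qed
  obtain k1 where k1: "k1 > 0" "\<And>\<kappa>. 0 < \<kappa> \<Longrightarrow> \<kappa> \<le> k1 \<Longrightarrow>
    \<exists>\<delta>>0. \<forall>s. norm s \<le> R \<longrightarrow> dlyapunov \<kappa> s (field s) \<le> - \<delta> * (norm (field s))^2"
    using lyapunov_decrease[OF R(1)] by blast
  obtain k2 \<gamma> where k2: "k2 > 0" "\<gamma> > 0"
    "\<And>\<kappa> s. 0 < \<kappa> \<Longrightarrow> \<kappa> \<le> k2 \<Longrightarrow> 0 < s \<Longrightarrow> s \<le> 1 \<Longrightarrow>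
      lyapunov \<kappa> ((1 - s) * x0, 0, (1 - s) * y0, (1 - s) * z0, 0) \<le> U x0 y0 z0 - \<gamma> * s^2"
    using lyapunov_ray[OF crit ne] by blast
  define \<kappa> where "\<kappa> = min k1 k2"
  have \<kappa>: "\<kappa> > 0" "\<kappa> \<le> k1" "\<kappa> \<le> k2" using k1 k2 by (auto simp: \<kappa>_def)
  obtain \<delta> where \<delta>: "\<delta> > 0"
    "\<And>s. norm s \<le> R \<Longrightarrow> dlyapunov \<kappa> s (field s) \<le> - \<delta> * (norm (field s))^2"
    using k1(2)[OF \<kappa>(1,2)] by blast
  obtain C where C: "C > 0"
    "\<And>s h. norm s \<le> R \<Longrightarrow> \<bar>dlyapunov \<kappa> s h\<bar> \<le> C * norm (field s) * norm h"
    using lyapunov_gradient[OF R(1) \<kappa>(1)] by blast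
  obtain f' where f': "\<And>s. (field has_derivative blinfun_apply (f' s)) (at s)" "continuous_on UNIV f'"
    using C1_map_field unfolding C1_map_def by blast
  have f'_eq: "blinfun_apply (f' s) = dfield s" for s
    using has_derivative_unique[OF f'(1) has_derivative_field] .
  define e :: state where "e = (- x0, 0, - y0, - z0, 0)"
  have ray: "P + s *\<^sub>R e = ((1 - s) * x0, 0, (1 - s) * y0, (1 - s) * z0, 0)" for s
    by (simp add: P_def e_def algebra_simps)
  have sub_c: "U x y z < c" if "lyapunov \<kappa> (x, b1, y, z, b3) < c" for x b1 y z b3
    using U_less_of_lyapunov_less[OF _ that] \<kappa> by simp
  interpret mountain_pass field f' "lyapunov \<kappa>" "dlyapunov \<kappa>" nehari_region P e R b \<delta> C \<gamma> 1
  proof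
    show "field 0 = 0" by (simp add: field_zero_iff[unfolded zero_prod_def] zero_prod_def grad_def)
    show "field P = 0" using crit by (simp add: P_def field_zero_iff)
    show "h = 0" if "blinfun_apply (f' 0) h = 0" for h
    proof -
      obtain p d1 q r d3 where h: "h = (p, d1, q, r, d3)" by (cases h) auto
      have "dfield (0, 0, 0, 0, 0) (p, d1, q, r, d3) = 0"
        using that by (simp add: f'_eq h zero_prod_def)
      then show ?thesis using \<mu>
        unfolding dfield_zero_iff by (simp add: h zero_prod_def dgrad_def hess_diag_def hess_off_def)
    qed
    show "h = 0" if "blinfun_apply (f' P) h = 0" for h
    proof -
      obtain p d1 q r d3 where h: "h = (p, d1, q, r, d3)" by (cases h) auto
      have "dfield (x0, 0, y0, z0, 0) (p, d1, q, r, d3) = 0"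
        using that by (simp add: f'_eq h P_def)
      then show ?thesis using hess[of p q r]
        unfolding dfield_zero_iff by (simp add: h zero_prod_def)
    qed
    show "P \<noteq> 0" using ne by (auto simp: P_def zero_prod_def)
    show "lyapunov \<kappa> 0 = 0" by (simp add: zero_prod_def lyapunov_def U_def grad_def)
    show "s \<in> interior nehari_region" if "s \<in> nehari_region" "lyapunov \<kappa> s < lyapunov \<kappa> P" for s
      by (rule nehari_region_interior[of c \<kappa>]) (use min that \<kappa> VP in \<open>auto simp: c_def\<close>)
    show "s = 0" if "s \<in> nehari_region" "lyapunov \<kappa> s < lyapunov \<kappa> P" "field s = 0" for s
    proof -
      obtain x b1 y z b3 where s: "s = (x, b1, y, z, b3)" by (cases s) auto
      have z: "b1 = 0" "b3 = 0" "grad x y z = 0" "grad y x z = 0" "grad z x y = 0"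
        using that(3) by (simp_all add: s field_zero_iff)
      then have "radial x y z = 0" by (simp add: radial_grad)
      moreover have "U x y z < c" using sub_c that(2) by (simp add: s VP)
      ultimately have "(x, y, z) = (0, 0, 0)" using min[of x y z] by (force simp: c_def)
      then show ?thesis using z by (simp add: s zero_prod_def)
    qed
    show "e \<noteq> 0" using ne by (auto simp: e_def zero_prod_def)
    show "P + s *\<^sub>R e \<in> nehari_region \<and> lyapunov \<kappa> (P + s *\<^sub>R e) \<le> lyapunov \<kappa> P - \<gamma> * s^2"
      if "0 < s" "s \<le> 1" for s
      unfolding ray VP using radial_ray_nonneg[OF rad0, of "1 - s"] k2(3)[OF \<kappa>(1,3) that] that
      by (simp add: c_def)
    show "lyapunov \<kappa> P < b * R^2" using \<open>c < b * R^2\<close> by (simp add: VP)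
  qed (use f' R b \<delta> C k2(2) has_derivative_lyapunov closed_nehari_region coercive[of \<kappa>] \<kappa> in auto)
  obtain A \<eta>0 where A: "A > 0" "\<eta>0 > 0"
    "\<And>\<eta> g. 0 \<le> \<eta> \<Longrightarrow> \<eta> < \<eta>0 \<Longrightarrow> perturbation \<eta> g \<Longrightarrow>
      \<exists>p X. norm (p - P) \<le> A * \<eta> \<and> connects_to_zero (\<lambda>s. field s + g s) p X"
    using heteroclinic_orbit_persists by blast
  show ?thesis by (rule that[OF A(1,2)]) (rule A(3)[unfolded P_def]; simp add: perturbation_def)
qed

lemma heteroclinic_to_trivial_of_lowest_pass:
  assumes crit: "grad x0 y0 z0 = 0" "grad y0 x0 z0 = 0" "grad z0 x0 y0 = 0"
    and ne: "(x0, y0, z0) \<noteq> (0, 0, 0)"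
    and hess: "\<And>p q r. dgrad x0 y0 z0 p q r = 0 \<Longrightarrow> dgrad y0 x0 z0 q p r = 0 \<Longrightarrow>
      dgrad z0 x0 y0 r p q = 0 \<Longrightarrow> p = 0 \<and> q = 0 \<and> r = 0"
    and min: "\<And>x y z. (x, y, z) \<noteq> (0, 0, 0) \<Longrightarrow> radial x y z = 0 \<Longrightarrow> U x0 y0 z0 \<le> U x y z"
    and hot: "higher_order_term r1" "higher_order_term r2" "higher_order_term r3"
  shows "heteroclinic_to_trivial (\<lambda>\<epsilon>. reduced_field c0 \<beta> K0 K2 \<mu> (r1 \<epsilon>) (r2 \<epsilon>) (r3 \<epsilon>))
    (equilibrium_state (x0, y0, z0))"
proof -
  show ?thesis
  proof (rule lowest_pass_connects_to_zero[OF crit ne])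
    show "p = 0 \<and> q = 0 \<and> r = 0"
      if "dgrad x0 y0 z0 p q r = 0" "dgrad y0 x0 z0 q p r = 0" "dgrad z0 x0 y0 r p q = 0" for p q r
      using that by (rule hess)
    show "U x0 y0 z0 \<le> U x y z" if "(x, y, z) \<noteq> (0, 0, 0)" "radial x y z = 0" for x y z
      using that by (rule min)
  next
    fix R A \<eta>0 :: real
    assume A: "A > 0" "\<eta>0 > 0"
      and orbit: "\<And>\<eta> g. \<lbrakk>0 \<le> \<eta>; \<eta> < \<eta>0; g 0 = 0;
        \<forall>s t. norm s \<le> R \<longrightarrow> norm t \<le> R \<longrightarrow> norm (g s - g t) \<le> \<eta> * norm (s - t)\<rbrakk> \<Longrightarrow>
      \<exists>p X. norm (p - (x0, 0, y0, z0, 0)) \<le> A * \<eta> \<and> connects_to_zero (\<lambda>s. field s + g s) p X"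
    define lip where "lip r C e \<longleftrightarrow> C \<ge> 0 \<and> e > 0 \<and>
      (\<forall>\<epsilon> s t. 0 \<le> \<epsilon> \<longrightarrow> \<epsilon> < e \<longrightarrow> norm s \<le> R \<longrightarrow> norm t \<le> R \<longrightarrow>
        \<bar>r \<epsilon> s - r \<epsilon> t\<bar> \<le> C * \<epsilon> * norm (s - t))" for r :: "real \<Rightarrow> state \<Rightarrow> real" and C e :: real
    have "\<exists>C e. lip r C e" if "higher_order_term r" for r
      using higher_order_term_lipschitz[OF that, of R] unfolding lip_def by metis
    then obtain C1 e1 C2 e2 C3 e3 where "lip r1 C1 e1" "lip r2 C2 e2" "lip r3 C3 e3"
      using hot by metis
    note C1 = this(1)[unfolded lip_def] and C2 = this(2)[unfolded lip_def] and C3 = this(3)[unfolded lip_def]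
    define C where "C = C1 + C2 / c0 + C3 + 1"
    have C: "C > 0" using C1 C2 C3 c0 by (auto simp: C_def intro!: add_nonneg_pos)
    define \<epsilon>0 where "\<epsilon>0 = Min {e1, e2, e3, \<eta>0 / C}"
    have \<epsilon>0: "\<epsilon>0 > 0" "\<epsilon>0 \<le> e1" "\<epsilon>0 \<le> e2" "\<epsilon>0 \<le> e3" "\<epsilon>0 \<le> \<eta>0 / C"
      using C1 C2 C3 A C by (auto simp: \<epsilon>0_def)
    have "\<exists>p X. dist p (equilibrium_state (x0, y0, z0)) \<le> A * C * \<epsilon> \<and>
        heteroclinic_orbit (reduced_field c0 \<beta> K0 K2 \<mu> (r1 \<epsilon>) (r2 \<epsilon>) (r3 \<epsilon>)) p A_T X"
      if "\<epsilon> \<in> {0..<\<epsilon>0}" for \<epsilon>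
    proof -
      have \<epsilon>: "0 \<le> \<epsilon>" "\<epsilon> < e1" "\<epsilon> < e2" "\<epsilon> < e3" "\<epsilon> < \<eta>0 / C" using that \<epsilon>0 by auto
      define g :: "state \<Rightarrow> state" where "g s = (0, r1 \<epsilon> s / 3, r2 \<epsilon> s / c0, 0, r3 \<epsilon> s / 3)" for s
      have F: "reduced_field c0 \<beta> K0 K2 \<mu> (r1 \<epsilon>) (r2 \<epsilon>) (r3 \<epsilon>) = (\<lambda>s. field s + g s)"
        using c0 by (auto simp: reduced_field_def field_def g_def grad_def fun_eq_iff field_simps)
      have g0: "g 0 = 0"
        using hot \<epsilon>(1) unfolding higher_order_term_def by (simp add: g_def zero_prod_def)
      have lip: "\<forall>s t. norm s \<le> R \<longrightarrow> norm t \<le> R \<longrightarrow> norm (g s - g t) \<le> C * \<epsilon> * norm (s - t)"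
      proof (intro allI impI)
        fix s t :: state assume st: "norm s \<le> R" "norm t \<le> R"
        have "norm (g s - g t) \<le> \<bar>(r1 \<epsilon> s - r1 \<epsilon> t) / 3\<bar> + \<bar>(r2 \<epsilon> s - r2 \<epsilon> t) / c0\<bar> + \<bar>(r3 \<epsilon> s - r3 \<epsilon> t) / 3\<bar>"
          using norm_state_le[of 0 "(r1 \<epsilon> s - r1 \<epsilon> t) / 3" "(r2 \<epsilon> s - r2 \<epsilon> t) / c0" 0 "(r3 \<epsilon> s - r3 \<epsilon> t) / 3"]
          by (simp add: g_def diff_divide_distrib)
        also have "\<dots> \<le> C1 * \<epsilon> * norm (s - t) + C2 * \<epsilon> * norm (s - t) / c0 + C3 * \<epsilon> * norm (s - t)"
        proof (intro add_mono)
          have "\<bar>r2 \<epsilon> s - r2 \<epsilon> t\<bar> \<le> C2 * \<epsilon> * norm (s - t)" using C2 \<epsilon>(1,3) st by blast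
          then show "\<bar>(r2 \<epsilon> s - r2 \<epsilon> t) / c0\<bar> \<le> C2 * \<epsilon> * norm (s - t) / c0"
            using c0 by (simp add: divide_right_mono)
        next
          have "\<bar>(r1 \<epsilon> s - r1 \<epsilon> t)\<bar> \<le> C1 * \<epsilon> * norm (s - t)" using C1 \<epsilon>(1,2) st by blast
          then show "\<bar>(r1 \<epsilon> s - r1 \<epsilon> t) / 3\<bar> \<le> C1 * \<epsilon> * norm (s - t)" by simp
          have "\<bar>(r3 \<epsilon> s - r3 \<epsilon> t)\<bar> \<le> C3 * \<epsilon> * norm (s - t)" using C3 \<epsilon>(1,4) st by blast
          then show "\<bar>(r3 \<epsilon> s - r3 \<epsilon> t) / 3\<bar> \<le> C3 * \<epsilon> * norm (s - t)" by simp
        qed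
        also have "\<dots> = (C1 + C2 / c0 + C3) * (\<epsilon> * norm (s - t))"
          using c0 by (simp add: field_simps)
        also have "\<dots> \<le> C * (\<epsilon> * norm (s - t))"
          using \<epsilon>(1) by (intro mult_right_mono) (auto simp: C_def)
        finally show "norm (g s - g t) \<le> C * \<epsilon> * norm (s - t)" by (simp add: mult_ac)
      qed
      have "C * \<epsilon> < \<eta>0" using \<epsilon>(5) C by (simp add: field_simps)
      moreover have "0 \<le> C * \<epsilon>" using C \<epsilon>(1) by simp
      ultimately obtain p X where p: "norm (p - (x0, 0, y0, z0, 0)) \<le> A * (C * \<epsilon>)"
        and X: "connects_to_zero (\<lambda>s. field s + g s) p X"
        using orbit[OF _ _ g0 lip] by blast
      have T: "A_T = 0" by (simp add: A_T_def equilibrium_state_def zero_prod_def)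
      have "field 0 + g 0 = 0"
        using g0 by (simp add: field_zero_iff zero_prod_def grad_def field_def)
      then show ?thesis
        using p X unfolding heteroclinic_orbit_def connects_to_zero_def F T
        by (intro exI[of _ p] exI[of _ X]) (auto simp: dist_norm equilibrium_state_def mult_ac)
    qed
    then show ?thesis unfolding heteroclinic_to_trivial_def using \<epsilon>0(1) by blast
  qed
qed

text \<open>
  The Hessian has equal diagonal entries \<open>d\<close> and equal off-diagonal entries \<open>o'\<close>, so its eigenvalues are \<open>d - o'\<close> and \<open>d + 2 o'\<close>.
  The assumption \<open>transverse\<close> makes the first one nonzero.
\<close>

lemma hexagon_orbit:
  assumes min: "\<And>x y z. (x, y, z) \<noteq> (0, 0, 0) \<Longrightarrow> radial x y z = 0 \<Longrightarrow> U (- hex) (- hex) (- hex) \<le> U x y z"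
    and transverse: "0 < \<beta> + (K0 - K2) * hex"
    and hot: "higher_order_term r1" "higher_order_term r2" "higher_order_term r3"
  shows "heteroclinic_to_trivial (\<lambda>\<epsilon>. reduced_field c0 \<beta> K0 K2 \<mu> (r1 \<epsilon>) (r2 \<epsilon>) (r3 \<epsilon>))
    (A_H_minus \<beta> K0 K2 \<mu>)"
proof -
  define a where "a = - hex"
  have a: "a < 0" using hex_eq(1) by (simp add: a_def)
  have mu: "\<mu> + \<beta> * a + (K0 + 2 * K2) * a^2 = 0" using hex_eq(2) by (simp add: a_def algebra_simps)
  have grad0: "grad a a a = 0"
  proof -
    have "grad a a a = a * (\<mu> + \<beta> * a + (K0 + 2 * K2) * a^2)"
      by (simp add: grad_def algebra_simps power2_eq_square)
    then show ?thesis using mu by simp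
  qed
  define d o' where "d = hess_diag a a a" and "o' = hess_off a a a"
  have diff: "d - o' \<noteq> 0"
  proof -
    have "d - o' = (\<mu> + \<beta> * a + (K0 + 2 * K2) * a^2) - 2 * a * (\<beta> + (K0 - K2) * - a)"
      by (simp add: d_def o'_def hess_diag_def hess_off_def algebra_simps power2_eq_square)
    then show ?thesis using mu a transverse by (simp add: a_def)
  qed
  have sum: "d + 2 * o' \<noteq> 0"
  proof -
    have "d + 2 * o' = (\<mu> + \<beta> * a + (K0 + 2 * K2) * a^2) + a * (\<beta> + 2 * (K0 + 2 * K2) * a)"
      by (simp add: d_def o'_def hess_diag_def hess_off_def algebra_simps power2_eq_square)
    moreover have "2 * (K0 + 2 * K2) * a > 0" using a K by (intro mult_neg_neg) auto
    then have "\<beta> + 2 * (K0 + 2 * K2) * a > 0" using \<beta> by linarith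
    ultimately show ?thesis using mu a by simp
  qed
  have "p = 0 \<and> q = 0 \<and> r = 0"
    if "dgrad a a a p q r = 0" "dgrad a a a q p r = 0" "dgrad a a a r p q = 0" for p q r
  proof -
    have e: "d * p + o' * q + o' * r = 0" "d * q + o' * p + o' * r = 0" "d * r + o' * p + o' * q = 0"
      using that by (simp_all add: dgrad_def d_def o'_def)
    have "(d - o') * (p - q) = 0" "(d - o') * (p - r) = 0"
      using e by (simp_all add: algebra_simps)
    then have eq: "q = p" "r = p" using diff by auto
    then have "(d + 2 * o') * p = 0" using e(1) by (simp add: algebra_simps)
    then show ?thesis using sum eq by simp
  qed
  note hess = this
  have "heteroclinic_to_trivial (\<lambda>\<epsilon>. reduced_field c0 \<beta> K0 K2 \<mu> (r1 \<epsilon>) (r2 \<epsilon>) (r3 \<epsilon>))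
    (equilibrium_state (a, a, a))"
    by (rule heteroclinic_to_trivial_of_lowest_pass[OF grad0 grad0 grad0 _ hess _ hot])
      (use a min in \<open>auto simp: a_def\<close>)
  moreover have "A_H_minus \<beta> K0 K2 \<mu> = equilibrium_state (a, a, a)"
  proof -
    have "a = (- \<beta> + sqrt (\<beta>^2 - 4 * \<mu> * (K0 + 2 * K2))) / (2 * (K0 + 2 * K2))"
      by (simp add: a_def hex_def minus_divide_left)
    then show ?thesis by (simp add: A_H_minus_def Let_def)
  qed
  ultimately show ?thesis by simp
qed

text \<open>
  The Hessian splits into the direction of the roll wave and a symmetric two-by-two block with entries \<open>d\<close> and
  \<open>\<beta> s\<close>. The assumption \<open>transverse\<close> makes the determinant of this block positive.
\<close>

lemma roll_orbit:
  assumes min: "\<And>x y z. (x, y, z) \<noteq> (0, 0, 0) \<Longrightarrow> radial x y z = 0 \<Longrightarrow> U 0 0 roll \<le> U x y z"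
    and transverse: "\<beta> + (K0 - K2) * roll < 0"
    and hot: "higher_order_term r1" "higher_order_term r2" "higher_order_term r3"
    and P0: "P0 \<in> A_R K0 \<mu>"
  shows "heteroclinic_to_trivial (\<lambda>\<epsilon>. reduced_field c0 \<beta> K0 K2 \<mu> (r1 \<epsilon>) (r2 \<epsilon>) (r3 \<epsilon>)) P0"
proof -
  obtain s where s: "s = roll \<or> s = - roll"
    and P0: "P0 \<in> equilibrium_state ` {(s, 0, 0), (0, s, 0), (0, 0, s)}"
    using P0 unfolding A_R_def roll_def by blast
  have s2: "s^2 = roll^2" and ne: "s \<noteq> 0" using s roll_eq(1) by auto
  have mu: "\<mu> + K0 * s^2 = 0" using roll_eq(2) s2 by simp
  have level: "U s 0 0 = U 0 0 roll" "U 0 s 0 = U 0 0 roll" "U 0 0 s = U 0 0 roll"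
    using s by (auto simp: U_def)
  have grads: "grad s 0 0 = 0" "grad 0 s 0 = 0" "grad 0 0 s = 0"
  proof -
    have "grad s 0 0 = s * (\<mu> + K0 * s^2)" by (simp add: grad_def algebra_simps)
    then show "grad s 0 0 = 0" using mu by simp
  qed (simp_all add: grad_def)
  define d where "d = \<mu> + K2 * s^2"
  have "(\<beta> * s)^2 < d^2"
  proof (rule power2_strict_mono)
    have "d = (\<mu> + K0 * s^2) - (K0 - K2) * roll * roll"
      unfolding s2[symmetric] power2_eq_square d_def using s by (auto simp: algebra_simps power2_eq_square)
    then have "d = - ((K0 - K2) * roll) * roll" using mu by simp
    moreover have "\<beta> * roll < - ((K0 - K2) * roll) * roll"
      using transverse roll_eq(1) by (intro mult_strict_right_mono) auto
    moreover have "\<bar>\<beta> * s\<bar> = \<beta> * roll" using s \<beta> roll_eq(1) by (auto simp: abs_mult)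
    ultimately show "\<bar>\<beta> * s\<bar> < \<bar>d\<bar>" by linarith
  qed
  then have det: "d^2 - (\<beta> * s)\<^sup>2 \<noteq> 0" by simp
  have lin: "q = 0 \<and> r = 0" if "d * q + \<beta> * s * r = 0" "d * r + \<beta> * s * q = 0" for q r
  proof -
    have "(d^2 - (\<beta> * s)\<^sup>2) * q = d * (d * q + \<beta> * s * r) - \<beta> * s * (d * r + \<beta> * s * q)"
      "(d^2 - (\<beta> * s)\<^sup>2) * r = d * (d * r + \<beta> * s * q) - \<beta> * s * (d * q + \<beta> * s * r)"
      by (simp_all add: algebra_simps power2_eq_square)
    then have "(d^2 - (\<beta> * s)\<^sup>2) * q = 0" "(d^2 - (\<beta> * s)\<^sup>2) * r = 0"
      unfolding that by (simp_all only: mult_zero_right diff_self)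
    then show ?thesis using det by (simp only: mult_eq_0_iff) blast
  qed
  have diag: "hess_diag s 0 0 \<noteq> 0"
  proof -
    have "hess_diag s 0 0 = 3 * (\<mu> + K0 * s^2) - 2 * \<mu>" by (simp add: hess_diag_def)
    then show ?thesis using mu \<mu> by simp
  qed
  have h: "hess_diag 0 s 0 = d" "hess_diag 0 0 s = d" "hess_off s 0 0 = 0" "hess_off 0 s 0 = 0"
    "hess_off 0 0 s = \<beta> * s"
    by (simp_all add: hess_diag_def hess_off_def d_def)
  consider "P0 = equilibrium_state (s, 0, 0)" | "P0 = equilibrium_state (0, s, 0)"
    | "P0 = equilibrium_state (0, 0, s)" using P0 by blast
  then show ?thesis
  proof cases
    case 1
    have "p = 0 \<and> q = 0 \<and> r = 0"
      if "dgrad s 0 0 p q r = 0" "dgrad 0 s 0 q p r = 0" "dgrad 0 s 0 r p q = 0" for p q r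
      using that diag lin[of q r] by (simp add: dgrad_def h)
    note hess = this
    show ?thesis unfolding 1
      by (rule heteroclinic_to_trivial_of_lowest_pass[OF grads(1) grads(2) grads(2) _ hess _ hot])
        (use ne min level in auto)
  next
    case 2
    have "p = 0 \<and> q = 0 \<and> r = 0"
      if "dgrad 0 s 0 p q r = 0" "dgrad s 0 0 q p r = 0" "dgrad 0 0 s r p q = 0" for p q r
      using that diag lin[of p r] by (simp add: dgrad_def h)
    note hess = this
    show ?thesis unfolding 2
      by (rule heteroclinic_to_trivial_of_lowest_pass[OF grads(2) grads(1) grads(3) _ hess _ hot])
        (use ne min level in auto)
  next
    case 3
    have "p = 0 \<and> q = 0 \<and> r = 0"
      if "dgrad 0 0 s p q r = 0" "dgrad 0 0 s q p r = 0" "dgrad s 0 0 r p q = 0" for p q r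
      using that diag lin[of p q] by (simp add: dgrad_def h)
    note hess = this
    show ?thesis unfolding 3
      by (rule heteroclinic_to_trivial_of_lowest_pass[OF grads(3) grads(3) grads(1) _ hess _ hot])
        (use ne min level in auto)
  qed
qed

end

theorem theorem4p13:
  fixes c0 \<beta>2 K0 K2 :: real
    and r1 r2 r3 :: "real \<Rightarrow> real \<Rightarrow> state \<Rightarrow> real"
    and F :: "real \<Rightarrow> real \<Rightarrow> state \<Rightarrow> state"
  assumes "c0 > 0" and "\<beta>2 \<ge> 0" and "K0 < 0" and "K2 < 0"
    and "\<And>\<mu>0. \<mu>0 > 0 \<Longrightarrow>
           higher_order_term (r1 \<mu>0) \<and> higher_order_term (r2 \<mu>0) \<and> higher_order_term (r3 \<mu>0)"
  defines "F \<equiv> \<lambda>\<mu>0 \<epsilon>. reduced_field c0 \<beta>2 K0 K2 \<mu>0 (r1 \<mu>0 \<epsilon>) (r2 \<mu>0 \<epsilon>) (r3 \<mu>0 \<epsilon>)"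
  shows "(K2 < K0 \<longrightarrow>
            (\<forall>\<mu>0>0. heteroclinic_to_trivial (F \<mu>0) (A_H_minus \<beta>2 K0 K2 \<mu>0))) \<and>
         (K2 \<in> {K0<..<0} \<longrightarrow>
            (\<forall>\<mu>0\<in>{0<..<mu1 \<beta>2 K0 K2}.
               heteroclinic_to_trivial (F \<mu>0) (A_H_minus \<beta>2 K0 K2 \<mu>0)) \<and>
            (\<forall>\<mu>0>mu1 \<beta>2 K0 K2.
               \<forall>P0\<in>A_R K0 \<mu>0. heteroclinic_to_trivial (F \<mu>0) P0))"
proof (intro conjI impI allI ballI)
  fix \<mu>0 :: real
  assume less: "K2 < K0" and \<mu>: "\<mu>0 > 0"
  interpret reduced_system \<mu>0 \<beta>2 K0 K2 c0 by unfold_locales (use assms \<mu> in auto)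
  show "heteroclinic_to_trivial (F \<mu>0) (A_H_minus \<beta>2 K0 K2 \<mu>0)"
    unfolding F_def
  proof (rule hexagon_orbit)
    have "0 < (K0 - K2) * hex" using less hex_eq(1) by simp
    then show "0 < \<beta>2 + (K0 - K2) * hex" using assms(2) by linarith
  qed (use hex_lowest_of_K2_le_K0 less assms(5)[OF \<mu>] in auto)
next
  fix \<mu>0 :: real
  assume between: "K2 \<in> {K0<..<0}" and \<mu>0: "\<mu>0 \<in> {0<..<mu1 \<beta>2 K0 K2}"
  interpret reduced_system \<mu>0 \<beta>2 K0 K2 c0 by unfold_locales (use assms \<mu>0 in auto)
  show "heteroclinic_to_trivial (F \<mu>0) (A_H_minus \<beta>2 K0 K2 \<mu>0)"
    unfolding F_def
  proof (rule hexagon_orbit)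
    show "U (- hex) (- hex) (- hex) \<le> U x y z" if "(x, y, z) \<noteq> (0, 0, 0)" "radial x y z = 0" for x y z
      using hex_or_roll_lowest[OF _ that(2,1)] hex_level_le_roll_level(1) between \<mu>0 by simp
    show "0 < \<beta>2 + (K0 - K2) * hex" using hex_level_le_roll_level(2) between \<mu>0 by simp
  qed (use assms(5)[of \<mu>0] \<mu>0 in auto)
next
  fix \<mu>0 :: real and P0 :: state
  assume between: "K2 \<in> {K0<..<0}" and gt: "mu1 \<beta>2 K0 K2 < \<mu>0" and P0: "P0 \<in> A_R K0 \<mu>0"
  have "0 \<le> mu1 \<beta>2 K0 K2"
  proof -
    \<comment> \<open>The value of \<open>mu1\<close> does not depend on \<open>\<mu>\<close>, so any positive one will do.\<close>
    interpret amplitude_potential 1 \<beta>2 K0 K2 by unfold_locales (use assms in auto)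
    obtain D where "0 < D" "mu1 \<beta>2 K0 K2 = \<beta>2^2 * (- K0) / D"
      using mu1_threshold[OF _ refl refl] between by (metis greaterThanLessThan_iff)
    then show ?thesis using assms by (simp add: divide_nonpos_pos mult_nonneg_nonpos)
  qed
  then have \<mu>: "\<mu>0 > 0" using gt by simp
  interpret reduced_system \<mu>0 \<beta>2 K0 K2 c0 by unfold_locales (use assms \<mu> in auto)
  show "heteroclinic_to_trivial (F \<mu>0) P0"
    unfolding F_def
  proof (rule roll_orbit)
    show "U 0 0 roll \<le> U x y z" if "(x, y, z) \<noteq> (0, 0, 0)" "radial x y z = 0" for x y z
      using hex_or_roll_lowest[OF _ that(2,1)] roll_level_le_hex_level(1) between gt by simp
    show "\<beta>2 + (K0 - K2) * roll < 0" using roll_level_le_hex_level(2) between gt by simp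
  qed (use assms(5)[OF \<mu>] P0 in auto)
qed

end
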